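(* Let $p\in[0,1)$ and let $(\boldsymbol{\sigma}_n)_{n\ge1}$ be a sequence of random permutations, $\boldsymbol\sigma_n$ of size $n$, such that $\mu_{\boldsymbol\sigma_n}$ converges in distribution to the Brownian separable permuton $\boldsymbol\mu^p$. Then $\mathrm{LIS}(\boldsymbol\sigma_n)/n$ converges to $0$ in probability.
   Context: A permuton is a probability measure on $[0,1]^2$ with uniform marginals; the space of permutons carries the topology of weak convergence of measures. For a permutation $\sigma$ of size $n$, $\mu_\sigma$ is the permuton with density $(x,y)\mapsto n\,\mathbf 1_{\sigma(\lceil nx\rceil)=\lceil ny\rceil}$. $\mathrm{LIS}(\sigma)$ is the maximal length of an increasing subsequence of $\sigma$ (indices $i_1<\dots<i_k$ with $\sigma(i_1)<\dots<\sigma(i_k)$). Brownian separable permuton: let $\mathfrak e$ be a Brownian excursion of length one on $[0,1]$; a.s. its local minima are strict with distinct values and countably many; enumerate their positions $(b_i)_{i\ge 1}$ measurably and attach i.i.d. signs $s_i\in\{\oplus,\ominus\}$ with $\mathbb P(s_i=\oplus)=p$, independent of $\mathfrak e$. For $x\neq y$ let $\mathrm{Dec}(x,y)$ be the sign of the local minimum at which $\mathfrak e$ attains its minimum on $[\min(x,y),\max(x,y)]$ (an arbitrary convention on the null set where this is ill-defined). Define $\psi(t)=\mathrm{Leb}\{s\in[0,t):\mathrm{Dec}(s,t)=\oplus\}+\mathrm{Leb}\{s\in(t,1]:\mathrm{Dec}(s,t)=\ominus\}$. Then $\boldsymbol\mu^p$ is the pushforward of Lebesgue measure on $[0,1]$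 by $t\mapsto(t,\psi(t))$. *)

theory Defs
  imports "HOL-Probability.Probability"
begin

section \<open>Permutons\<close>

abbreviation unit_square :: "(real \<times> real) set" where
  "unit_square \<equiv> {0..1} \<times> {0..1}"

definition permutons :: "(real \<times> real) measure set" where
  "permutons = {\<mu>. prob_space \<mu> \<and> sets \<mu> = sets (restrict_space borel unit_square) \<and>
     distr \<mu> borel fst = uniform_measure lborel {0..1} \<and>
     distr \<mu> borel snd = uniform_measure lborel {0..1}}"

text \<open>
  The topology of weak convergence: the coarsest topology on the set of permutons that makes
  \<open>\<mu> \<mapsto> \<integral> f d\<mu>\<close> continuous for every continuous \<open>f\<close> on the (compact) unit square.
\<close>
definition permuton_topology :: "(real \<times> real) measure topology" where
  "permuton_topology = topology_generated_by
     {{\<mu> \<in> permutons. (\<integral>z. f z \<partial>\<mu>) \<in> U} | f U.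
        continuous_on unit_square (f :: real \<times> real \<Rightarrow> real) \<and> open (U :: real set)}"

definition permuton_borel :: "(real \<times> real) measure measure" where
  "permuton_borel = sigma permutons {A. openin permuton_topology A}"

text \<open>
  A permutation of size \<open>n\<close> is a function that \<open>permutes {1..n}\<close>.  On the null set where
  \<open>x = 0\<close> or \<open>y = 0\<close> the value of the density is irrelevant.
\<close>
definition permuton_of_perm :: "nat \<Rightarrow> (nat \<Rightarrow> nat) \<Rightarrow> (real \<times> real) measure" where
  "permuton_of_perm n \<sigma> = density (restrict_space lborel unit_square)
     (\<lambda>(x, y). ennreal (real n * of_bool (\<sigma> (nat \<lceil>real n * x\<rceil>) = nat \<lceil>real n * y\<rceil>)))"

definition LIS :: "nat \<Rightarrow> (nat \<Rightarrow> nat) \<Rightarrow> nat" where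
  "LIS n \<sigma> = Max {card I | I. I \<subseteq> {1..n} \<and> strict_mono_on I \<sigma>}"

definition random_permutation :: "nat \<Rightarrow> 'a measure \<Rightarrow> ('a \<Rightarrow> nat \<Rightarrow> nat) \<Rightarrow> bool" where
  "random_permutation n M \<sigma> \<longleftrightarrow>
     prob_space M \<and> \<sigma> \<in> measurable M (count_space {\<pi>. \<pi> permutes {1..n}})"

text \<open>
  Convergence in distribution, each random element being allowed its own probability space.
\<close>
definition converges_in_distribution ::
  "'c topology \<Rightarrow> (nat \<Rightarrow> 'a measure) \<Rightarrow> (nat \<Rightarrow> 'a \<Rightarrow> 'c) \<Rightarrow> 'b measure \<Rightarrow> ('b \<Rightarrow> 'c) \<Rightarrow> bool" where
  "converges_in_distribution T P X Q Y \<longleftrightarrow>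
     (\<forall>F :: 'c \<Rightarrow> real. continuous_map T euclideanreal F \<and> bounded (F ` topspace T) \<longrightarrow>
        (\<lambda>n. \<integral>\<omega>. F (X n \<omega>) \<partial>P n) \<longlonglongrightarrow> (\<integral>\<omega>. F (Y \<omega>) \<partial>Q))"

section \<open>Brownian excursion\<close>

text \<open>
  \<open>hitting_density x\<close> is the density of the hitting time of \<open>0\<close> by Brownian motion started at
  \<open>x > 0\<close>, i.e. \<open>t \<mapsto> x / sqrt (2 \<pi> t^3) * exp (- x^2 / (2 t))\<close>; \<open>killed_density t x y\<close> is the
  transition density of Brownian motion killed at \<open>0\<close>.
\<close>
definition hitting_density :: "real \<Rightarrow> real \<Rightarrow> real" where
  "hitting_density x t = x / t * normal_density 0 (sqrt t) x"

definition killed_density :: "real \<Rightarrow> real \<Rightarrow> real \<Rightarrow> real" where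
  "killed_density t x y = normal_density x (sqrt t) y - normal_density x (sqrt t) (- y)"

text \<open>
  The joint density, in the variables \<open>x 0, \<dots>, x (k - 1)\<close>, of the normalised Brownian excursion at
  the times \<open>0 < t 0 < \<dots> < t (k - 1) < 1\<close> (for \<open>k \<ge> 1\<close>).
\<close>
definition excursion_density :: "nat \<Rightarrow> (nat \<Rightarrow> real) \<Rightarrow> (nat \<Rightarrow> real) \<Rightarrow> real" where
  "excursion_density k t x =
     (if \<forall>i<k. 0 < x i
      then 2 * sqrt (2 * pi) * hitting_density (x 0) (t 0) *
           (\<Prod>i<k - 1. killed_density (t (Suc i) - t i) (x i) (x (Suc i))) *
           hitting_density (x (k - 1)) (1 - t (k - 1))
      else 0)"

text \<open>
  The Brownian excursion of length one is the continuous process with the finite-dimensional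
  distributions above; these determine its law on the space of continuous functions.
\<close>
definition brownian_excursion :: "'a measure \<Rightarrow> ('a \<Rightarrow> real \<Rightarrow> real) \<Rightarrow> bool" where
  "brownian_excursion M e \<longleftrightarrow>
     prob_space M \<and>
     (\<forall>t\<in>{0..1}. (\<lambda>\<omega>. e \<omega> t) \<in> borel_measurable M) \<and>
     (\<forall>\<omega>\<in>space M. continuous_on {0..1} (e \<omega>) \<and> e \<omega> 0 = 0 \<and> e \<omega> 1 = 0) \<and>
     (\<forall>k\<ge>1. \<forall>t. strict_mono_on {..<k} t \<and> t ` {..<k} \<subseteq> {0<..<1} \<longrightarrow>
        distributed M (Pi\<^sub>M {..<k} (\<lambda>_. lborel)) (\<lambda>\<omega>. \<lambda>i\<in>{..<k}. e \<omega> (t i))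
          (\<lambda>x. ennreal (excursion_density k t x)))"

section \<open>The Brownian separable permuton\<close>

text \<open>
  Only interior local minima count: the end points \<open>0\<close> and \<open>1\<close>, where an excursion vanishes,
  are excluded.
\<close>
definition local_minima :: "(real \<Rightarrow> real) \<Rightarrow> real set" where
  "local_minima f = {u \<in> {0<..<1}. \<forall>\<^sub>F v in nhds u. f u \<le> f v}"

text \<open>
  Signs are booleans, \<open>True\<close> standing for \<open>\<oplus>\<close>.  The sequence \<open>b\<close> enumerates the positions of the
  local minima of \<open>f\<close> and \<open>s i\<close> is the sign attached to \<open>b i\<close>.  When no unique local minimum
  realises the minimum of \<open>f\<close> between \<open>x\<close> and \<open>y\<close>, \<open>THE\<close> returns an arbitrary index.
\<close>
definition Dec :: "(real \<Rightarrow> real) \<Rightarrow> (nat \<Rightarrow> real) \<Rightarrow> (nat \<Rightarrow> bool) \<Rightarrow> real \<Rightarrow> real \<Rightarrow> bool" where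
  "Dec f b s x y = s (THE i. b i \<in> {min x y..max x y} \<and> (\<forall>z\<in>{min x y..max x y}. f (b i) \<le> f z))"

definition psi :: "(real \<Rightarrow> real) \<Rightarrow> (nat \<Rightarrow> real) \<Rightarrow> (nat \<Rightarrow> bool) \<Rightarrow> real \<Rightarrow> real" where
  "psi f b s t = measure lborel {u \<in> {0..<t}. Dec f b s u t} +
                 measure lborel {u \<in> {t<..1}. \<not> Dec f b s u t}"

definition permuton_of_signed_excursion ::
  "(real \<Rightarrow> real) \<Rightarrow> (nat \<Rightarrow> real) \<Rightarrow> (nat \<Rightarrow> bool) \<Rightarrow> (real \<times> real) measure" where
  "permuton_of_signed_excursion f b s =
     distr (restrict_space lborel {0..1}) (restrict_space borel unit_square) (\<lambda>t. (t, psi f b s t))"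

text \<open>The sigma-algebras generated by the process \<open>(e t)\<close>, \<open>0 \<le> t \<le> 1\<close>, and by all the signs.\<close>
definition path_algebra :: "'a measure \<Rightarrow> ('a \<Rightarrow> real \<Rightarrow> real) \<Rightarrow> 'a measure" where
  "path_algebra M e =
     vimage_algebra (space M) (\<lambda>\<omega>. \<lambda>t\<in>{0..1}. e \<omega> t) (Pi\<^sub>M {0..1} (\<lambda>_. borel))"

definition sign_algebra :: "'a measure \<Rightarrow> (nat \<Rightarrow> 'a \<Rightarrow> bool) \<Rightarrow> 'a measure" where
  "sign_algebra M s =
     vimage_algebra (space M) (\<lambda>\<omega> i. s i \<omega>) (Pi\<^sub>M UNIV (\<lambda>_. count_space UNIV))"

text \<open>
  The enumeration \<open>b\<close> has to be measurable with respect to the sigma-algebra generated by \<open>e\<close>, so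
  that the signs, being independent of \<open>e\<close>, are independent of the pair \<open>(e, b)\<close>.  The
  construction is an actual permuton only almost surely, hence the random permuton \<open>X\<close> is required
  to agree with it almost everywhere.
\<close>
definition brownian_separable_permuton ::
  "real \<Rightarrow> 'a measure \<Rightarrow> ('a \<Rightarrow> (real \<times> real) measure) \<Rightarrow> bool" where
  "brownian_separable_permuton p M X \<longleftrightarrow>
     prob_space M \<and> X \<in> measurable M permuton_borel \<and>
     (\<exists>(e :: 'a \<Rightarrow> real \<Rightarrow> real) (b :: nat \<Rightarrow> 'a \<Rightarrow> real) (s :: nat \<Rightarrow> 'a \<Rightarrow> bool).
        brownian_excursion M e \<and>
        (\<forall>i. b i \<in> borel_measurable (path_algebra M e)) \<and>
        (AE \<omega> in M. bij_betw (\<lambda>i. b i \<omega>) UNIV (local_minima (e \<omega>))) \<and>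
        prob_space.indep_vars M (\<lambda>_. count_space UNIV) s UNIV \<and>
        (\<forall>i. distr M (count_space UNIV) (s i) = measure_pmf (bernoulli_pmf p)) \<and>
        prob_space.indep_set M (sets (path_algebra M e)) (sets (sign_algebra M s)) \<and>
        (AE \<omega> in M. X \<omega> = permuton_of_signed_excursion (e \<omega>) (\<lambda>i. b i \<omega>) (\<lambda>i. s i \<omega>)))"

end

theory Submission
  imports Defs
begin

text \<open>
  The increasing points of a permutation form a chain of \<open>[0,1]\<^sup>2\<close>.  Discretising chains on finer and
  finer grids gives weakly continuous functionals that dominate \<open>LIS / n\<close>, and by compactness they
  tend to \<open>0\<close> at every permuton that gives no mass to closed chains.  It remains to see that the
  Brownian separable permuton almost surely has this property.  A chain of positive mass would yield
  a set \<open>A\<close> of times, of positive measure, any two elements of which have sign \<open>\<oplus>\<close>.  As the step of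
  an arithmetic progression of length \<open>k\<close> tends to \<open>0\<close>, almost every progression starting in \<open>A\<close>
  stays in \<open>A\<close>; but the signs along a fixed progression are attached to distinct minima, so that they
  are all \<open>\<oplus>\<close> with probability \<open>p ^ k\<close> only.  Letting \<open>k\<close> tend to infinity shows that \<open>A\<close> is null.
  The same argument with the relation \<open>e x \<le> e y\<close> shows that almost no time is a one-sided local
  minimum of the excursion.
\<close>

section \<open>The mass of discretised chains\<close>

text \<open>A chain of the permuton only says that \<psi> is weakly increasing along it, and equal
  values of \<psi> do not determine a sign. Two facts close the gap. The order of the points defined
  by the signs is transitive, so a sign \<ominus> between x < y forces \<psi> y \<le> \<psi> x. And
  the uniform second marginal makes every level set of \<psi> null, while a monotone function takes
  at most countably many values twice; off a null set a chain thus carries only signs \<oplus>.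
  Distinctness of the minima along a progression has two sources: no term of the progression is
  itself a minimiser, so the minimisers lie in disjoint open intervals, and minimal values over
  separated intervals differ, so each minimiser is unique. Both are estimates on finite-dimensional
  laws, made tractable by comparison with a Gaussian walk. Weak convergence only controls continuous
  functionals. The resolution m of the grid is therefore fixed while n tends to infinity, and m
  tends to infinity afterwards, under the limit law alone.\<close>

lemma topspace_permuton_topology: "topspace permuton_topology = permutons"
proof -
  have "permutons \<in> {{\<mu> \<in> permutons. (\<integral>z. f z \<partial>\<mu>) \<in> U} | f U.
        continuous_on unit_square (f :: real \<times> real \<Rightarrow> real) \<and> open (U :: real set)}"
    by (rule CollectI, rule exI[of _ "\<lambda>_. 0"], rule exI[of _ UNIV]) auto
  then show ?thesis
    unfolding permuton_topology_def topology_generated_by_topspace by blast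
qed

lemma continuous_map_permuton_integral:
  fixes f :: "real \<times> real \<Rightarrow> real"
  assumes "continuous_on unit_square f"
  shows "continuous_map permuton_topology euclideanreal (\<lambda>\<mu>. \<integral>z. f z \<partial>\<mu>)"
  unfolding continuous_map_def topspace_permuton_topology
proof (intro conjI allI impI)
  fix U :: "real set" assume "openin euclideanreal U"
  then have "{\<mu> \<in> permutons. (\<integral>z. f z \<partial>\<mu>) \<in> U} \<in> {{\<mu> \<in> permutons. (\<integral>z. f z \<partial>\<mu>) \<in> U} | f U.
        continuous_on unit_square (f :: real \<times> real \<Rightarrow> real) \<and> open (U :: real set)}"
    using assms open_openin by blast
  then show "openin permuton_topology {\<mu> \<in> permutons. (\<integral>z. f z \<partial>\<mu>) \<in> U}"
    unfolding permuton_topology_def by (rule topology_generated_by_Basis)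
qed auto

lemma continuous_map_Max:
  fixes f :: "'i \<Rightarrow> 'a \<Rightarrow> real"
  assumes "finite S" "S \<noteq> {}" "\<And>i. i \<in> S \<Longrightarrow> continuous_map T euclideanreal (f i)"
  shows "continuous_map T euclideanreal (\<lambda>x. Max ((\<lambda>i. f i x) ` S))"
  using assms
proof (induction S rule: finite_ne_induct)
  case (singleton i) then show ?case by simp
next
  case (insert i S)
  then have "continuous_map T euclideanreal (\<lambda>x. max (f i x) (Max ((\<lambda>i. f i x) ` S)))"
    by (intro continuous_map_real_max) auto
  then show ?case using insert by (simp add: Max_insert)
qed

lemma measurable_permuton_borel_continuous:
  assumes "continuous_map permuton_topology euclideanreal F"
  shows "F \<in> borel_measurable permuton_borel"
proof (rule borel_measurableI)
  fix U :: "real set" assume "open U"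
  then have *: "openin permuton_topology {\<mu> \<in> permutons. F \<mu> \<in> U}"
    using assms unfolding continuous_map_def topspace_permuton_topology by auto
  have sub: "{A. openin permuton_topology A} \<subseteq> Pow permutons"
    using openin_subset topspace_permuton_topology by blast
  have "F -` U \<inter> space permuton_borel = {\<mu> \<in> permutons. F \<mu> \<in> U}"
    unfolding permuton_borel_def using sub by (auto simp: space_measure_of_conv)
  then show "F -` U \<inter> space permuton_borel \<in> sets permuton_borel"
    using * sub unfolding permuton_borel_def by (simp add: sigma_sets.Basic)
qed

text \<open>Only strict inversions are excluded. Ties must be allowed, because both rounding to a
  grid and passing to a limit create them.\<close>

definition is_chain :: "(real \<times> real) set \<Rightarrow> bool" where
  "is_chain K \<longleftrightarrow> (\<forall>z\<in>K. \<forall>w\<in>K. \<not> (fst z < fst w \<and> snd w < snd z))"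

definition grid :: "nat \<Rightarrow> (real \<times> real) set" where
  "grid m = (\<lambda>(a, b). (real a / real m, real b / real m)) ` ({..m} \<times> {..m})"

definition grid_chains :: "nat \<Rightarrow> (real \<times> real) set set" where
  "grid_chains m = {K. K \<subseteq> grid m \<and> K \<noteq> {} \<and> is_chain K}"

text \<open>A continuous cut-off, equal to 1 within 3 / m of K and to 0 beyond 4 / m. The 3 is the
  total error in \<open>LIS_le_chain_mass\<close>: 2 / m for rounding to the grid and 1 / m for
  moving from a small square to its corner.\<close>

definition tent :: "nat \<Rightarrow> (real \<times> real) set \<Rightarrow> real \<times> real \<Rightarrow> real" where
  "tent m K z = max 0 (min 1 (4 - real m * infdist z K))"

text \<open>The family of grid chains is finite, so this maximum stays continuous for weak
  convergence.\<close>

definition chain_mass :: "nat \<Rightarrow> (real \<times> real) measure \<Rightarrow> real" where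
  "chain_mass m \<mu> = Max ((\<lambda>K. \<integral>z. tent m K z \<partial>\<mu>) ` grid_chains m)"

section \<open>Elementary properties of grid chains and their smoothed mass\<close>

lemma finite_grid: "finite (grid m)" by (simp add: grid_def)

lemma grid_subset: "m > 0 \<Longrightarrow> grid m \<subseteq> unit_square"
  by (auto simp: grid_def field_simps)

lemma grid_chains_nonempty: "grid_chains m \<noteq> {}"
proof -
  have "{(real 0 / real m, real 0 / real m)} \<in> grid_chains m"
    unfolding grid_chains_def grid_def is_chain_def by force
  then show ?thesis by blast
qed

lemma finite_grid_chains: "finite (grid_chains m)"
  by (rule finite_subset[of _ "Pow (grid m)"]) (auto simp: grid_chains_def finite_grid)

lemma tent_nonneg: "0 \<le> tent m K z" and tent_le_1: "tent m K z \<le> 1"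
  by (auto simp: tent_def)

lemma continuous_on_tent: "continuous_on A (tent m K)"
  unfolding tent_def by (intro continuous_intros)

lemma borel_measurable_tent [measurable]: "tent m K \<in> borel_measurable borel"
  by (intro borel_measurable_continuous_onI continuous_on_tent)

lemma continuous_chain_mass:
  "continuous_map permuton_topology euclideanreal (chain_mass m)"
proof -
  have "continuous_map permuton_topology euclideanreal
     (\<lambda>\<mu>. Max ((\<lambda>K. \<integral>z. tent m K z \<partial>\<mu>) ` grid_chains m))"
    by (intro continuous_map_Max finite_grid_chains grid_chains_nonempty
      continuous_map_permuton_integral continuous_on_tent)
  then show ?thesis by (simp add: chain_mass_def[abs_def])
qed

lemma chain_mass_nonneg: "0 \<le> chain_mass m \<mu>"
proof -
  obtain K where K: "K \<in> grid_chains m" using grid_chains_nonempty by blast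
  have "0 \<le> (\<integral>z. tent m K z \<partial>\<mu>)" by (simp add: tent_nonneg)
  also have "\<dots> \<le> chain_mass m \<mu>"
    unfolding chain_mass_def using K by (intro Max_ge) (auto simp: finite_grid_chains)
  finally show ?thesis .
qed

lemma chain_mass_attained:
  obtains K where "K \<in> grid_chains m" "chain_mass m \<mu> = (\<integral>z. tent m K z \<partial>\<mu>)"
proof -
  have "chain_mass m \<mu> \<in> (\<lambda>K. \<integral>z. tent m K z \<partial>\<mu>) ` grid_chains m"
    unfolding chain_mass_def by (rule Max_in) (auto simp: finite_grid_chains grid_chains_nonempty)
  then show ?thesis using that by blast
qed

lemma permutonD:
  assumes "\<mu> \<in> permutons"
  shows "prob_space \<mu>" "sets \<mu> = sets (restrict_space borel unit_square)" "space \<mu> = unit_square"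
proof -
  show "prob_space \<mu>" and *: "sets \<mu> = sets (restrict_space borel unit_square)"
    using assms by (auto simp: permutons_def)
  show "space \<mu> = unit_square" using sets_eq_imp_space_eq[OF *] by (simp add: space_restrict_space)
qed

lemma borel_measurable_permuton:
  assumes "\<mu> \<in> permutons" "f \<in> borel_measurable borel"
  shows "f \<in> borel_measurable \<mu>"
proof -
  have "f \<in> borel_measurable (restrict_space borel unit_square)"
    using assms(2) by (rule measurable_restrict_space1)
  then show ?thesis using permutonD(2)[OF assms(1)] by (simp cong: measurable_cong_sets)
qed

lemma sets_permutonI:
  assumes "\<mu> \<in> permutons" "A \<in> sets borel" "A \<subseteq> unit_square"
  shows "A \<in> sets \<mu>"
  unfolding permutonD(2)[OF assms(1)] using assms(2,3) by (auto simp: sets_restrict_space)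

lemma chain_mass_le_1:
  assumes "\<mu> \<in> permutons"
  shows "chain_mass m \<mu> \<le> 1"
proof -
  interpret prob_space \<mu> using permutonD(1)[OF assms] .
  obtain K where K: "K \<in> grid_chains m" "chain_mass m \<mu> = (\<integral>z. tent m K z \<partial>\<mu>)"
    by (rule chain_mass_attained)
  have "(\<integral>z. tent m K z \<partial>\<mu>) \<le> (\<integral>z. 1 \<partial>\<mu>)"
    by (rule integral_mono') (auto simp: tent_nonneg tent_le_1)
  then show ?thesis using K by (simp add: prob_space)
qed

lemma chain_mass_le_measure:
  assumes "\<mu> \<in> permutons"
  obtains K where "K \<in> grid_chains m"
     "chain_mass m \<mu> \<le> measure \<mu> {z \<in> unit_square. real m * infdist z K \<le> 4}"
proof -
  interpret prob_space \<mu> using permutonD(1)[OF assms] .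
  obtain K where K: "K \<in> grid_chains m" "chain_mass m \<mu> = (\<integral>z. tent m K z \<partial>\<mu>)"
    by (rule chain_mass_attained)
  let ?B = "{z \<in> unit_square. real m * infdist z K \<le> 4}"
  have "closed (unit_square \<inter> {z. real m * infdist z K \<le> 4})"
  proof (rule closed_Int)
    show "closed unit_square" by (simp add: closed_Times)
    have "continuous_on UNIV (\<lambda>z. real m * infdist z K)" by (intro continuous_intros)
    then show "closed {z. real m * infdist z K \<le> 4}"
      by (intro closed_Collect_le continuous_on_const)
  qed
  moreover have "?B = unit_square \<inter> {z. real m * infdist z K \<le> 4}" by auto
  ultimately have "?B \<in> sets borel" using borel_closed by simp
  then have "?B \<in> sets \<mu>"
    by (rule sets_permutonI[OF assms]) blast
  then have "(\<integral>z. tent m K z \<partial>\<mu>) \<le> (\<integral>z. indicator ?B z \<partial>\<mu>)"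
  proof (intro integral_mono')
    show "integrable \<mu> (indicator ?B :: _ \<Rightarrow> real)"
      using \<open>?B \<in> sets \<mu>\<close> by (intro integrable_real_indicator) (auto simp: less_top[symmetric])
  qed (auto simp: tent_nonneg tent_def permutonD(3)[OF assms] indicator_def)
  also have "\<dots> = measure \<mu> ?B"
    using \<open>?B \<in> sets \<mu>\<close> by simp
  finally show ?thesis using K that by auto
qed

section \<open>Rounding points to the grid\<close>

definition grid_round :: "nat \<Rightarrow> real \<times> real \<Rightarrow> real \<times> real" where
  "grid_round m z = (real (nat \<lceil>real m * fst z\<rceil>) / real m, real (nat \<lceil>real m * snd z\<rceil>) / real m)"

lemma dist_round_real:
  fixes x :: real
  assumes "m > 0" "0 \<le> x"
  shows "\<bar>x - real (nat \<lceil>real m * x\<rceil>) / real m\<bar> \<le> 1 / real m"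
proof -
  have "0 \<le> \<lceil>real m * x\<rceil>" using assms by (smt (verit) ceiling_less_zero mult_nonneg_nonneg of_nat_0_le_iff)
  then have "real (nat \<lceil>real m * x\<rceil>) = of_int \<lceil>real m * x\<rceil>" by simp
  moreover have "real m * x \<le> of_int \<lceil>real m * x\<rceil>" "of_int \<lceil>real m * x\<rceil> \<le> real m * x + 1"
    by linarith+
  ultimately have "\<bar>real m * x - real (nat \<lceil>real m * x\<rceil>)\<bar> \<le> 1" by linarith
  moreover have "x - real (nat \<lceil>real m * x\<rceil>) / real m = (real m * x - real (nat \<lceil>real m * x\<rceil>)) / real m"
    using assms by (simp add: field_simps)
  ultimately show ?thesis using assms by (simp add: divide_right_mono)
qed

lemma grid_round_in_grid:
  assumes "m > 0" "z \<in> unit_square"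
  shows "grid_round m z \<in> grid m"
proof -
  have *: "nat \<lceil>real m * x\<rceil> \<le> m" if "x \<le> 1" for x :: real
  proof -
    have "real m * x \<le> real m" using that by (simp add: mult_left_le)
    then have "\<lceil>real m * x\<rceil> \<le> int m" by (intro ceiling_le) simp
    then show ?thesis by (simp only: nat_le_iff)
  qed
  have "fst z \<le> 1" "snd z \<le> 1" using assms by auto
  then have "(nat \<lceil>real m * fst z\<rceil>, nat \<lceil>real m * snd z\<rceil>) \<in> {..m} \<times> {..m}"
    using * by simp
  then show ?thesis unfolding grid_def grid_round_def by (rule rev_image_eqI) simp
qed

lemma dist_grid_round:
  assumes "m > 0" "z \<in> unit_square"
  shows "dist z (grid_round m z) \<le> 2 / real m"
proof -
  obtain x y where z: "z = (x, y)" by (cases z)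
  have "dist z (grid_round m z) \<le> \<bar>x - real (nat \<lceil>real m * x\<rceil>) / real m\<bar>
      + \<bar>y - real (nat \<lceil>real m * y\<rceil>) / real m\<bar>"
    unfolding z grid_round_def dist_Pair_Pair dist_real_def fst_conv snd_conv
    by (rule order_trans[OF sqrt_sum_squares_le_sum_abs]) simp
  also have "\<dots> \<le> 1 / real m + 1 / real m"
    using assms by (intro add_mono dist_round_real) (auto simp: z)
  finally show ?thesis by simp
qed

lemma fst_diff_le_dist: "\<bar>fst z - fst w\<bar> \<le> dist z w" for z w :: "real \<times> real"
  using dist_fst_le[of z w] by (simp add: dist_real_def)

lemma snd_diff_le_dist: "\<bar>snd z - snd w\<bar> \<le> dist z w" for z w :: "real \<times> real"
  using dist_snd_le[of z w] by (simp add: dist_real_def)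

text \<open>
  Compactness of chains in the Hausdorff metric, by a diagonal argument: along a subsequence, the set
  of points of the grid \<open>j\<close> that are close to the chain is eventually constant, for every \<open>j\<close>.
\<close>

lemma chain_mass_limit:
  assumes \<mu>: "\<mu> \<in> permutons" and inf: "infinite {m. m > 0 \<and> c \<le> chain_mass m \<mu>}"
  obtains C where "closed C" "C \<subseteq> unit_square" "is_chain C" "c \<le> measure \<mu> C"
proof -
  interpret prob_space \<mu> using permutonD(1)[OF \<mu>] .
  define S0 where "S0 = {m. m > 0 \<and> c \<le> chain_mass m \<mu>}"
  define N where "N m K = {z \<in> unit_square. real m * infdist z K \<le> 4}" for m K
  have "\<exists>K. K \<in> grid_chains m \<and> chain_mass m \<mu> \<le> measure \<mu> (N m K)" for m
    by (rule chain_mass_le_measure[OF \<mu>, of m]) (auto simp: N_def)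
  then obtain K where K: "\<And>m. K m \<in> grid_chains m" "\<And>m. chain_mass m \<mu> \<le> measure \<mu> (N m (K m))"
    by metis
  \<comment> \<open>The radius 2 / j is the rounding error of \<open>grid_round j\<close>: every
    point of \<open>K m\<close> has its rounding in \<open>T j m\<close>.\<close>
  define T where "T j m = {g \<in> grid j. \<exists>w\<in>K m. dist w g \<le> 2 / real j}" for j m
  have "\<exists>S. \<forall>j. (infinite (S j) \<and> S j \<subseteq> S0 \<and> (\<exists>t. \<forall>m\<in>S j. T j m = t)) \<and> S (Suc j) \<subseteq> S j"
  proof (rule dependent_nat_choice)
    have fin: "finite (T j ` S)" for j S
      by (rule finite_subset[of _ "Pow (grid j)"]) (auto simp: T_def finite_grid)
    have step: "\<exists>S'. (infinite S' \<and> S' \<subseteq> S0 \<and> (\<exists>t. \<forall>m\<in>S'. T j m = t)) \<and> S' \<subseteq> S"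
      if S: "infinite S" "S \<subseteq> S0" for S j
    proof -
      obtain a where "a \<in> S" "infinite {b \<in> S. T j b = T j a}"
        using pigeonhole_infinite[OF S(1) fin] by blast
      with S(2) show ?thesis by (intro exI[of _ "{b \<in> S. T j b = T j a}"]) auto
    qed
    show "\<exists>S. infinite S \<and> S \<subseteq> S0 \<and> (\<exists>t. \<forall>m\<in>S. T 0 m = t)"
      using step[of S0 0] inf by (auto simp: S0_def)
    show "\<exists>S'. (infinite S' \<and> S' \<subseteq> S0 \<and> (\<exists>t. \<forall>m\<in>S'. T (Suc j) m = t)) \<and> S' \<subseteq> S"
      if "infinite S \<and> S \<subseteq> S0 \<and> (\<exists>t. \<forall>m\<in>S. T j m = t)" for S j
      using step[of S "Suc j"] that by blast
  qed
  then obtain S where *: "\<forall>j. (infinite (S j) \<and> S j \<subseteq> S0 \<and> (\<exists>t. \<forall>m\<in>S j. T j m = t)) \<and> S (Suc j) \<subseteq> S j"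
    by (rule exE)
  have S: "infinite (S j)" "S j \<subseteq> S0" "\<exists>t. \<forall>m\<in>S j. T j m = t" "S (Suc j) \<subseteq> S j" for j
    using *[rule_format, of j] by (iprover elim: conjE)+
  then obtain t where t: "\<And>j m. m \<in> S j \<Longrightarrow> T j m = t j" by metis
  have anti: "S j \<subseteq> S i" if "i \<le> j" for i j
    using lift_Suc_antimono_le[of S i j] S(4) that by blast
  have tfin: "finite (t j)" for j
  proof -
    obtain m where "m \<in> S j" using S(1)[of j] infinite_imp_nonempty by blast
    then have "t j \<subseteq> grid j" using t by (auto simp: T_def)
    then show ?thesis using finite_grid finite_subset by blast
  qed
  \<comment> \<open>For m \<ge> 4 * j the 4 / m neighbourhood of \<open>K m\<close> adds at most 1 /
    j to the rounding error 2 / j, whence the radius 3 / j.\<close>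
  define D where "D j = unit_square \<inter> (\<Union>g\<in>t j. cball g (3 / real j))" for j
  have Dcl: "closed (D j)" for j
    unfolding D_def using tfin by (intro closed_Int closed_UN closed_Times) auto
  have Nsub: "N m (K m) \<subseteq> D j" if "m \<in> S j" "j > 0" "m \<ge> 4 * j" for m j
  proof
    fix z assume z: "z \<in> N m (K m)"
    have Kg: "K m \<subseteq> grid m" "K m \<noteq> {}" using K(1)[of m] by (auto simp: grid_chains_def)
    then have "compact (K m)" using finite_grid finite_subset finite_imp_compact by blast
    then obtain w where w: "w \<in> K m" "infdist z (K m) = dist z w"
      using infdist_attains_inf[of "K m" z] Kg(2) compact_imp_closed by blast
    have m0: "m > 0" using that by simp
    have "real m * dist z w \<le> 4" using z w by (simp add: N_def)
    then have "dist z w \<le> 4 / real m" using m0 by (simp add: field_simps)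
    also have "\<dots> \<le> 1 / real j" using that m0 by (simp add: field_simps flip: of_nat_mult)
    finally have zw: "dist z w \<le> 1 / real j" .
    have wu: "w \<in> unit_square" using w(1) Kg(1) grid_subset[OF m0] by blast
    let ?g = "grid_round j w"
    have "dist w ?g \<le> 2 / real j" "?g \<in> grid j"
      using dist_grid_round grid_round_in_grid wu that by blast+
    then have "?g \<in> t j" using w(1) t[OF that(1)] by (auto simp: T_def)
    moreover have "dist ?g z \<le> 3 / real j"
      using zw \<open>dist w ?g \<le> 2 / real j\<close> dist_triangle[of ?g z w]
      by (simp add: dist_commute add_divide_distrib[symmetric])
    ultimately show "z \<in> D j" using z by (auto simp: D_def N_def)
  qed
  define A where "A J = (\<Inter>i\<le>J. D (Suc i))" for J :: nat
  have Asets: "A J \<in> sets \<mu>" for J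
    unfolding A_def
    by (rule sets_permutonI[OF \<mu>])
      (auto intro!: borel_closed closed_INT Dcl, auto simp: D_def)
  have cA: "c \<le> measure \<mu> (A J)" for J
  proof -
    \<comment> \<open>Such an m belongs to all the earlier sets of the decreasing sequence S, so one
      and the same neighbourhood of mass at least c lies in every \<open>D (Suc i)\<close> with i
      \<le> J.\<close>
    obtain m where m: "m \<in> S (Suc J)" "m \<ge> 4 * Suc J"
      using S(1)[of "Suc J"] unfolding infinite_nat_iff_unbounded_le by blast
    have "N m (K m) \<subseteq> A J" unfolding A_def
    proof (rule INT_greatest)
      fix i assume "i \<in> {..J}"
      then show "N m (K m) \<subseteq> D (Suc i)"
        using m anti[of "Suc i" "Suc J"] by (intro Nsub) auto
    qed
    then have "measure \<mu> (N m (K m)) \<le> measure \<mu> (A J)"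
      by (rule finite_measure_mono[OF _ Asets])
    moreover have "c \<le> chain_mass m \<mu>" using m(1) S(2) by (auto simp: S0_def)
    ultimately show ?thesis using K(2)[of m] by linarith
  qed
  define C where "C = (\<Inter>J. A J)"
  have CD: "C = (\<Inter>j. D (Suc j))" by (auto simp: C_def A_def)
  have "(\<lambda>J. measure \<mu> (A J)) \<longlonglongrightarrow> measure \<mu> C"
    unfolding C_def using Asets
    by (intro finite_Lim_measure_decseq) (auto simp: decseq_def A_def)
  then have "c \<le> measure \<mu> C"
    using cA by (intro LIMSEQ_le_const[of _ _ c]) auto
  moreover have "is_chain C"
    unfolding is_chain_def
  proof (intro ballI notI)
    fix z w assume zw: "z \<in> C" "w \<in> C" and inc: "fst z < fst w \<and> snd w < snd z"
    \<comment> \<open>The inversion has a gap d in both coordinates. Each of its points will be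
      moved by at most 3 / j + 2 / j = 5 / j, so 10 / j < d preserves it.\<close>
    define d where "d = min (fst w - fst z) (snd z - snd w)"
    have "d > 0" using inc by (simp add: d_def)
    then obtain i where i: "inverse (real (Suc i)) < d / 10"
      using reals_Archimedean[of "d / 10"] by auto
    define j where "j = Suc i"
    have j: "10 / real j < d" using i by (simp add: j_def field_simps)
    have "z \<in> D j" "w \<in> D j" using zw by (auto simp: CD j_def)
    then obtain g h where gh: "g \<in> t j" "dist g z \<le> 3 / real j" "h \<in> t j" "dist h w \<le> 3 / real j"
      by (auto simp: D_def)
    \<comment> \<open>As \<open>T j m\<close> is the same set for all m in \<open>S j\<close>, one m
      serves both g and h. The inversion is thus transported to points of the single chain
      \<open>K m\<close>.\<close>
    obtain m where m: "m \<in> S j" using S(1)[of j] infinite_imp_nonempty by blast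
    then have "g \<in> T j m" "h \<in> T j m" using t gh by auto
    then obtain k l where kl: "k \<in> K m" "dist k g \<le> 2 / real j" "l \<in> K m" "dist l h \<le> 2 / real j"
      by (auto simp: T_def)
    have "dist k z \<le> 5 / real j" "dist l w \<le> 5 / real j"
      using kl gh dist_triangle[of k z g] dist_triangle[of l w h]
      by (auto simp: add_divide_distrib[symmetric])
    moreover have "10 / real j = 5 / real j + 5 / real j" by simp
    ultimately have "fst k < fst l" "snd l < snd k"
      using j fst_diff_le_dist[of k z] fst_diff_le_dist[of l w]
        snd_diff_le_dist[of k z] snd_diff_le_dist[of l w]
      unfolding d_def by linarith+
    then show False using K(1)[of m] kl by (auto simp: grid_chains_def is_chain_def)
  qed
  moreover have "closed C" unfolding CD using Dcl by blast
  moreover have "C \<subseteq> unit_square" by (auto simp: CD D_def)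
  ultimately show ?thesis using that by blast
qed

section \<open>Longest increasing subsequences and the mass of grid chains\<close>

lemma permuton_of_perm_density_measurable:
  "(\<lambda>(x, y). ennreal (real n * of_bool (\<sigma> (nat \<lceil>real n * x\<rceil>) = nat \<lceil>real n * y\<rceil>)))
     \<in> borel_measurable (borel :: (real \<times> real) measure)"
proof -
  have [measurable]: "(\<lambda>z :: real \<times> real. nat \<lceil>real n * fst z\<rceil>) \<in> measurable borel (count_space UNIV)"
    "(\<lambda>z :: real \<times> real. nat \<lceil>real n * snd z\<rceil>) \<in> measurable borel (count_space UNIV)"
    unfolding borel_prod[symmetric] by measurable
  show ?thesis unfolding case_prod_beta
    by (rule measurable_compose_countable[where g = "\<lambda>z. nat \<lceil>real n * fst z\<rceil>"],
        rule measurable_compose_countable[where g = "\<lambda>z. nat \<lceil>real n * snd z\<rceil>"]) measurable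
qed

lemma nat_ceiling_eq:
  fixes x :: real
  assumes "n > 0" "(real i - 1) / real n < x" "x \<le> real i / real n"
  shows "nat \<lceil>real n * x\<rceil> = i"
proof -
  have "real i - 1 < real n * x" "real n * x \<le> real i"
    using assms by (auto simp: field_simps)
  then have "\<lceil>real n * x\<rceil> = int i" by (intro ceiling_unique) auto
  then show ?thesis by simp
qed

text \<open>Each index of an increasing subsequence carries mass 1 / n, spread over a square of side
  1 / n. Rounding is monotone in each coordinate, so the rounded corners of these squares form a
  grid chain, and its tent equals 1 on all of them. The condition n \<ge> 2 * m keeps each square
  within 2 / n \<le> 1 / m of its corner.\<close>

lemma LIS_le_chain_mass:
  assumes perm: "\<sigma> permutes {1..n}" and m: "m > 0" and n: "n \<ge> 2 * m"
  shows "real (LIS n \<sigma>) / real n \<le> chain_mass m (permuton_of_perm n \<sigma>)"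
proof -
  have "n > 0" using m n by simp
  have fin: "finite {card I | I. I \<subseteq> {1..n} \<and> strict_mono_on I \<sigma>}"
    by (rule finite_subset[of _ "card ` Pow {1..n}"]) auto
  have "LIS n \<sigma> \<in> {card I | I. I \<subseteq> {1..n} \<and> strict_mono_on I \<sigma>}"
    unfolding LIS_def by (rule Max_in[OF fin]) (auto intro!: exI[of _ "{}"])
  then obtain I where I: "I \<subseteq> {1..n}" "strict_mono_on I \<sigma>" "LIS n \<sigma> = card I" by blast
  show ?thesis
  proof (cases "I = {}")
    case True
    then show ?thesis using I chain_mass_nonneg by simp
  next
    case False
    define p where "p i = (real i / real n, real (\<sigma> i) / real n)" for i
    define K where "K = grid_round m ` p ` I"
  let ?q = "1 / real n * (1 / real n)"
  let ?I = "(\<integral>\<^sup>+z. ennreal (tent m K z) \<partial>permuton_of_perm n \<sigma>)"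
    have \<sigma>I: "1 \<le> i \<and> i \<le> n \<and> 1 \<le> \<sigma> i \<and> \<sigma> i \<le> n" if "i \<in> I" for i
      using that I(1) permutes_in_image[OF perm, of i] by auto
    have pu: "p i \<in> unit_square" if "i \<in> I" for i
      using \<sigma>I[OF that] \<open>n > 0\<close> by (auto simp: p_def)
    have mono: "nat \<lceil>real m * (real a / real n)\<rceil> \<le> nat \<lceil>real m * (real b / real n)\<rceil>" if "a \<le> b" for a b
      using that by (intro nat_mono ceiling_mono mult_left_mono divide_right_mono) auto
    have "is_chain K"
      unfolding is_chain_def
    proof (intro ballI notI)
      fix z w assume "z \<in> K" "w \<in> K" and zw: "fst z < fst w \<and> snd w < snd z"
      then obtain i j where ij: "i \<in> I" "j \<in> I" "z = grid_round m (p i)" "w = grid_round m (p j)"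
        by (auto simp: K_def)
      have "i < j"
      proof (rule ccontr)
        assume "\<not> i < j"
        then have "nat \<lceil>real m * (real j / real n)\<rceil> \<le> nat \<lceil>real m * (real i / real n)\<rceil>"
          by (intro mono) simp
        then have "fst w \<le> fst z"
          unfolding ij grid_round_def p_def fst_conv
            by (intro divide_right_mono[OF _ of_nat_0_le_iff] of_nat_mono)
        then show False using zw by simp
      qed
      then have "\<sigma> i \<le> \<sigma> j" using I(2) ij by (meson less_imp_le strict_mono_onD)
      then have "snd z \<le> snd w"
        unfolding ij grid_round_def p_def snd_conv
        by (intro divide_right_mono[OF _ of_nat_0_le_iff] of_nat_mono mono)
      then show False using zw by simp
    qed
    then have K: "K \<in> grid_chains m"
      using False grid_round_in_grid[OF m pu] by (auto simp: grid_chains_def K_def simp del: mem_Times_iff)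
    \<comment> \<open>\<open>p i\<close> is the upper right corner. On the half-open square both
      ceilings of the density are constant, equal to i and \<open>\<sigma> i\<close>, which also
      makes the squares disjoint.\<close>
    define Sq where "Sq i = {(real i - 1) / real n <.. real i / real n} \<times>
       {(real (\<sigma> i) - 1) / real n <.. real (\<sigma> i) / real n}" for i
    define U where "U = (\<Union>i\<in>I. Sq i)"
    have SqU: "Sq i \<subseteq> unit_square" if "i \<in> I" for i
    proof -
      have "{(real k - 1) / real n <.. real k / real n} \<subseteq> {0..1}" if "1 \<le> k" "k \<le> n" for k
      proof -
        have "0 \<le> (real k - 1) / real n" "real k / real n \<le> 1"
          using that \<open>n > 0\<close> by auto
        then show ?thesis by (meson atLeastAtMost_iff greaterThanAtMost_iff less_imp_le order_trans subsetI)
      qed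
      then show ?thesis using \<sigma>I[OF that] unfolding Sq_def by (intro Sigma_mono) auto
    qed
    have Sqm: "Sq i \<in> sets borel" for i
      unfolding Sq_def borel_prod[symmetric] by measurable
    have finI: "finite I" using I(1) finite_subset by blast
    have "emeasure lborel (Sq i) = ennreal (1 / real n) * ennreal (1 / real n)" for i
    proof -
      have "emeasure (lborel :: (real \<times> real) measure) (Sq i) = emeasure (lborel \<Otimes>\<^sub>M lborel) (Sq i)"
        by (simp add: lborel_prod)
      also have "\<dots> = emeasure lborel {(real i - 1) / real n <.. real i / real n} *
          emeasure lborel {(real (\<sigma> i) - 1) / real n <.. real (\<sigma> i) / real n}"
        unfolding Sq_def by (intro lborel.emeasure_pair_measure_Times) auto
      also have "\<dots> = ennreal (1 / real n) * ennreal (1 / real n)"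
        using \<open>n > 0\<close> by (simp add: emeasure_lborel_Ioc divide_right_mono diff_divide_distrib)
      finally show ?thesis .
    qed
    then have Sqe: "emeasure lborel (Sq i) = ennreal (?q)" for i
      by (simp only: ennreal_mult zero_le_divide_1_iff of_nat_0_le_iff)
    have ceil: "nat \<lceil>real n * fst z\<rceil> = i \<and> nat \<lceil>real n * snd z\<rceil> = \<sigma> i" if "z \<in> Sq i" for z i
      using that \<open>n > 0\<close> by (auto simp: Sq_def intro!: nat_ceiling_eq)
    have "disjoint_family_on Sq I"
      unfolding disjoint_family_on_def using ceil by blast
    then have "emeasure lborel U = (\<Sum>i\<in>I. emeasure lborel (Sq i))"
      unfolding U_def using Sqm finI by (intro sum_emeasure[symmetric]) auto
    then have Ue: "emeasure lborel U = ennreal (real (card I) * (?q))"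
      unfolding Sqe
      by (simp only: sum_constant ennreal_of_nat_eq_real_of_nat ennreal_mult' of_nat_0_le_iff)
    have UU: "U \<subseteq> unit_square" using SqU by (auto simp: U_def)
    have Um: "U \<in> sets borel" unfolding U_def using finI Sqm by blast
    define L where "L = restrict_space (lborel :: (real \<times> real) measure) unit_square"
    have us: "unit_square \<in> sets (borel :: (real \<times> real) measure)" by (intro borel_closed closed_Times) auto
    have LU: "emeasure L U = emeasure lborel U" "U \<in> sets L"
      unfolding L_def using UU Um us by (auto simp: emeasure_restrict_space sets_restrict_space_iff)
    have Lsp: "space L = unit_square" unfolding L_def by (simp add: space_restrict_space)
    have L1: "emeasure L (space L) = 1"
    proof -
      have "emeasure L (space L) = emeasure (lborel \<Otimes>\<^sub>M lborel) ({0..1::real} \<times> {0..1::real})"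
        unfolding Lsp unfolding L_def using us by (simp add: emeasure_restrict_space lborel_prod)
      also have "\<dots> = 1" by (subst lborel.emeasure_pair_measure_Times) auto
      finally show ?thesis .
    qed
    define f where "f = (\<lambda>(x, y). ennreal (real n * of_bool (\<sigma> (nat \<lceil>real n * x\<rceil>) = nat \<lceil>real n * y\<rceil>)))"
    have Lf: "f \<in> borel_measurable L"
      unfolding f_def L_def
      by (intro measurable_restrict_space1) (use permuton_of_perm_density_measurable in simp)
    have Lt: "(\<lambda>z. ennreal (tent m K z)) \<in> borel_measurable L"
      unfolding L_def by (intro measurable_restrict_space1) simp
    have tent1: "tent m K z = 1" if "z \<in> Sq i" "i \<in> I" for z i
    proof -
      have "\<bar>fst z - fst (p i)\<bar> \<le> 1 / real n" "\<bar>snd z - snd (p i)\<bar> \<le> 1 / real n"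
        using that \<open>n > 0\<close> by (auto simp: Sq_def p_def abs_le_iff field_simps)
      then have "dist z (p i) \<le> 1 / real n + 1 / real n"
        using sqrt_sum_squares_le_sum_abs[of "fst z - fst (p i)" "snd z - snd (p i)"]
        by (simp add: dist_prod_def dist_real_def)
      also have "\<dots> \<le> 1 / real m" using m n by (simp add: field_simps flip: of_nat_mult)
      finally have "dist z (p i) \<le> 1 / real m" .
      moreover have "dist (p i) (grid_round m (p i)) \<le> 2 / real m"
        by (rule dist_grid_round[OF m pu[OF that(2)]])
      ultimately have "dist z (grid_round m (p i)) \<le> 3 / real m"
        using dist_triangle[of z "grid_round m (p i)" "p i"] by (simp add: add_divide_distrib[symmetric])
      moreover have "infdist z K \<le> dist z (grid_round m (p i))"
        using that by (intro infdist_le) (auto simp: K_def)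
      ultimately have "infdist z K \<le> 3 / real m" by linarith
      then have "real m * infdist z K \<le> 3" using m by (simp add: field_simps)
      then show ?thesis by (simp add: tent_def)
    qed
    have lower: "ennreal (real n) * indicator U z \<le> f z * ennreal (tent m K z)" for z
    proof (cases "z \<in> U")
      case True
      then obtain i where i: "i \<in> I" "z \<in> Sq i" by (auto simp: U_def)
      then show ?thesis using ceil[OF i(2)] tent1[OF i(2,1)] True by (simp add: f_def case_prod_beta)
    qed simp
    \<comment> \<open>This crude bound serves only to make the integral finite, so that it can be
      read as a real integral.\<close>
    have upper: "f z * ennreal (tent m K z) \<le> ennreal (real n)" for z
    proof -
      have "f z * ennreal (tent m K z) \<le> ennreal (real n) * 1"
        by (intro mult_mono) (auto simp: f_def case_prod_beta tent_le_1 intro!: ennreal_leI)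
      then show ?thesis by simp
    qed
    have eq: "?I = (\<integral>\<^sup>+z. f z * ennreal (tent m K z) \<partial>L)"
      unfolding permuton_of_perm_def L_def[symmetric] f_def[symmetric]
      by (rule nn_integral_density[OF Lf Lt])
    have "(\<integral>\<^sup>+z. f z * ennreal (tent m K z) \<partial>L) \<le> (\<integral>\<^sup>+z. ennreal (real n) \<partial>L)"
      by (intro nn_integral_mono upper)
    also have "\<dots> < \<infinity>" using L1 by simp
    finally have finite: "?I < \<infinity>" unfolding eq .
    have "ennreal (real (card I) / real n) = ennreal (real n) * emeasure L U"
      unfolding LU Ue using \<open>n > 0\<close> by (subst ennreal_mult'[symmetric]) auto
    also have "\<dots> = (\<integral>\<^sup>+z. ennreal (real n) * indicator U z \<partial>L)"
      using LU by (simp add: nn_integral_cmult_indicator)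
    also have "\<dots> \<le> ?I"
      unfolding eq by (intro nn_integral_mono lower)
    finally have "ennreal (real (card I) / real n) \<le> ?I" .
    then have "enn2real (ennreal (real (card I) / real n)) \<le> enn2real ?I"
      using finite by (intro enn2real_mono) auto
    also have "\<dots> = (\<integral>z. tent m K z \<partial>permuton_of_perm n \<sigma>)"
    proof (rule integral_eq_nn_integral[symmetric])
      show "tent m K \<in> borel_measurable (permuton_of_perm n \<sigma>)"
        unfolding permuton_of_perm_def L_def[symmetric] f_def[symmetric] measurable_density_eq1
        unfolding L_def by (intro measurable_restrict_space1) simp
    qed (simp add: tent_nonneg)
    also have "\<dots> \<le> chain_mass m (permuton_of_perm n \<sigma>)"
      unfolding chain_mass_def using K by (intro Max_ge) (auto simp: finite_grid_chains)
    finally show ?thesis using I(3) by simp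
  qed
qed

section \<open>Chains of random relations\<close>

lemma emeasure_lborel_translate:
  fixes A :: "real set"
  assumes "A \<in> sets borel"
  shows "emeasure lborel {t. t + c \<in> A} = emeasure lborel A"
proof -
  have "emeasure lborel A = emeasure (distr lborel borel ((+) c)) A"
    by (simp add: lborel_distr_plus)
  also have "\<dots> = emeasure lborel {t. t + c \<in> A}"
    using assms by (subst emeasure_distr) (auto simp: vimage_def add.commute)
  finally show ?thesis by simp
qed

text \<open>Take an open U around K of almost the same measure. Small translates of K stay inside U
  and have the measure of K, so each misses only a little of U; a point of U missed by none of them
  starts a progression in K.\<close>

lemma translates_of_compact:
  fixes K :: "real set"
  assumes K: "compact K" and \<epsilon>: "\<epsilon> > 0"
  obtains \<eta> where "\<eta> > 0" "\<And>h. 0 \<le> h \<Longrightarrow> h < \<eta> \<Longrightarrow>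
     emeasure lborel K \<le> emeasure lborel {t. \<forall>i\<le>k. t + real i * h \<in> K} + ennreal \<epsilon>"
proof -
  have Km: "K \<in> sets borel" using K by (simp add: borel_compact)
  \<comment> \<open>One equal share of the error for each of the k + 1 translates.\<close>
  define \<epsilon>' where "\<epsilon>' = \<epsilon> / real (Suc k)"
  have "\<epsilon>' > 0" using \<epsilon> by (simp add: \<epsilon>'_def)
  obtain U where U: "open U" "K \<subseteq> U" "emeasure lborel (U - K) < ennreal \<epsilon>'"
    using outer_regular_lborel[of K \<epsilon>'] Km \<open>\<epsilon>' > 0\<close> by auto
  obtain d where d: "d > 0" "(\<Union>x\<in>K. ball x d) \<subseteq> U"
    using compact_subset_open_imp_ball_epsilon_subset[OF K U(1,2)] by blast
  have Um: "U \<in> sets borel" using U by simp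
  have Kfin: "emeasure lborel K < \<infinity>" using emeasure_compact_finite[OF K] by simp
  have "emeasure lborel K \<le> emeasure lborel {t. \<forall>i\<le>k. t + real i * h \<in> K} + ennreal \<epsilon>"
    if h: "0 \<le> h" "h < d / real (Suc k)" for h
  proof -
    define V where "V i = {t. t + real i * h \<in> K}" for i
    have Vm: "V i \<in> sets borel" for i
    proof -
      have "(\<lambda>t. t + real i * h) \<in> borel_measurable borel" by measurable
      from measurable_sets[OF this Km] show ?thesis by (simp add: V_def vimage_def)
    qed
    have VU: "V i \<subseteq> U" if "i \<le> k" for i
    proof
      fix t assume "t \<in> V i"
      have "real i * h \<le> real (Suc k) * h" using that h by (intro mult_right_mono) auto
      also have "\<dots> < d" using h by (simp add: field_simps)
      finally have "t \<in> ball (t + real i * h) d" using h by (simp add: dist_real_def)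
      moreover have "t + real i * h \<in> K" using \<open>t \<in> V i\<close> by (simp add: V_def)
      ultimately show "t \<in> U" using d(2) by blast
    qed
    have VK: "emeasure lborel (V i) = emeasure lborel K" for i
      unfolding V_def by (rule emeasure_lborel_translate[OF Km])
    have diff: "emeasure lborel (U - V i) \<le> ennreal \<epsilon>'" if "i \<le> k" for i
    proof -
      have "emeasure lborel (U - V i) = emeasure lborel U - emeasure lborel (V i)"
        using Kfin Um Vm VU[OF that] VK by (intro emeasure_Diff) auto
      also have "\<dots> = emeasure lborel (U - K)"
        unfolding VK using Kfin Um Km U(2) by (subst emeasure_Diff) auto
      finally show ?thesis using U(3) by simp
    qed
    let ?T = "{t. \<forall>i\<le>k. t + real i * h \<in> K}"
    have T: "?T = (\<Inter>i\<le>k. V i)" by (auto simp: V_def)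
    have Tm: "?T \<in> sets borel" unfolding T using Vm by auto
    have sub: "U \<subseteq> ?T \<union> (\<Union>i\<le>k. U - V i)" unfolding T by auto
    have UVm: "(\<Union>i\<le>k. U - V i) \<in> sets borel"
      by (rule sets.finite_UN) (simp_all add: Um Vm sets.Diff)
    have "emeasure lborel K \<le> emeasure lborel U"
      by (rule emeasure_mono[OF U(2)]) (simp add: Um)
    also have "\<dots> \<le> emeasure lborel (?T \<union> (\<Union>i\<le>k. U - V i))"
      by (rule emeasure_mono[OF sub]) (simp only: sets_lborel sets.Un Tm UVm)
    also have "\<dots> \<le> emeasure lborel ?T + emeasure lborel (\<Union>i\<le>k. U - V i)"
      by (rule emeasure_subadditive) (simp_all only: sets_lborel Tm UVm)
    also have "emeasure lborel (\<Union>i\<le>k. U - V i) \<le> (\<Sum>i\<le>k. emeasure lborel (U - V i))"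
      by (rule emeasure_subadditive_finite) (use Um Vm in auto)
    also have "\<dots> \<le> (\<Sum>i\<le>k. ennreal \<epsilon>')" by (intro sum_mono diff) auto
    also have "\<dots> = ennreal (\<Sum>i\<le>k. \<epsilon>')" using \<open>\<epsilon>' > 0\<close> by (intro sum_ennreal) auto
    also have "(\<Sum>i\<le>k. \<epsilon>') = \<epsilon>" by (simp add: \<epsilon>'_def field_simps)
    finally show ?thesis by simp
  qed
  then show ?thesis using that[of "d / real (Suc k)"] d(1) by simp
qed

text \<open>Inner regularity with an error below the full measure of A; boundedness turns the closed
  approximation into a compact one, as \<open>translates_of_compact\<close> requires.\<close>

lemma inner_compact_positive:
  fixes A :: "real set"
  assumes A: "A \<in> sets borel" "bounded A" and pos: "emeasure lborel A \<noteq> 0"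
  obtains K where "compact K" "K \<subseteq> A" "emeasure lborel K \<noteq> 0"
proof -
  have "emeasure lborel A < \<infinity>" using emeasure_bounded_finite[OF A(2)] by simp
  then obtain a where a: "emeasure lborel A = ennreal a" "a \<ge> 0" by (cases "emeasure lborel A") auto
  then have "a > 0" using pos by (cases "a = 0") auto
  then obtain T where T: "closed T" "T \<subseteq> A" "A - T \<in> lmeasurable" "emeasure lebesgue (A - T) < ennreal a"
    using sets_lebesgue_inner_closed[of A a] A by auto
  have Tm: "T \<in> sets borel" using T by simp
  have "emeasure lborel (A - T) < ennreal a"
    using T(4) A Tm by (simp add: emeasure_completion)
  moreover have "emeasure lborel A = emeasure lborel T + emeasure lborel (A - T)"
    using T(2) A Tm by (subst plus_emeasure) (auto simp: Un_absorb1)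
  ultimately have "emeasure lborel T \<noteq> 0" unfolding a(1) by (intro notI) simp
  moreover have "compact T"
    using bounded_subset[OF A(2) T(2)] T(1) by (simp add: compact_eq_bounded_closed)
  ultimately show ?thesis using that T(2) by blast
qed

text \<open>The relation is tested only at distances below \<eta>: two one-sided minima of the same
  scale are comparable only when they are closer than that scale.\<close>

definition null_chains :: "(real \<Rightarrow> real \<Rightarrow> bool) \<Rightarrow> real \<Rightarrow> real \<Rightarrow> bool" where
  "null_chains R \<alpha> \<beta> \<longleftrightarrow> (\<forall>A \<eta>. A \<in> sets borel \<longrightarrow> A \<subseteq> {\<alpha>..\<beta>} \<longrightarrow> \<eta> > 0 \<longrightarrow>
     (\<forall>x\<in>A. \<forall>y\<in>A. x < y \<longrightarrow> y < x + \<eta> \<longrightarrow> R x y) \<longrightarrow> emeasure lborel A = 0)"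

text \<open>
  A chain of positive measure contains most of the arithmetic progressions of small step that start
  in it, and these are all chains; but a progression of length \<open>k\<close> is a chain with probability at
  most \<open>B * q ^ k\<close>.
\<close>

lemma (in prob_space) AE_no_chain:
  fixes R :: "'a \<Rightarrow> real \<Rightarrow> real \<Rightarrow> bool" and \<alpha> \<beta> B q :: real
  assumes meas: "\<And>h. h > 0 \<Longrightarrow>
      {(\<omega>, t). \<omega> \<in> space M \<and> \<alpha> \<le> t \<and> t + h \<le> \<beta> \<and> R \<omega> t (t + h)} \<in> sets (M \<Otimes>\<^sub>M borel)"
    and bound: "\<And>k h. h > 0 \<Longrightarrow> AE t in lborel. \<alpha> \<le> t \<longrightarrow> t + real k * h \<le> \<beta> \<longrightarrow>
      emeasure M {\<omega> \<in> space M. \<forall>i<k. R \<omega> (t + real i * h) (t + real i * h + h)} \<le> ennreal (B * q ^ k)"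
    and q: "0 \<le> q" "q < 1" and B: "B \<ge> 0" and \<alpha>\<beta>: "\<alpha> \<le> \<beta>"
  shows "AE \<omega> in M. null_chains (R \<omega>) \<alpha> \<beta>"
proof -
  let ?N = "M \<Otimes>\<^sub>M borel"
  define E where "E k h = {(\<omega>, t). \<omega> \<in> space M \<and> \<alpha> \<le> t \<and> t + real k * h \<le> \<beta> \<and>
     (\<forall>i<k. R \<omega> (t + real i * h) (t + real i * h + h))}" for k :: nat and h
  have Em: "E k h \<in> sets (M \<Otimes>\<^sub>M lborel)" if "h > 0" for k h
  proof -
    let ?S = "{(\<omega>, t). \<omega> \<in> space M \<and> \<alpha> \<le> t \<and> t + h \<le> \<beta> \<and> R \<omega> t (t + h)}"
    have shift: "(\<lambda>(\<omega>, t). (\<omega>, t + real i * h)) \<in> ?N \<rightarrow>\<^sub>M ?N" for i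
      by measurable
    define Z where "Z i = (\<lambda>(\<omega>, t). (\<omega>, t + real i * h)) -` ?S \<inter> space (?N)" for i
    have Z: "Z i \<in> sets (?N)" for i
      unfolding Z_def by (rule measurable_sets[OF shift meas[OF that]])
    have sp: "space M \<times> {\<alpha>..\<beta> - real k * h} \<in> sets (?N)" by (rule pair_measureI) auto
    have "(\<Inter>i\<in>{..<k}. Z i) \<in> sets (?N)" if "k > 0"
      by (rule sets.finite_INT) (use that Z in auto)
    then have "(space M \<times> {\<alpha>..\<beta> - real k * h}) \<inter> (\<Inter>i\<in>{..<k}. Z i) \<in> sets (?N)"
      if "k > 0" using sp that by (simp add: sets.Int)
    moreover have "E k h = (space M \<times> {\<alpha>..\<beta> - real k * h}) \<inter> (\<Inter>i\<in>{..<k}. Z i)"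
    proof -
      have "\<alpha> \<le> t + real i * h \<and> t + real i * h + h \<le> \<beta>"
        if "\<alpha> \<le> t" "t + real k * h \<le> \<beta>" "i < k" for i t
      proof -
        have "real (Suc i) * h \<le> real k * h" using that \<open>h > 0\<close> by (intro mult_right_mono) auto
        moreover have "real i * h \<ge> 0" using \<open>h > 0\<close> by simp
        ultimately show ?thesis using that by (simp add: algebra_simps)
      qed
      then show ?thesis by (auto simp: E_def Z_def space_pair_measure)
    qed
    moreover have "E 0 h = space M \<times> {\<alpha>..\<beta>}" by (auto simp: E_def)
    ultimately have "E k h \<in> sets (?N)" by (cases "k = 0") auto
    then show ?thesis by (simp cong: sets_pair_measure_cong)
  qed
  \<comment> \<open>G measures the starting points for a fixed \<omega>, whereas
    \<open>bound\<close> concerns a fixed starting point t; Tonelli links the two.\<close>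
  define G where "G k h \<omega> = emeasure lborel (Pair \<omega> -` E k h)" for k h \<omega>
  have Gm: "G k h \<in> borel_measurable M" if "h > 0" for k h
    unfolding G_def by (rule lborel.measurable_emeasure_Pair[OF Em[OF that]])
  interpret P: pair_sigma_finite M "lborel :: real measure"
    by (intro pair_sigma_finite.intro sigma_finite_measure_axioms lborel.sigma_finite_measure_axioms)
  have GI: "(\<integral>\<^sup>+\<omega>. G k h \<omega> \<partial>M) \<le> ennreal ((\<beta> - \<alpha>) * B * q ^ k)" if "h > 0" for k h
  proof -
    have "(\<integral>\<^sup>+\<omega>. G k h \<omega> \<partial>M) = emeasure (M \<Otimes>\<^sub>M lborel) (E k h)"
      unfolding G_def by (rule lborel.emeasure_pair_measure_alt[symmetric, OF Em[OF that]])
    also have "\<dots> = (\<integral>\<^sup>+t. emeasure M ((\<lambda>\<omega>. (\<omega>, t)) -` E k h) \<partial>lborel)"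
      by (rule P.emeasure_pair_measure_alt2[OF Em[OF that]])
    also have "\<dots> \<le> (\<integral>\<^sup>+t. ennreal (B * q ^ k) * indicator {\<alpha>..\<beta>} t \<partial>lborel)"
    proof (rule nn_integral_mono_AE, use bound[OF that, of k] in eventually_elim)
      case (elim t)
      show ?case
      proof (cases "\<alpha> \<le> t \<and> t + real k * h \<le> \<beta>")
        case True
        then have "(\<lambda>\<omega>. (\<omega>, t)) -` E k h = {\<omega> \<in> space M. \<forall>i<k. R \<omega> (t + real i * h) (t + real i * h + h)}"
          by (auto simp: E_def)
        moreover have "t \<le> \<beta>" using True that by (smt (verit) mult_nonneg_nonneg of_nat_0_le_iff)
        ultimately show ?thesis using elim True by simp
      next
        case False
        then have "(\<lambda>\<omega>. (\<omega>, t)) -` E k h = {}" by (auto simp: E_def)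
        then show ?thesis by simp
      qed
    qed
    also have "\<dots> = ennreal (B * q ^ k) * ennreal (\<beta> - \<alpha>)"
      using \<alpha>\<beta> by (simp add: nn_integral_cmult_indicator)
    also have "\<dots> = ennreal ((\<beta> - \<alpha>) * B * q ^ k)"
      using \<alpha>\<beta> B q by (subst ennreal_mult[symmetric]) (auto simp: mult_ac)
    finally show ?thesis .
  qed
  define h where "h n = 1 / real (Suc n)" for n
  have h0: "h n > 0" for n by (simp add: h_def)
  \<comment> \<open>Fatou keeps the bound as the step tends to 0. A single sequence of steps is used
    for all chains, so the exceptional null set does not depend on A.\<close>
  define L where "L k \<omega> = liminf (\<lambda>n. G k (h n) \<omega>)" for k \<omega>
  have Lm: "L k \<in> borel_measurable M" for k
    unfolding L_def using Gm[OF h0] by measurable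
  have LI: "(\<integral>\<^sup>+\<omega>. L k \<omega> \<partial>M) \<le> ennreal ((\<beta> - \<alpha>) * B * q ^ k)" for k
  proof -
    have "(\<integral>\<^sup>+\<omega>. L k \<omega> \<partial>M) \<le> liminf (\<lambda>n. \<integral>\<^sup>+\<omega>. G k (h n) \<omega> \<partial>M)"
      unfolding L_def by (rule nn_integral_liminf[OF Gm[OF h0]])
    also have "\<dots> \<le> liminf (\<lambda>n. ennreal ((\<beta> - \<alpha>) * B * q ^ k))"
      by (intro Liminf_mono always_eventually allI GI h0)
    finally show ?thesis by (simp add: Liminf_const)
  qed
  have "(\<integral>\<^sup>+\<omega>. (INF k. L k \<omega>) \<partial>M) \<le> ennreal ((\<beta> - \<alpha>) * B * q ^ k)" for k
    by (rule order_trans[OF nn_integral_mono LI[of k]]) (auto intro: INF_lower)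
  moreover have "(\<lambda>k. ennreal ((\<beta> - \<alpha>) * B * q ^ k)) \<longlonglongrightarrow> ennreal ((\<beta> - \<alpha>) * B * 0)"
    by (intro tendsto_ennrealI tendsto_mult tendsto_const LIMSEQ_power_zero) (use q in auto)
  ultimately have "(\<integral>\<^sup>+\<omega>. (INF k. L k \<omega>) \<partial>M) \<le> 0"
    by (intro LIMSEQ_le_const) auto
  then have "(\<integral>\<^sup>+\<omega>. (INF k. L k \<omega>) \<partial>M) = 0" by simp
  \<comment> \<open>A chain of positive measure contradicts this, because it bounds all the
    \<open>L k \<omega>\<close> from below by the same number.\<close>
  then have "AE \<omega> in M. (INF k. L k \<omega>) = 0"
    using Lm by (subst (asm) nn_integral_0_iff_AE) auto
  then show ?thesis
    unfolding null_chains_def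
  proof (rule AE_mp, intro AE_I2 impI allI)
    fix \<omega> A and \<eta> :: real
    assume \<omega>: "\<omega> \<in> space M" and L0: "(INF k. L k \<omega>) = 0" and A: "A \<in> sets borel" "A \<subseteq> {\<alpha>..\<beta>}"
      and \<eta>: "\<eta> > 0" and chain: "\<forall>x\<in>A. \<forall>y\<in>A. x < y \<longrightarrow> y < x + \<eta> \<longrightarrow> R \<omega> x y"
    show "emeasure lborel A = 0"
    proof (rule ccontr)
      assume "emeasure lborel A \<noteq> 0"
      moreover have "bounded A" using A(2) bounded_closed_interval bounded_subset by blast
      ultimately obtain K where K: "compact K" "K \<subseteq> A" "emeasure lborel K \<noteq> 0"
        using inner_compact_positive A(1) by blast
      \<comment> \<open>Once the step is small, nearly all of K starts a progression of k + 1 points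
        of K; a step below \<eta> makes consecutive points related.\<close>
      have "emeasure lborel K - ennreal \<epsilon> \<le> L k \<omega>" if \<epsilon>: "\<epsilon> > 0" for k \<epsilon>
      proof -
        obtain d where d: "d > 0" "\<And>h. 0 \<le> h \<Longrightarrow> h < d \<Longrightarrow>
            emeasure lborel K \<le> emeasure lborel {t. \<forall>i\<le>k. t + real i * h \<in> K} + ennreal \<epsilon>"
          using translates_of_compact[OF K(1) \<epsilon>, of k] by blast
        have "h \<longlonglongrightarrow> 0" unfolding h_def by (rule LIMSEQ_Suc[OF lim_1_over_n])
        then have "\<forall>\<^sub>F n in sequentially. h n < min d \<eta>"
          using d \<eta> by (intro order_tendstoD) auto
        then have "\<forall>\<^sub>F n in sequentially. emeasure lborel K - ennreal \<epsilon> \<le> G k (h n) \<omega>"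
        proof eventually_elim
          case (elim n)
          have "{t. \<forall>i\<le>k. t + real i * h n \<in> K} \<subseteq> Pair \<omega> -` E k (h n)"
          proof
            fix t assume t: "t \<in> {t. \<forall>i\<le>k. t + real i * h n \<in> K}"
            then have tA: "t + real i * h n \<in> A" if "i \<le> k" for i using that K(2) by blast
            have "R \<omega> (t + real i * h n) (t + real i * h n + h n)" if "i < k" for i
            proof -
              have "t + real i * h n \<in> A" "t + real i * h n + h n \<in> A"
                using tA[of i] tA[of "Suc i"] that by (auto simp: algebra_simps)
              then show ?thesis using chain h0[of n] elim by auto
            qed
            moreover have "\<alpha> \<le> t" "t + real k * h n \<le> \<beta>"
              using tA[of 0] tA[of k] A(2) by auto
            ultimately show "t \<in> Pair \<omega> -` E k (h n)" using \<omega> by (auto simp: E_def)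
          qed
          then have "emeasure lborel {t. \<forall>i\<le>k. t + real i * h n \<in> K} \<le> G k (h n) \<omega>"
            unfolding G_def by (rule emeasure_mono) (rule sets_Pair1[OF Em[OF h0]])
          note GK = this
          have "emeasure lborel K \<le> emeasure lborel {t. \<forall>i\<le>k. t + real i * h n \<in> K} + ennreal \<epsilon>"
            using elim h0[of n] by (intro d(2)) auto
          also have "\<dots> \<le> G k (h n) \<omega> + ennreal \<epsilon>" by (rule add_right_mono[OF GK])
          finally have "emeasure lborel K \<le> ennreal \<epsilon> + G k (h n) \<omega>" by (simp add: add.commute)
          then show ?case by (simp add: ennreal_minus_le_iff)
        qed
        then show ?thesis unfolding L_def by (intro Liminf_bounded)
      qed
      then have diff: "emeasure lborel K - ennreal \<epsilon> \<le> 0" if "\<epsilon> > 0" for \<epsilon>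
        unfolding L0[symmetric] using that by (intro INF_greatest) auto
      have "emeasure lborel K \<le> 0"
      proof (rule ennreal_le_epsilon)
        fix \<epsilon> :: real assume "\<epsilon> > 0"
        from diff[OF this] have "emeasure lborel K \<le> ennreal \<epsilon> + 0"
          unfolding ennreal_minus_le_iff by (rule conjunct1)
        then show "emeasure lborel K \<le> 0 + ennreal \<epsilon>" by (simp only: add_0_right add_0)
      qed
      then show False using K(3) by simp
    qed
  qed
qed

section \<open>Finite-dimensional laws of the excursion\<close>

lemma normal_density_0_eq:
  assumes "s > 0"
  shows "normal_density 0 (sqrt s) x = 1 / sqrt (2 * pi * s) * exp (- x\<^sup>2 / (2 * s))"
  using assms by (simp add: normal_density_def)

lemma normal_density_0_le:
  assumes "s > 0"
  shows "normal_density 0 (sqrt s) x \<le> 1 / sqrt (2 * pi * s)"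
  unfolding normal_density_0_eq[OF assms]
  using assms by (intro mult_left_le) auto

lemma hitting_density_nonneg: "0 \<le> x \<Longrightarrow> 0 \<le> t \<Longrightarrow> 0 \<le> hitting_density x t"
  by (simp add: hitting_density_def)

text \<open>As t \<le> 1, the factor x * exp (- x^2 / (2 t)) is at most x * exp (- x^2 / 2) \<le> 1,
  uniformly in x. This disposes of the last factor of the excursion density when the last time stays
  away from 1.\<close>

lemma hitting_density_le:
  assumes "0 < s" "s \<le> t" "t \<le> 1" "0 \<le> x"
  shows "hitting_density x t \<le> 1 / s * (1 / sqrt (2 * pi * s))"
proof -
  have "t > 0" using assms by simp
  have "x * exp (- x\<^sup>2 / (2 * t)) \<le> 1"
  proof -
    have "x\<^sup>2 / 2 \<le> x\<^sup>2 / (2 * t)"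
      using assms \<open>t > 0\<close> by (intro divide_left_mono) auto
    then have "x * exp (- x\<^sup>2 / (2 * t)) \<le> x * exp (- (x\<^sup>2 / 2))"
      using assms by (intro mult_left_mono) auto
    also have "\<dots> \<le> 1"
    proof -
      have "0 \<le> (x - 1)\<^sup>2" by simp
      then have "x \<le> 1 + x\<^sup>2 / 2" by (simp add: power2_diff)
      also have "\<dots> \<le> exp (x\<^sup>2 / 2)" by (rule exp_ge_add_one_self)
      finally show ?thesis by (simp add: exp_minus field_simps)
    qed
    finally show ?thesis .
  qed
  then have "hitting_density x t \<le> 1 / t * (1 / sqrt (2 * pi * t))"
    unfolding hitting_density_def normal_density_0_eq[OF \<open>t > 0\<close>]
    using \<open>t > 0\<close> by (simp add: divide_right_mono)
  also have "\<dots> \<le> 1 / s * (1 / sqrt (2 * pi * s))"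
    using assms by (intro mult_mono divide_left_mono real_sqrt_le_mono mult_left_mono) auto
  finally show ?thesis .
qed

text \<open>The truncation lets the weight itself carry the positivity of the first
  position.\<close>

definition hit :: "real \<Rightarrow> real \<Rightarrow> real" where
  "hit t x = (if 0 < x then hitting_density x t else 0)"

lemma hit_nonneg: "0 \<le> t \<Longrightarrow> 0 \<le> hit t x"
  by (simp add: hit_def hitting_density_nonneg)

lemma borel_measurable_hit [measurable]: "hit t \<in> borel_measurable borel"
  unfolding hit_def[abs_def] hitting_density_def[abs_def] by measurable

text \<open>In the space variable the hitting density is minus the derivative of the Gaussian
  density, so the integral over the half-line is the Gaussian value at 0.\<close>

lemma nn_integral_hit:
  assumes "t > 0"
  shows "(\<integral>\<^sup>+x. ennreal (hit t x) \<partial>lborel) = ennreal (1 / sqrt (2 * pi * t))"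
proof -
  have "(\<integral>\<^sup>+x. ennreal (hit t x) \<partial>lborel) = (\<integral>\<^sup>+x. ennreal (hitting_density x t) * indicator {0..} x \<partial>lborel)"
    by (intro nn_integral_cong) (auto simp: hit_def hitting_density_def indicator_def)
  also have "\<dots> = ennreal (0 - - normal_density 0 (sqrt t) 0)"
  proof (rule nn_integral_FTC_atLeast[where F = "\<lambda>x. - normal_density 0 (sqrt t) x"])
    show "(\<lambda>x. hitting_density x t) \<in> borel_measurable borel"
      unfolding hitting_density_def by measurable
    show "((\<lambda>x. - normal_density 0 (sqrt t) x) has_real_derivative hitting_density x t) (at x)" for x
      unfolding hitting_density_def normal_density_0_eq[OF assms]
      using assms by (auto intro!: derivative_eq_intros simp: field_simps power2_eq_square)
    have "((\<lambda>x. exp (- x\<^sup>2 / (2 * t))) \<longlongrightarrow> 0) at_top"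
    proof -
      have "filterlim (\<lambda>x::real. x\<^sup>2 * (1 / (2 * t))) at_top at_top"
        using assms by (intro filterlim_at_top_mult_tendsto_pos[OF tendsto_const] filterlim_pow_at_top filterlim_ident) auto
      then have "filterlim (\<lambda>x::real. - x\<^sup>2 / (2 * t)) at_bot at_top"
        by (simp add: filterlim_uminus_at_bot)
      then show ?thesis by (rule filterlim_compose[OF exp_at_bot])
    qed
    then have "((\<lambda>x. - (1 / sqrt (2 * pi * t) * exp (- x\<^sup>2 / (2 * t)))) \<longlongrightarrow> - (1 / sqrt (2 * pi * t) * 0)) at_top"
      by (intro tendsto_minus tendsto_mult tendsto_const)
    then show "((\<lambda>x. - normal_density 0 (sqrt t) x) \<longlongrightarrow> 0) at_top"
      unfolding normal_density_0_eq[OF assms] by simp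
  qed (use assms in \<open>auto simp: hitting_density_nonneg\<close>)
  also have "\<dots> = ennreal (1 / sqrt (2 * pi * t))"
    using assms by (simp add: normal_density_0_eq)
  finally show ?thesis .
qed

lemma killed_density_le: "killed_density s x y \<le> normal_density 0 (sqrt s) (y - x)"
  unfolding killed_density_def by (simp add: normal_density_def)

lemma killed_density_nonneg:
  assumes "s > 0" "x > 0" "y > 0"
  shows "0 \<le> killed_density s x y"
proof -
  have "(y - x)\<^sup>2 \<le> (- y - x)\<^sup>2"
    using assms by (simp add: power2_eq_square algebra_simps)
  then have "- (- y - x)\<^sup>2 / (2 * s) \<le> - (y - x)\<^sup>2 / (2 * s)"
    using assms by (simp add: divide_right_mono)
  then show ?thesis
    unfolding killed_density_def normal_density_def using assms
    by (simp add: divide_right_mono)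
qed

text \<open>The densities of the increments of the dominating walk. The weight of index 0 describes
  the first position; its total mass is 1 / sqrt (2 pi t 0), not 1.\<close>

definition walk_weight :: "(nat \<Rightarrow> real) \<Rightarrow> nat \<Rightarrow> real \<Rightarrow> real" where
  "walk_weight t i z = (if i = 0 then hit (t 0) z else normal_density 0 (sqrt (t i - t (i - 1))) z)"

text \<open>The factor 2 * sqrt (2 * pi) normalises \<open>excursion_density\<close>; the rest is
  the bound of \<open>hitting_density_le\<close> for a remaining time of at least 1 -
  \<beta>.\<close>

definition excursion_const :: "real \<Rightarrow> real" where
  "excursion_const \<beta> = 2 * sqrt (2 * pi) * (1 / (1 - \<beta>) * (1 / sqrt (2 * pi * (1 - \<beta>))))"

text \<open>Killing only decreases the Gaussian kernel, and the last hitting factor is bounded by a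
  constant. What remains depends on the first position and the increments alone.\<close>

lemma excursion_density_le:
  assumes k: "k \<ge> 1" and t: "strict_mono_on {..<k} t" "t ` {..<k} \<subseteq> {0<..<1}"
    and \<beta>: "t (k - 1) \<le> \<beta>" "\<beta> < 1"
  shows "excursion_density k t x \<le> excursion_const \<beta> *
     (hit (t 0) (x 0) * (\<Prod>i<k - 1. normal_density 0 (sqrt (t (Suc i) - t i)) (x (Suc i) - x i)))"
proof (cases "\<forall>i<k. 0 < x i")
  case True
  have t0: "t 0 > 0" "t (k - 1) > 0" using t(2) k by (auto simp: subset_eq)
  have inc: "t i < t (Suc i)" if "i < k - 1" for i
    using that by (intro strict_mono_onD[OF t(1)]) auto
  have a: "0 \<le> hit (t 0) (x 0)" using t0 by (simp add: hit_nonneg)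
  have prod: "(\<Prod>i<k - 1. killed_density (t (Suc i) - t i) (x i) (x (Suc i))) \<le>
      (\<Prod>i<k - 1. normal_density 0 (sqrt (t (Suc i) - t i)) (x (Suc i) - x i))"
    using True inc by (intro prod_mono) (auto intro!: killed_density_nonneg killed_density_le)
  have prod0: "0 \<le> (\<Prod>i<k - 1. killed_density (t (Suc i) - t i) (x i) (x (Suc i)))"
    using True inc by (intro prod_nonneg) (auto intro!: killed_density_nonneg)
  have h: "hitting_density (x (k - 1)) (1 - t (k - 1)) \<le> 1 / (1 - \<beta>) * (1 / sqrt (2 * pi * (1 - \<beta>)))"
    using True k \<beta> t0 by (intro hitting_density_le) (auto intro: less_imp_le)
  have h0: "0 \<le> hitting_density (x (k - 1)) (1 - t (k - 1))"
    using True k \<beta> by (intro hitting_density_nonneg) (auto intro: less_imp_le)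
  have "excursion_density k t x = 2 * sqrt (2 * pi) * hit (t 0) (x 0) *
       (\<Prod>i<k - 1. killed_density (t (Suc i) - t i) (x i) (x (Suc i))) *
       hitting_density (x (k - 1)) (1 - t (k - 1))"
    using True k by (simp add: excursion_density_def hit_def)
  also have "\<dots> \<le> 2 * sqrt (2 * pi) * hit (t 0) (x 0) *
      (\<Prod>i<k - 1. normal_density 0 (sqrt (t (Suc i) - t i)) (x (Suc i) - x i)) *
      (1 / (1 - \<beta>) * (1 / sqrt (2 * pi * (1 - \<beta>))))"
    using a prod prod0 h h0 by (intro mult_mono mult_left_mono mult_nonneg_nonneg prod_nonneg) auto
  finally show ?thesis by (simp add: excursion_const_def mult_ac)
next
  case False
  then have "excursion_density k t x = 0" by (auto simp: excursion_density_def)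
  moreover have "t 0 > 0" using t(2) k by (auto simp: subset_eq)
  ultimately show ?thesis using \<beta>
    by (simp add: excursion_const_def hit_nonneg prod_nonneg)
qed

section \<open>From positions to increments\<close>

definition partial_sums :: "nat \<Rightarrow> (nat \<Rightarrow> real) \<Rightarrow> nat \<Rightarrow> real" where
  "partial_sums k z = (\<lambda>i\<in>{..<k}. \<Sum>j\<le>i. z j)"

abbreviation lborel_fun :: "nat \<Rightarrow> (nat \<Rightarrow> real) measure" where
  "lborel_fun k \<equiv> Pi\<^sub>M {..<k} (\<lambda>_. lborel)"

lemma measurable_partial_sums [measurable]:
  "partial_sums k \<in> lborel_fun k \<rightarrow>\<^sub>M lborel_fun k"
  unfolding partial_sums_def[abs_def]
proof (rule measurable_restrict)
  fix i assume i: "i \<in> {..<k}"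
  have "(\<lambda>z. z j) \<in> borel_measurable (lborel_fun k)" if "j \<in> {..i}" for j
    using measurable_component_singleton[of j "{..<k}" "\<lambda>_. lborel :: real measure"] that i by simp
  then have "(\<lambda>z. \<Sum>j\<le>i. z j) \<in> borel_measurable (lborel_fun k)"
    by (rule borel_measurable_sum)
  then show "(\<lambda>z. \<Sum>j\<le>i. z j) \<in> lborel_fun k \<rightarrow>\<^sub>M lborel" by simp
qed

lemma partial_sums_Suc:
  assumes "z \<in> space (lborel_fun k)"
  shows "partial_sums (Suc k) (z(k := y)) = (partial_sums k z)(k := (\<Sum>j<k. z j) + y)"
proof
  fix i
  have *: "(\<Sum>j\<le>i. (z(k := y)) j) = (\<Sum>j\<le>i. z j)" if "i < k"
    using that by (intro sum.cong) auto
  have "(\<Sum>j\<le>k. (z(k := y)) j) = (\<Sum>j<k. (z(k := y)) j) + y"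
    by (simp add: lessThan_Suc_atMost[symmetric])
  also have "(\<Sum>j<k. (z(k := y)) j) = (\<Sum>j<k. z j)" by (intro sum.cong) auto
  finally show "partial_sums (Suc k) (z(k := y)) i = ((partial_sums k z)(k := (\<Sum>j<k. z j) + y)) i"
    using * by (auto simp: partial_sums_def restrict_def)
qed

text \<open>A triangular change of variables with unit Jacobian. Inductively, the last coordinate is
  only translated by the sum of the preceding ones.\<close>

lemma nn_integral_partial_sums:
  assumes "G \<in> borel_measurable (lborel_fun k)"
  shows "(\<integral>\<^sup>+x. G x \<partial>lborel_fun k) = (\<integral>\<^sup>+z. G (partial_sums k z) \<partial>lborel_fun k)"
  using assms
proof (induction k arbitrary: G)
  case 0
  show ?case
    by (intro nn_integral_cong) (auto simp: space_PiM partial_sums_def)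
next
  case (Suc k)
  interpret product_sigma_finite "\<lambda>_::nat. lborel :: real measure" ..
  let ?M = "lborel_fun k"
  have ins: "{..<Suc k} = insert k {..<k}" by auto
  have G[measurable]: "G \<in> borel_measurable (Pi\<^sub>M (insert k {..<k}) (\<lambda>_. lborel))"
    using Suc.prems by (simp add: ins)
  have upd[measurable]: "(\<lambda>(x, y). x(k := y)) \<in> ?M \<Otimes>\<^sub>M lborel \<rightarrow>\<^sub>M Pi\<^sub>M (insert k {..<k}) (\<lambda>_. lborel)"
    by (rule measurable_add_dim)
  have G2: "(\<lambda>(x, y). G (x(k := y))) \<in> borel_measurable (?M \<Otimes>\<^sub>M lborel)"
    using measurable_compose[OF upd G] by (simp add: case_prod_beta)
  have G1: "(\<lambda>x. \<integral>\<^sup>+y. G (x(k := y)) \<partial>lborel) \<in> borel_measurable (?M)"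
    using lborel.borel_measurable_nn_integral[OF G2] by simp
  have "(\<integral>\<^sup>+x. G x \<partial>lborel_fun (Suc k)) = (\<integral>\<^sup>+x. \<integral>\<^sup>+y. G (x(k := y)) \<partial>lborel \<partial>?M)"
    unfolding ins by (rule product_nn_integral_insert) (auto simp: G)
  also have "\<dots> = (\<integral>\<^sup>+z. \<integral>\<^sup>+y. G ((partial_sums k z)(k := y)) \<partial>lborel \<partial>?M)"
    by (rule Suc.IH[OF G1])
  also have "\<dots> = (\<integral>\<^sup>+z. \<integral>\<^sup>+y. G (partial_sums (Suc k) (z(k := y))) \<partial>lborel \<partial>?M)"
  proof (rule nn_integral_cong)
    fix z assume z: "z \<in> space (?M)"
    then have ps: "partial_sums k z \<in> space (?M)"
      using measurable_space[OF measurable_partial_sums] by blast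
    have m: "(\<lambda>y. G ((partial_sums k z)(k := y))) \<in> borel_measurable borel"
      using measurable_Pair2[OF G2 ps] by simp
    have "(\<integral>\<^sup>+y. G ((partial_sums k z)(k := y)) \<partial>lborel) =
        (\<integral>\<^sup>+y. G ((partial_sums k z)(k := (\<Sum>j<k. z j) + y)) \<partial>lborel)"
      using nn_integral_real_affine[OF m, of 1 "\<Sum>j<k. z j"] by simp
    then show "(\<integral>\<^sup>+y. G ((partial_sums k z)(k := y)) \<partial>lborel) =
        (\<integral>\<^sup>+y. G (partial_sums (Suc k) (z(k := y))) \<partial>lborel)"
      by (simp add: partial_sums_Suc[OF z])
  qed
  also have "\<dots> = (\<integral>\<^sup>+z. G (partial_sums (Suc k) z) \<partial>lborel_fun (Suc k))"
    unfolding ins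
    by (rule product_nn_integral_insert[symmetric])
      (use measurable_compose[OF measurable_partial_sums[of "Suc k"] Suc.prems] in \<open>auto simp: ins\<close>)
  finally show ?case .
qed

lemma partial_sums_diff:
  assumes "Suc i < k"
  shows "partial_sums k z (Suc i) - partial_sums k z i = z (Suc i)"
  using assms by (simp add: partial_sums_def)

lemma partial_sums_0: "k \<ge> 1 \<Longrightarrow> partial_sums k z 0 = z 0"
  by (simp add: partial_sums_def)

text \<open>
  On a compact subinterval of \<open>(0,1)\<close> the finite-dimensional laws of the excursion are dominated,
  up to a constant, by those of a random walk with independent Gaussian increments.
\<close>

lemma emeasure_excursion_le:
  assumes exc: "brownian_excursion M e"
    and k: "k \<ge> 1" and t: "strict_mono_on {..<k} t" "t ` {..<k} \<subseteq> {0<..<1}"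
    and \<beta>: "t (k - 1) \<le> \<beta>" "\<beta> < 1"
    and A: "A \<in> sets (lborel_fun k)"
  shows "emeasure M {\<omega> \<in> space M. (\<lambda>i\<in>{..<k}. e \<omega> (t i)) \<in> A} \<le> ennreal (excursion_const \<beta>) *
     (\<integral>\<^sup>+z. indicator A (partial_sums k z) * (\<Prod>i<k. ennreal (walk_weight t i (z i))) \<partial>lborel_fun k)"
proof -
  let ?C = "ennreal (excursion_const \<beta>)"
  let ?L = "lborel_fun k"
  have dist: "distributed M (?L) (\<lambda>\<omega>. \<lambda>i\<in>{..<k}. e \<omega> (t i)) (\<lambda>x. ennreal (excursion_density k t x))"
    using exc k t unfolding brownian_excursion_def by blast
  define D where "D x = hit (t 0) (x 0) * (\<Prod>i<k - 1. normal_density 0 (sqrt (t (Suc i) - t i)) (x (Suc i) - x i))"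
    for x :: "nat \<Rightarrow> real"
  have comp: "(\<lambda>z. z j) \<in> borel_measurable (?L)" if "j < k" for j
    using measurable_component_singleton[of j "{..<k}" "\<lambda>_. lborel :: real measure"] that by simp
  have Dm: "D \<in> borel_measurable (?L)"
    unfolding D_def[abs_def]
  proof (intro borel_measurable_times borel_measurable_prod)
    show "(\<lambda>x. hit (t 0) (x 0)) \<in> borel_measurable (?L)"
      using k by (intro measurable_compose[OF comp borel_measurable_hit]) auto
    show "(\<lambda>x. normal_density 0 (sqrt (t (Suc i) - t i)) (x (Suc i) - x i)) \<in> borel_measurable (?L)"
      if "i \<in> {..<k - 1}" for i
      using that by (intro measurable_compose[OF _ borel_measurable_normal_density] borel_measurable_diff comp) auto
  qed
  have C0: "excursion_const \<beta> \<ge> 0" using \<beta> by (simp add: excursion_const_def)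
  have "emeasure M {\<omega> \<in> space M. (\<lambda>i\<in>{..<k}. e \<omega> (t i)) \<in> A}
      = emeasure M ((\<lambda>\<omega>. \<lambda>i\<in>{..<k}. e \<omega> (t i)) -` A \<inter> space M)"
    by (intro arg_cong[where f = "emeasure M"]) auto
  also have "\<dots> = (\<integral>\<^sup>+x. ennreal (excursion_density k t x) * indicator A x \<partial>?L)"
    by (rule distributed_emeasure[OF dist A])
  also have "\<dots> \<le> (\<integral>\<^sup>+x. ?C * (ennreal (D x) * indicator A x) \<partial>?L)"
  proof (rule nn_integral_mono)
    fix x
    have "ennreal (excursion_density k t x) \<le> ?C * ennreal (D x)"
      using excursion_density_le[OF k t \<beta>, of x] C0
      unfolding D_def[symmetric] by (simp add: ennreal_mult'[symmetric] ennreal_leI)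
    then show "ennreal (excursion_density k t x) * indicator A x \<le> ?C * (ennreal (D x) * indicator A x)"
      by (simp add: indicator_def)
  qed
  also have "\<dots> = ?C * (\<integral>\<^sup>+x. ennreal (D x) * indicator A x \<partial>?L)"
    using Dm A by (intro nn_integral_cmult) auto
  also have "(\<integral>\<^sup>+x. ennreal (D x) * indicator A x \<partial>?L) =
      (\<integral>\<^sup>+z. ennreal (D (partial_sums k z)) * indicator A (partial_sums k z) \<partial>?L)"
    using Dm A by (intro nn_integral_partial_sums) auto
  also have "\<dots> = (\<integral>\<^sup>+z. indicator A (partial_sums k z) * (\<Prod>i<k. ennreal (walk_weight t i (z i))) \<partial>?L)"
  proof (rule nn_integral_cong)
    fix z
    obtain k' where k': "k = Suc k'" using k by (cases k) auto
    have t0: "t 0 > 0" using t(2) k by (auto simp: subset_eq)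
    have "ennreal (D (partial_sums k z)) = ennreal (hit (t 0) (z 0)) * (\<Prod>i<k - 1. ennreal (normal_density 0 (sqrt (t (Suc i) - t i)) (z (Suc i))))"
    proof -
      have "D (partial_sums k z) = hit (t 0) (z 0) * (\<Prod>i<k - 1. normal_density 0 (sqrt (t (Suc i) - t i)) (z (Suc i)))"
        unfolding D_def partial_sums_0[OF k]
        by (intro arg_cong2[where f = "(*)"] refl prod.cong) (auto simp: partial_sums_diff)
      then show ?thesis using t0 by (simp add: ennreal_mult hit_nonneg prod_nonneg prod_ennreal)
    qed
    also have "\<dots> = (\<Prod>i<k. ennreal (walk_weight t i (z i)))"
      unfolding k' by (simp only: prod.lessThan_Suc_shift) (simp add: walk_weight_def)
    finally show "ennreal (D (partial_sums k z)) * indicator A (partial_sums k z) =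
      indicator A (partial_sums k z) * (\<Prod>i<k. ennreal (walk_weight t i (z i)))"
      by (simp add: mult.commute)
  qed
  finally show ?thesis .
qed

section \<open>Monotone progressions and close minima of the excursion\<close>

lemma ennreal_mult3: "0 \<le> a \<Longrightarrow> 0 \<le> b \<Longrightarrow> ennreal a * (ennreal b * ennreal c) = ennreal (a * b * c)"
  by (simp add: ennreal_mult' mult.assoc)

lemma excursion_const_nonneg: "\<beta> < 1 \<Longrightarrow> 0 \<le> excursion_const \<beta>"
  by (simp add: excursion_const_def)

lemma nn_integral_normal_density:
  assumes "s > 0"
  shows "(\<integral>\<^sup>+z. ennreal (normal_density 0 (sqrt s) z) \<partial>lborel) = 1"
  using assms by (subst nn_integral_eq_integral) auto

text \<open>Reflection exchanges the two closed half-lines, which overlap in the null set {0}; each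
  therefore carries half of the mass.\<close>

lemma nn_integral_normal_density_half:
  assumes s: "s > 0" and sg: "\<sigma> \<in> {1, -1 :: real}"
  shows "(\<integral>\<^sup>+z. ennreal (normal_density 0 (sqrt s) z) * indicator {z. 0 \<le> \<sigma> * z} z \<partial>lborel) = ennreal (1 / 2)"
proof -
  define I where "I c = (\<integral>\<^sup>+z. ennreal (normal_density 0 (sqrt s) z) * indicator {z. 0 \<le> c * z} z \<partial>lborel)" for c :: real
  have m: "(\<lambda>z. ennreal (normal_density 0 (sqrt s) z) * indicator {z. 0 \<le> c * z} z) \<in> borel_measurable borel" for c :: real
    by measurable
  have neg: "I (- c) = I c" for c
  proof -
    have "I c = (\<integral>\<^sup>+z. ennreal (normal_density 0 (sqrt s) (- z)) * indicator {z. 0 \<le> c * z} (- z) \<partial>lborel)"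
      unfolding I_def using nn_integral_real_affine[OF m[of c], of "-1" 0] by simp
    also have "\<dots> = I (- c)"
      unfolding I_def by (intro nn_integral_cong) (auto simp: normal_density_def indicator_def)
    finally show ?thesis by simp
  qed
  have "I 1 + I (- 1) = (\<integral>\<^sup>+z. ennreal (normal_density 0 (sqrt s) z) * indicator {z. 0 \<le> 1 * z} z
       + ennreal (normal_density 0 (sqrt s) z) * indicator {z. 0 \<le> - 1 * z} z \<partial>lborel)"
    unfolding I_def by (intro nn_integral_add[symmetric]) simp_all
  also have "\<dots> = (\<integral>\<^sup>+z. ennreal (normal_density 0 (sqrt s) z) \<partial>lborel)"
    by (intro nn_integral_cong_AE, use AE_lborel_singleton[of 0] in eventually_elim)
      (auto simp: indicator_def)
  finally have "I 1 + I 1 = 1" using neg[of 1] nn_integral_normal_density[OF s] by simp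
  moreover from this have "I 1 \<noteq> top" by auto
  then obtain r where r: "0 \<le> r" "I 1 = ennreal r" by (cases "I 1") auto
  ultimately have "ennreal (r + r) = ennreal 1"
    by (simp only: ennreal_plus ennreal_1)
  then have "r + r = 1" by (rule iffD1[OF ennreal_inj, rotated 2]) (use r(1) in simp_all)
  then have "r = 1 / 2" by simp
  then have "I 1 = ennreal (1 / 2)" by (simp only: r(2))
  then show ?thesis using neg[of 1] sg unfolding I_def by auto
qed

lemma nn_integral_walk_weight:
  fixes t :: "nat \<Rightarrow> real"
  assumes t: "strict_mono_on {..<k} t" and "i < k" "i > 0"
  shows "(\<integral>\<^sup>+z. ennreal (walk_weight t i z) \<partial>lborel) = 1"
proof -
  have "t (i - 1) < t i" using assms by (intro strict_mono_onD[OF t]) auto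
  then show ?thesis using assms by (simp add: walk_weight_def nn_integral_normal_density)
qed

lemma nn_integral_walk_weight_0_le:
  assumes "0 < \<alpha>" "\<alpha> \<le> t 0"
  shows "(\<integral>\<^sup>+z. ennreal (walk_weight t 0 z) \<partial>lborel) \<le> ennreal (1 / sqrt (2 * pi * \<alpha>))"
proof -
  have "(\<integral>\<^sup>+z. ennreal (walk_weight t 0 z) \<partial>lborel) = ennreal (1 / sqrt (2 * pi * t 0))"
    using assms by (simp add: walk_weight_def nn_integral_hit)
  also have "\<dots> \<le> ennreal (1 / sqrt (2 * pi * \<alpha>))"
    using assms by (intro ennreal_leI divide_left_mono real_sqrt_le_mono mult_left_mono) auto
  finally show ?thesis .
qed

lemma borel_measurable_walk_weight [measurable]: "walk_weight t i \<in> borel_measurable borel"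
  by (cases "i = 0") (simp_all add: walk_weight_def[abs_def])

lemma measurable_lborel_fun_component:
  "j < k \<Longrightarrow> (\<lambda>z. z j) \<in> borel_measurable (lborel_fun k)"
  using measurable_component_singleton[of j "{..<k}" "\<lambda>_. lborel :: real measure"] by simp

text \<open>Under the dominating walk the k conditions concern k different independent increments,
  each of which has the prescribed sign with probability 1 / 2. The other factors are the domination
  constant and a bound on the mass of the first position.\<close>

lemma excursion_monotone_bound:
  assumes exc: "brownian_excursion M e" and sg: "\<sigma> \<in> {1, -1 :: real}"
    and h: "h > 0" and \<alpha>: "0 < \<alpha>" "\<alpha> \<le> t" and \<beta>: "t + real k * h \<le> \<beta>" "\<beta> < 1"
  shows "emeasure M {\<omega> \<in> space M. \<forall>i<k. 0 \<le> \<sigma> * (e \<omega> (t + real i * h + h) - e \<omega> (t + real i * h))}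
     \<le> ennreal (excursion_const \<beta> * (1 / sqrt (2 * pi * \<alpha>)) * (1 / 2) ^ k)"
proof -
  let ?L = "lborel_fun (Suc k)"
  let ?C = "ennreal (excursion_const \<beta>)"
  interpret product_sigma_finite "\<lambda>_::nat. lborel :: real measure" ..
  define \<tau> where "\<tau> i = t + real i * h" for i
  define A where "A = {x \<in> space (?L). \<forall>i<k. 0 \<le> \<sigma> * (x (Suc i) - x i)}"
  have \<tau>: "strict_mono_on {..<Suc k} \<tau>"
    using h by (auto simp: strict_mono_on_def \<tau>_def)
  have \<tau>le: "\<tau> i \<le> \<beta>" "\<alpha> \<le> \<tau> i" if "i < Suc k" for i
  proof -
    have "real i * h \<le> real k * h" using that h by (intro mult_right_mono) auto
    moreover have "0 \<le> real i * h" using h by simp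
    ultimately show "\<tau> i \<le> \<beta>" "\<alpha> \<le> \<tau> i" using \<alpha> \<beta> by (auto simp: \<tau>_def)
  qed
  then have img: "\<tau> ` {..<Suc k} \<subseteq> {0<..<1}" using \<alpha> \<beta> by force
  have Am: "A \<in> sets (?L)"
  proof -
    have [measurable]: "(\<lambda>x. \<sigma> * (x (Suc i) - x i)) \<in> borel_measurable (?L)"
      if "i \<in> {..<k}" for i
      using that by (intro borel_measurable_times borel_measurable_diff measurable_lborel_fun_component) auto
    have "A = {x \<in> space (?L). \<forall>i\<in>{..<k}. 0 \<le> \<sigma> * (x (Suc i) - x i)}"
      by (auto simp: A_def)
    also have "\<dots> \<in> sets (?L)" by measurable
    finally show ?thesis .
  qed
  \<comment> \<open>Each constraint is absorbed into the factor of its own increment, so that the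
    integral splits; the starting coordinate is unconstrained.\<close>
  define f where "f i z = ennreal (walk_weight \<tau> i z) * (if i = 0 then 1 else indicator {z. 0 \<le> \<sigma> * z} z)" for i z
  have fm: "f i \<in> borel_measurable lborel" for i
    unfolding f_def[abs_def] by measurable
  have "{\<omega> \<in> space M. \<forall>i<k. 0 \<le> \<sigma> * (e \<omega> (t + real i * h + h) - e \<omega> (t + real i * h))} =
      {\<omega> \<in> space M. (\<lambda>i\<in>{..<Suc k}. e \<omega> (\<tau> i)) \<in> A}"
    by (auto simp: A_def \<tau>_def algebra_simps space_PiM)
  also have "emeasure M \<dots> \<le> ?C * (\<integral>\<^sup>+z. indicator A (partial_sums (Suc k) z) *
     (\<Prod>i<Suc k. ennreal (walk_weight \<tau> i (z i))) \<partial>?L)"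
    using \<tau>le(1)[of k] \<beta> by (intro emeasure_excursion_le[OF exc _ \<tau> img _ _ Am]) auto
  also have "(\<integral>\<^sup>+z. indicator A (partial_sums (Suc k) z) *
     (\<Prod>i<Suc k. ennreal (walk_weight \<tau> i (z i))) \<partial>?L) =
     (\<integral>\<^sup>+z. (\<Prod>i<Suc k. f i (z i)) \<partial>?L)"
  proof (rule nn_integral_cong)
    fix z assume z: "z \<in> space (?L)"
    have "partial_sums (Suc k) z \<in> A \<longleftrightarrow> (\<forall>i<k. 0 \<le> \<sigma> * z (Suc i))"
      using measurable_space[OF measurable_partial_sums z] by (simp add: A_def partial_sums_diff)
    also have "\<dots> \<longleftrightarrow> (\<forall>i<Suc k. i \<noteq> 0 \<longrightarrow> 0 \<le> \<sigma> * z i)"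
      by (metis Suc_less_eq gr0_implies_Suc neq0_conv nat.distinct(1))
    finally have *: "partial_sums (Suc k) z \<in> A \<longleftrightarrow> (\<forall>i<Suc k. i \<noteq> 0 \<longrightarrow> 0 \<le> \<sigma> * z i)" .
    show "indicator A (partial_sums (Suc k) z) * (\<Prod>i<Suc k. ennreal (walk_weight \<tau> i (z i))) = (\<Prod>i<Suc k. f i (z i))"
    proof (cases "partial_sums (Suc k) z \<in> A")
      case True
      then have "f i (z i) = ennreal (walk_weight \<tau> i (z i))" if "i < Suc k" for i
        using * that by (simp add: f_def)
      then have "(\<Prod>i<Suc k. f i (z i)) = (\<Prod>i<Suc k. ennreal (walk_weight \<tau> i (z i)))"
        by (intro prod.cong) auto
      then show ?thesis using True by simp
    next
      case False
      then obtain i where "i < Suc k" "i \<noteq> 0" "\<not> 0 \<le> \<sigma> * z i" using * by blast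
      then have "f i (z i) = 0" "i \<in> {..<Suc k}" by (auto simp: f_def)
      then have "(\<Prod>i<Suc k. f i (z i)) = 0" by (intro prod_zero) auto
      then show ?thesis using False by simp
    qed
  qed
  also have "\<dots> = (\<Prod>i<Suc k. \<integral>\<^sup>+z. f i z \<partial>lborel)"
    using fm by (intro product_nn_integral_prod) auto
  also have "\<dots> = (\<integral>\<^sup>+z. f 0 z \<partial>lborel) * (\<Prod>i<k. \<integral>\<^sup>+z. f (Suc i) z \<partial>lborel)"
    by (rule prod.lessThan_Suc_shift)
  also have "(\<Prod>i<k. \<integral>\<^sup>+z. f (Suc i) z \<partial>lborel) = (\<Prod>i<k. ennreal (1 / 2))"
  proof (intro prod.cong refl)
    fix i
    have "\<tau> (Suc i) - \<tau> (Suc i - 1) = h" by (simp add: \<tau>_def algebra_simps)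
    then have "f (Suc i) = (\<lambda>z. ennreal (normal_density 0 (sqrt h) z) * indicator {z. 0 \<le> \<sigma> * z} z)"
      by (simp add: f_def[abs_def] walk_weight_def)
    then show "(\<integral>\<^sup>+z. f (Suc i) z \<partial>lborel) = ennreal (1 / 2)"
      using nn_integral_normal_density_half[OF h sg] by (simp only:)
  qed
  also have "\<dots> = ennreal ((1 / 2) ^ k)"
    by (simp only: prod_constant card_lessThan) (rule ennreal_power, simp)
  also have "?C * ((\<integral>\<^sup>+z. f 0 z \<partial>lborel) * ennreal ((1 / 2) ^ k))
     \<le> ?C * (ennreal (1 / sqrt (2 * pi * \<alpha>)) * ennreal ((1 / 2) ^ k))"
    using nn_integral_walk_weight_0_le[of \<alpha> \<tau>] \<alpha>
    by (intro mult_left_mono mult_right_mono) (simp_all add: f_def \<tau>_def)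
  also have "\<dots> = ennreal (excursion_const \<beta> * (1 / sqrt (2 * pi * \<alpha>)) * (1 / 2) ^ k)"
    using \<alpha> by (intro ennreal_mult3 excursion_const_nonneg \<beta>) auto
  finally show ?thesis .
qed

text \<open>Phrased through minimising indices rather than through the minima, so that the event is
  a finite Boolean combination of comparisons of coordinates.\<close>

definition block_minima_close :: "nat \<Rightarrow> nat \<Rightarrow> real \<Rightarrow> (nat \<Rightarrow> real) \<Rightarrow> bool" where
  "block_minima_close j k \<epsilon> x \<longleftrightarrow> (\<exists>i\<in>{..<j}. \<exists>l\<in>{j..<k}. (\<forall>i'\<in>{..<j}. x i \<le> x i') \<and>
      (\<forall>l'\<in>{j..<k}. x l \<le> x l') \<and> \<bar>x i - x l\<bar> \<le> \<epsilon>)"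

lemma sets_block_minima_close:
  fixes X :: "nat \<Rightarrow> 'a \<Rightarrow> real"
  assumes X: "\<And>i. i < k \<Longrightarrow> X i \<in> borel_measurable M" and j: "j \<le> k"
  shows "{\<omega> \<in> space M. block_minima_close j k \<epsilon> (\<lambda>i. X i \<omega>)} \<in> sets M"
proof -
  have le: "Measurable.pred M (\<lambda>\<omega>. X i \<omega> \<le> X l \<omega>)" "Measurable.pred M (\<lambda>\<omega>. \<bar>X i \<omega> - X l \<omega>\<bar> \<le> \<epsilon>)"
    if "i < k" "l < k" for i l
    using X[OF that(1)] X[OF that(2)] by measurable
  have "Measurable.pred M (\<lambda>\<omega>. \<exists>i\<in>{..<j}. \<exists>l\<in>{j..<k}. (\<forall>i'\<in>{..<j}. X i \<omega> \<le> X i' \<omega>) \<and>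
      (\<forall>l'\<in>{j..<k}. X l \<omega> \<le> X l' \<omega>) \<and> \<bar>X i \<omega> - X l \<omega>\<bar> \<le> \<epsilon>)"
    using j by (intro pred_intros_finite(3,4) pred_intros_logic(3) le) auto
  then show ?thesis unfolding block_minima_close_def by (rule predE)
qed

text \<open>Increment j moves the whole second block and leaves the first one fixed. Given all other
  increments, the minima are \<epsilon>-close only if increment j falls in an interval of length 2 *
  \<epsilon>, and its Gaussian density is at most 1 / sqrt (2 pi \<gamma>). The bound is independent
  of the number of times.\<close>

lemma excursion_block_minima_bound:
  fixes t :: "nat \<Rightarrow> real"
  assumes exc: "brownian_excursion M e"
    and t: "strict_mono_on {..<k} t" "t ` {..<k} \<subseteq> {\<alpha>..\<beta>}" and \<alpha>: "0 < \<alpha>" and \<beta>: "\<beta> < 1"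
    and j: "0 < j" "j < k" and \<gamma>: "0 < \<gamma>" "\<gamma> \<le> t j - t (j - 1)" and \<epsilon>: "\<epsilon> \<ge> 0"
  shows "emeasure M {\<omega> \<in> space M. block_minima_close j k \<epsilon> (\<lambda>i. e \<omega> (t i))}
     \<le> ennreal (excursion_const \<beta> * (1 / sqrt (2 * pi * \<alpha>)) * (1 / sqrt (2 * pi * \<gamma>) * (2 * \<epsilon>)))"
proof -
  let ?C = "ennreal (excursion_const \<beta>)"
  let ?g = "ennreal (1 / sqrt (2 * pi * \<gamma>))"
  let ?d = "ennreal (1 / sqrt (2 * pi * \<gamma>) * (2 * \<epsilon>))"
  interpret product_sigma_finite "\<lambda>_::nat. lborel :: real measure" ..
  define A where "A = {x \<in> space (lborel_fun k). block_minima_close j k \<epsilon> x}"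
  have k: "k \<ge> 1" using j by simp
  have img: "t ` {..<k} \<subseteq> {0<..<1}" using t(2) \<alpha> \<beta> by force
  have t0: "\<alpha> \<le> t 0" "t (k - 1) \<le> \<beta>" using t(2) j by (auto simp: image_subset_iff)
  have Am: "A \<in> sets (lborel_fun k)"
    unfolding A_def
    using j by (intro sets_block_minima_close[where X = "\<lambda>i x. x i"] measurable_lborel_fun_component) auto
  \<comment> \<open>Coordinate j is integrated first, with the other coordinates frozen.\<close>
  define I where "I = {..<k} - {j}"
  have I: "{..<k} = insert j I" "j \<notin> I" "finite I" using j by (auto simp: I_def)
  define W where "W i z = ennreal (walk_weight t i z)" for i z
  have Wm [measurable]: "W i \<in> borel_measurable lborel" for i unfolding W_def[abs_def] by measurable
  define F where "F z = indicator A (partial_sums k z) * (\<Prod>i<k. W i (z i))" for z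
  have Fm: "F \<in> borel_measurable (lborel_fun k)"
    unfolding F_def[abs_def]
  proof (intro borel_measurable_times_ennreal borel_measurable_prod_ennreal)
    show "(\<lambda>z. indicator A (partial_sums k z)) \<in> borel_measurable (lborel_fun k)"
      using Am by measurable
    show "(\<lambda>z. W i (z i)) \<in> borel_measurable (lborel_fun k)" if "i \<in> {..<k}" for i
      using that measurable_compose[OF measurable_lborel_fun_component, of i k "W i" borel] Wm by simp
  qed
  have Wj: "W j y \<le> ?g" for y
  proof -
    have "normal_density 0 (sqrt (t j - t (j - 1))) y \<le> 1 / sqrt (2 * pi * (t j - t (j - 1)))"
      using \<gamma> by (intro normal_density_0_le) auto
    also have "\<dots> \<le> 1 / sqrt (2 * pi * \<gamma>)"
      using \<gamma> by (intro divide_left_mono real_sqrt_le_mono mult_left_mono) auto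
    finally show ?thesis using j by (simp add: W_def walk_weight_def ennreal_leI)
  qed
  have inner: "(\<integral>\<^sup>+y. F (z(j := y)) \<partial>lborel) \<le> (\<Prod>i\<in>I. W i (z i)) * ?d"
    for z
  proof -
    \<comment> \<open>The path with its linking increment set to 0: the true path is X on the first
      block and X + y on the second, so its block minima agree exactly for y = m.\<close>
    define X where "X = partial_sums k (z(j := 0))"
    define m where "m = Min (X ` {..<j}) - Min (X ` {j..<k})"
    have ps: "partial_sums k (z(j := y)) i = X i + (if j \<le> i then y else 0)" if "i < k" for i y
    proof -
      have "(\<Sum>l\<le>i. (z(j := y)) l) = (\<Sum>l\<le>i. (z(j := 0)) l + (if l = j then y else 0))"
        by (intro sum.cong) auto
      also have "\<dots> = (\<Sum>l\<le>i. (z(j := 0)) l) + (if j \<le> i then y else 0)"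
        by (simp add: sum.distrib)
      finally show ?thesis using that by (simp add: X_def partial_sums_def)
    qed
    have mem: "y \<in> {m - \<epsilon>..m + \<epsilon>}" if "partial_sums k (z(j := y)) \<in> A" for y
    proof -
      let ?x = "partial_sums k (z(j := y))"
      obtain i l where il: "i < j" "l \<in> {j..<k}" "\<And>i'. i' < j \<Longrightarrow> ?x i \<le> ?x i'"
        "\<And>l'. l' \<in> {j..<k} \<Longrightarrow> ?x l \<le> ?x l'" "\<bar>?x i - ?x l\<bar> \<le> \<epsilon>"
        using \<open>?x \<in> A\<close> by (auto simp: A_def block_minima_close_def)
      have "Min (X ` {..<j}) = X i"
        using il(1) il(3) j by (intro Min_eqI) (auto simp: ps)
      moreover have "Min (X ` {j..<k}) = X l"
        using il(2) il(4) j by (intro Min_eqI) (auto simp: ps)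
      moreover have "?x i = X i" "?x l = X l + y" using il j by (auto simp: ps)
      ultimately show ?thesis using il(5) by (auto simp: m_def)
    qed
    have "F (z(j := y)) \<le> (\<Prod>i\<in>I. W i (z i)) * (?g * indicator {m - \<epsilon>..m + \<epsilon>} y)" for y
    proof -
      have "(\<Prod>i<k. W i ((z(j := y)) i)) = W j y * (\<Prod>i\<in>I. W i ((z(j := y)) i))"
        unfolding I(1) using I(2,3) by simp
      also have "(\<Prod>i\<in>I. W i ((z(j := y)) i)) = (\<Prod>i\<in>I. W i (z i))"
        using I(2) by (intro prod.cong) auto
      finally have *: "(\<Prod>i<k. W i ((z(j := y)) i)) = W j y * (\<Prod>i\<in>I. W i (z i))" .
      have "indicator A (partial_sums k (z(j := y))) \<le> (indicator {m - \<epsilon>..m + \<epsilon>} y :: ennreal)"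
        using mem[of y] by (simp add: indicator_def)
      then have "F (z(j := y)) \<le> indicator {m - \<epsilon>..m + \<epsilon>} y * (?g * (\<Prod>i\<in>I. W i (z i)))"
        unfolding F_def * by (intro mult_mono Wj) auto
      then show ?thesis by (simp add: mult_ac)
    qed
    then have "(\<integral>\<^sup>+y. F (z(j := y)) \<partial>lborel) \<le>
       (\<integral>\<^sup>+y. (\<Prod>i\<in>I. W i (z i)) * (?g * indicator {m - \<epsilon>..m + \<epsilon>} y) \<partial>lborel)"
      by (intro nn_integral_mono)
    also have "\<dots> = (\<Prod>i\<in>I. W i (z i)) * (?g * ennreal (2 * \<epsilon>))"
      using \<epsilon> by (simp add: nn_integral_cmult)
    also have "?g * ennreal (2 * \<epsilon>) = ?d"
      using \<epsilon> \<gamma> by (subst ennreal_mult) auto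
    finally show ?thesis .
  qed
  have "emeasure M {\<omega> \<in> space M. block_minima_close j k \<epsilon> (\<lambda>i. e \<omega> (t i))} =
     emeasure M {\<omega> \<in> space M. (\<lambda>i\<in>{..<k}. e \<omega> (t i)) \<in> A}"
  proof (intro arg_cong[where f = "emeasure M"] Collect_cong conj_cong refl)
    fix \<omega>
    have "block_minima_close j k \<epsilon> (\<lambda>i\<in>{..<k}. e \<omega> (t i)) \<longleftrightarrow> block_minima_close j k \<epsilon> (\<lambda>i. e \<omega> (t i))"
      using j unfolding block_minima_close_def by (intro bex_cong conj_cong refl) auto
    then show "block_minima_close j k \<epsilon> (\<lambda>i. e \<omega> (t i)) \<longleftrightarrow>
      (\<lambda>i\<in>{..<k}. e \<omega> (t i)) \<in> A"
      by (simp add: A_def space_PiM)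
  qed
  also have "\<dots> \<le> ?C * (\<integral>\<^sup>+z. F z \<partial>lborel_fun k)"
    unfolding F_def W_def using t0 \<beta> by (intro emeasure_excursion_le[OF exc k t(1) img _ _ Am]) auto
  also have "\<dots> \<le> ?C * ((\<integral>\<^sup>+z. W 0 z \<partial>lborel) * 1 * ?d)"
  proof (rule mult_left_mono)
    have "(\<integral>\<^sup>+z. F z \<partial>lborel_fun k) = (\<integral>\<^sup>+z. \<integral>\<^sup>+y. F (z(j := y)) \<partial>lborel \<partial>Pi\<^sub>M I (\<lambda>_. lborel))"
    using Fm unfolding I(1) by (intro product_nn_integral_insert I) auto
  also have "\<dots> \<le> (\<integral>\<^sup>+z. (\<Prod>i\<in>I. W i (z i)) * ?d \<partial>Pi\<^sub>M I (\<lambda>_. lborel))"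
    by (intro nn_integral_mono inner)
  also have "\<dots> = (\<integral>\<^sup>+z. (\<Prod>i\<in>I. W i (z i)) \<partial>Pi\<^sub>M I (\<lambda>_. lborel)) * ?d"
  proof (intro nn_integral_multc borel_measurable_prod_ennreal)
    show "(\<lambda>z. W i (z i)) \<in> borel_measurable (Pi\<^sub>M I (\<lambda>_. lborel))" if "i \<in> I" for i
      using measurable_compose[OF measurable_component_singleton[OF that, of "\<lambda>_. lborel"] Wm[of i]] by simp
  qed
  also have "(\<integral>\<^sup>+z. (\<Prod>i\<in>I. W i (z i)) \<partial>Pi\<^sub>M I (\<lambda>_. lborel)) = (\<Prod>i\<in>I. \<integral>\<^sup>+z. W i z \<partial>lborel)"
    using I Wm by (intro product_nn_integral_prod) auto
  also have "\<dots> = (\<integral>\<^sup>+z. W 0 z \<partial>lborel) * (\<Prod>i\<in>I - {0}. \<integral>\<^sup>+z. W i z \<partial>lborel)"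
    using I(3) j by (intro prod.remove) (auto simp: I_def)
  also have "(\<Prod>i\<in>I - {0}. \<integral>\<^sup>+z. W i z \<partial>lborel) = 1"
    unfolding W_def by (intro prod.neutral ballI nn_integral_walk_weight[OF t(1)]) (auto simp: I_def)
  finally show "(\<integral>\<^sup>+z. F z \<partial>lborel_fun k) \<le> (\<integral>\<^sup>+z. W 0 z \<partial>lborel) * 1 * ?d" .
  qed simp
  also have "\<dots> \<le> ?C * (ennreal (1 / sqrt (2 * pi * \<alpha>)) * ?d)"
    unfolding mult_1_right W_def
    by (rule mult_left_mono[OF mult_right_mono[OF nn_integral_walk_weight_0_le[where t = t, OF \<alpha> t0(1)]]]) simp_all
  also have "\<dots> = ennreal (excursion_const \<beta> * (1 / sqrt (2 * pi * \<alpha>)) * (1 / sqrt (2 * pi * \<gamma>) * (2 * \<epsilon>)))"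
    using \<alpha> by (intro ennreal_mult3 excursion_const_nonneg \<beta>) auto
  finally show ?thesis .
qed

section \<open>Joint measurability of the path in time and chance\<close>

lemma floor_quotient_tendsto:
  fixes x :: real
  shows "(\<lambda>n. real_of_int \<lfloor>real (Suc n) * x\<rfloor> / real (Suc n)) \<longlonglongrightarrow> x"
proof (rule real_tendsto_sandwich)
  show "(\<lambda>n. x - 1 / real (Suc n)) \<longlonglongrightarrow> x"
    using tendsto_diff[OF tendsto_const LIMSEQ_Suc[OF lim_1_over_n], of "x"] by simp
  show "\<forall>\<^sub>F n in sequentially. x - 1 / real (Suc n) \<le> real_of_int \<lfloor>real (Suc n) * x\<rfloor> / real (Suc n)"
  proof (intro always_eventually allI)
    fix n
    have "real (Suc n) * x - 1 \<le> real_of_int \<lfloor>real (Suc n) * x\<rfloor>" by linarith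
    then have "(real (Suc n) * x - 1) / real (Suc n) \<le> real_of_int \<lfloor>real (Suc n) * x\<rfloor> / real (Suc n)"
      by (intro divide_right_mono) auto
    then show "x - 1 / real (Suc n) \<le> real_of_int \<lfloor>real (Suc n) * x\<rfloor> / real (Suc n)"
      by (simp add: diff_divide_distrib)
  qed
  show "\<forall>\<^sub>F n in sequentially. real_of_int \<lfloor>real (Suc n) * x\<rfloor> / real (Suc n) \<le> x"
  proof (intro always_eventually allI)
    fix n
    have "real_of_int \<lfloor>real (Suc n) * x\<rfloor> / real (Suc n) \<le> (real (Suc n) * x) / real (Suc n)"
      by (intro divide_right_mono) auto
    then show "real_of_int \<lfloor>real (Suc n) * x\<rfloor> / real (Suc n) \<le> x" by simp
  qed
qed simp

text \<open>A continuous path is the limit of its values at rounded times, and these depend on time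
  through countably many values. The time is clamped to [0,1], since nothing is known of the path
  outside.\<close>

lemma measurable_path:
  fixes e :: "'a \<Rightarrow> real \<Rightarrow> real"
  assumes e: "\<And>t. t \<in> {0..1} \<Longrightarrow> (\<lambda>\<omega>. e \<omega> t) \<in> borel_measurable N"
    and cont: "\<And>\<omega>. \<omega> \<in> space N \<Longrightarrow> continuous_on {0..1} (e \<omega>)"
  shows "(\<lambda>x. e (fst x) (max 0 (min 1 (snd x)))) \<in> borel_measurable (N \<Otimes>\<^sub>M borel)"
proof -
  define c where "c t = max 0 (min 1 t)" for t :: real
  have c01: "c t \<in> {0..1}" for t by (simp add: c_def)
  have cc: "isCont c t" for t unfolding c_def[abs_def] by (intro continuous_intros)
  define u where "u n x = e (fst x) (c (real_of_int \<lfloor>real (Suc n) * snd x\<rfloor> / real (Suc n)))" for n x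
  have um: "u n \<in> borel_measurable (N \<Otimes>\<^sub>M borel)" for n
    unfolding u_def[abs_def]
  proof (rule measurable_compose_countable[where g = "\<lambda>x. \<lfloor>real (Suc n) * snd x\<rfloor>"])
    show "(\<lambda>x. e (fst x) (c (real_of_int i / real (Suc n)))) \<in> borel_measurable (N \<Otimes>\<^sub>M borel)" for i
      by (rule measurable_compose[OF measurable_fst e[OF c01]])
    show "(\<lambda>x. \<lfloor>real (Suc n) * snd x\<rfloor>) \<in> N \<Otimes>\<^sub>M borel \<rightarrow>\<^sub>M count_space UNIV" by measurable
  qed
  have ul: "(\<lambda>n. u n x) \<longlonglongrightarrow> e (fst x) (c (snd x))" if "x \<in> space (N \<Otimes>\<^sub>M borel)" for x
  proof -
    have "(\<lambda>n. real_of_int \<lfloor>real (Suc n) * snd x\<rfloor> / real (Suc n)) \<longlonglongrightarrow> snd x"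
      by (rule floor_quotient_tendsto)
    then have "(\<lambda>n. c (real_of_int \<lfloor>real (Suc n) * snd x\<rfloor> / real (Suc n))) \<longlonglongrightarrow> c (snd x)"
      by (rule isCont_tendsto_compose[OF cc])
    moreover have "continuous_on {0..1} (e (fst x))"
      using that by (intro cont) (auto simp: space_pair_measure)
    ultimately show ?thesis unfolding u_def
      by (intro continuous_on_tendsto_compose[of "{0..1}" "e (fst x)"]) (use c01 in auto)
  qed
  show ?thesis unfolding c_def[symmetric]
    by (rule borel_measurable_LIMSEQ_real[OF ul um])
qed

lemma measurable_path_compose:
  fixes e :: "'a \<Rightarrow> real \<Rightarrow> real"
  assumes e: "\<And>t. t \<in> {0..1} \<Longrightarrow> (\<lambda>\<omega>. e \<omega> t) \<in> borel_measurable N"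
    and cont: "\<And>\<omega>. \<omega> \<in> space N \<Longrightarrow> continuous_on {0..1} (e \<omega>)"
    and g: "g \<in> L \<rightarrow>\<^sub>M N" and f: "f \<in> borel_measurable L"
  shows "(\<lambda>x. e (g x) (max 0 (min 1 (f x)))) \<in> borel_measurable L"
proof -
  have "(\<lambda>x. (g x, f x)) \<in> L \<rightarrow>\<^sub>M N \<Otimes>\<^sub>M borel" using g f by measurable
  from measurable_compose[OF this measurable_path[of e N, OF e cont]] show ?thesis by simp
qed

section \<open>Almost no time is a one-sided minimum\<close>

lemma brownian_excursionD:
  assumes "brownian_excursion M e"
  shows "prob_space M" "t \<in> {0..1} \<Longrightarrow> (\<lambda>\<omega>. e \<omega> t) \<in> borel_measurable M"
    "\<omega> \<in> space M \<Longrightarrow> continuous_on {0..1} (e \<omega>)"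
  using assms unfolding brownian_excursion_def by blast+

lemma AE_no_monotone_chain:
  assumes exc: "brownian_excursion M e" and sg: "\<sigma> \<in> {1, -1 :: real}"
    and \<alpha>\<beta>: "0 < \<alpha>" "\<alpha> \<le> \<beta>" "\<beta> < 1"
  shows "AE \<omega> in M. null_chains (\<lambda>x y. 0 \<le> \<sigma> * (e \<omega> y - e \<omega> x)) \<alpha> \<beta>"
proof -
  interpret prob_space M using brownian_excursionD(1)[OF exc] .
  show ?thesis
  proof (rule AE_no_chain)
    fix h :: real assume h: "h > 0"
    define P where "P x \<longleftrightarrow> \<alpha> \<le> snd x \<and> snd x + h \<le> \<beta> \<and>
      0 \<le> \<sigma> * (e (fst x) (max 0 (min 1 (snd x + h))) - e (fst x) (max 0 (min 1 (snd x))))" for x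
    have [measurable]: "(\<lambda>x. e (fst x) (max 0 (min 1 (snd x + h)))) \<in> borel_measurable (M \<Otimes>\<^sub>M borel)"
      "(\<lambda>x. e (fst x) (max 0 (min 1 (snd x)))) \<in> borel_measurable (M \<Otimes>\<^sub>M borel)"
      by (intro measurable_path_compose[OF brownian_excursionD(2,3)[OF exc]]; measurable)+
    have "{x \<in> space (M \<Otimes>\<^sub>M borel). P x} \<in> sets (M \<Otimes>\<^sub>M borel)"
      unfolding P_def by measurable
    also have "{x \<in> space (M \<Otimes>\<^sub>M borel). P x} = {(\<omega>, t). \<omega> \<in> space M \<and> \<alpha> \<le> t \<and> t + h \<le> \<beta> \<and> 0 \<le> \<sigma> * (e \<omega> (t + h) - e \<omega> t)}"
      using \<alpha>\<beta> h by (auto simp: P_def space_pair_measure)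
    finally show "{(\<omega>, t). \<omega> \<in> space M \<and> \<alpha> \<le> t \<and> t + h \<le> \<beta> \<and> 0 \<le> \<sigma> * (e \<omega> (t + h) - e \<omega> t)} \<in> sets (M \<Otimes>\<^sub>M borel)" .
  next
    fix k h assume h: "(h :: real) > 0"
    show "AE t in lborel. \<alpha> \<le> t \<longrightarrow> t + real k * h \<le> \<beta> \<longrightarrow>
      emeasure M {\<omega> \<in> space M. \<forall>i<k. 0 \<le> \<sigma> * (e \<omega> (t + real i * h + h) - e \<omega> (t + real i * h))}
        \<le> ennreal (excursion_const \<beta> * (1 / sqrt (2 * pi * \<alpha>)) * (1 / 2) ^ k)"
      using excursion_monotone_bound[OF exc sg h \<alpha>\<beta>(1) _ _ \<alpha>\<beta>(3)] by (intro AE_I2) auto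
  qed (use \<alpha>\<beta> in \<open>auto simp: excursion_const_def\<close>)
qed

text \<open>The point is a weak local minimum neither from the right nor from the left. It can
  therefore not realise the minimum over an interval of which it is an end point.\<close>

definition generic_point :: "(real \<Rightarrow> real) \<Rightarrow> real \<Rightarrow> bool" where
  "generic_point f t \<longleftrightarrow> (\<forall>\<delta>>0. \<exists>y. t < y \<and> y < t + \<delta> \<and> y \<le> 1 \<and> f y < f t) \<and>
     (\<forall>\<delta>>0. \<exists>y. t - \<delta> < y \<and> y < t \<and> 0 \<le> y \<and> f y < f t)"

text \<open>Two right-sided minima x < y of the same scale, closer than that scale, satisfy e x
  \<le> e y; for left-sided minima the inequality is reversed. Each such set is a chain for one of
  the two monotone relations, and countably many scales and margins cover all exceptional
  times.\<close>

lemma AE_generic_point: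
  assumes exc: "brownian_excursion M e"
  shows "AE \<omega> in M. AE t in lborel. t \<in> {0<..<1} \<longrightarrow> generic_point (e \<omega>) t"
proof -
  \<comment> \<open>Used both as the margin at 0 and 1 and as the scale of a one-sided minimum. The
    2 keeps the margin at most 1 / 2, so the remaining interval is never empty.\<close>
  define a where "a m = 1 / real (m + 2)" for m :: nat
  have a: "0 < a m" "a m \<le> 1 - a m" for m by (auto simp: a_def field_simps)
  have "AE \<omega> in M. null_chains (\<lambda>x y. 0 \<le> \<sigma> * (e \<omega> y - e \<omega> x)) (a m) (1 - a m)"
    if "\<sigma> \<in> {1, -1}" for \<sigma> m
    using a[of m] by (intro AE_no_monotone_chain[OF exc that]) auto
  then have "AE \<omega> in M. \<forall>m. \<forall>\<sigma>\<in>{1, -1}. null_chains (\<lambda>x y. 0 \<le> \<sigma> * (e \<omega> y - e \<omega> x)) (a m) (1 - a m)"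
    by (subst AE_all_countable, intro allI AE_finite_allI) auto
  from this AE_space show ?thesis
  proof eventually_elim
    case (elim \<omega>)
    note ch = elim(1) and \<omega> = elim(2)
    define g where "g t = e \<omega> (max 0 (min 1 t))" for t
    have g: "continuous_on UNIV g"
      unfolding g_def
      by (rule continuous_on_compose2[OF brownian_excursionD(3)[OF exc \<omega>]]) (auto intro!: continuous_intros)
    have ge: "g t = e \<omega> t" if "0 \<le> t" "t \<le> 1" for t using that by (simp add: g_def)
    \<comment> \<open>\<sigma> = 1 looks to the right and \<sigma> = -1 to the left, and the two
      inequalities keep the window inside [0,1]. With the offset written as r * a n for a fixed r,
      the set is an intersection of closed sets.\<close>
    define B where "B \<sigma> m n = {t \<in> {a m..1 - a m}. (\<sigma> * a n \<le> 1 - t \<and> - \<sigma> * a n \<le> t) \<and>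
      (\<forall>r\<in>{0..1}. g t \<le> g (t + \<sigma> * (r * a n)))}" for \<sigma> m n
    have Bm: "B \<sigma> m n \<in> sets borel" for \<sigma> m n
    proof -
      have cl: "closed {t. g t \<le> g (t + \<sigma> * (r * a n))}" for r
      proof (intro closed_Collect_le g)
        show "continuous_on UNIV (\<lambda>t. g (t + \<sigma> * (r * a n)))"
          by (rule continuous_on_compose2[OF g]) (auto intro!: continuous_intros)
      qed
      have "B \<sigma> m n = {a m..1 - a m} \<inter> ({..1 - \<sigma> * a n} \<inter> {- \<sigma> * a n..}) \<inter> (\<Inter>r\<in>{0..1}. {t. g t \<le> g (t + \<sigma> * (r * a n))})"
        by (auto simp: B_def)
      also have "closed \<dots>" using cl by (intro closed_Int closed_INT) auto
      finally show ?thesis by simp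
    qed
    have Bn: "emeasure lborel (B \<sigma> m n) = 0" if \<sigma>: "\<sigma> \<in> {1, -1}" for \<sigma> m n
    proof -
      have "0 \<le> \<sigma> * (e \<omega> y - e \<omega> x)" if x: "x \<in> B \<sigma> m n" and y: "y \<in> B \<sigma> m n" and xy: "x < y" "y < x + a n" for x y
      proof -
        define r where "r = (y - x) / a n"
        have r: "r \<in> {0..1}" "r * a n = y - x" using xy a(1)[of n] by (auto simp: r_def field_simps)
        have I: "0 \<le> x" "x \<le> 1" "0 \<le> y" "y \<le> 1" using x y a(1)[of m] by (auto simp: B_def)
        have "g x \<le> g (x + \<sigma> * (r * a n))" "g y \<le> g (y + \<sigma> * (r * a n))"
          using x y r(1) by (auto simp: B_def)
        then show ?thesis using \<sigma> r(2) ge[OF I(1,2)] ge[OF I(3,4)] by auto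
      qed
      moreover have "B \<sigma> m n \<subseteq> {a m..1 - a m}" by (auto simp: B_def)
      ultimately show ?thesis
        using ch[rule_format, OF \<sigma>, unfolded null_chains_def, rule_format, of "B \<sigma> m n" m "a n"] Bm a(1)[of n] by blast
    qed
    have null: "(\<Union>m. \<Union>n. B 1 m n \<union> B (-1) m n) \<in> null_sets lborel"
      using Bm Bn by (intro null_sets_UN null_sets.Un) (auto simp: null_sets_def)
    have near: "\<exists>n. a n < \<delta>" if d: "\<delta> > 0" for \<delta>
    proof -
      obtain n where "inverse (real (Suc n)) < \<delta>" using reals_Archimedean[OF d] by blast
      moreover have "a n \<le> inverse (real (Suc n))" by (simp add: a_def inverse_eq_divide field_simps)
      ultimately show ?thesis by (intro exI[of _ n]) linarith
    qed
    show "AE t in lborel. t \<in> {0<..<1} \<longrightarrow> generic_point (e \<omega>) t"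
    proof (rule AE_I'[OF null], rule subsetI)
      fix t assume "t \<in> {t \<in> space lborel. \<not> (t \<in> {0<..<1} \<longrightarrow> generic_point (e \<omega>) t)}"
      then have t: "0 < t" "t < 1" and ng: "\<not> generic_point (e \<omega>) t" by auto
      obtain m where m: "a m < min t (1 - t)" using near[of "min t (1 - t)"] t by auto
      then have tm: "t \<in> {a m..1 - a m}" by auto
      consider \<delta> where "\<delta> > 0" "\<And>y. t < y \<Longrightarrow> y < t + \<delta> \<Longrightarrow> y \<le> 1 \<Longrightarrow> e \<omega> t \<le> e \<omega> y"
        | \<delta> where "\<delta> > 0" "\<And>y. t - \<delta> < y \<Longrightarrow> y < t \<Longrightarrow> 0 \<le> y \<Longrightarrow> e \<omega> t \<le> e \<omega> y"
        using ng unfolding generic_point_def by (metis not_le)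
      then show "t \<in> (\<Union>m. \<Union>n. B 1 m n \<union> B (-1) m n)"
      proof cases
        case 1
        obtain n where n: "a n < min \<delta> (1 - t)" using near[of "min \<delta> (1 - t)"] t 1(1) by auto
        have "g t \<le> g (t + r * a n)" if "r \<in> {0..1}" for r
        proof (cases "r = 0")
          case False
          have "0 < r * a n" "r * a n \<le> 1 * a n"
            using that False a(1)[of n] by (auto intro!: mult_right_mono)
          then show ?thesis using 1(2)[of "t + r * a n"] n t by (simp add: ge)
        qed simp
        then have "t \<in> B 1 m n" using tm n a(1)[of n] t by (auto simp: B_def)
        then show ?thesis by blast
      next
        case 2
        obtain n where n: "a n < min \<delta> t" using near[of "min \<delta> t"] t 2(1) by auto
        have "g t \<le> g (t - r * a n)" if "r \<in> {0..1}" for r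
        proof (cases "r = 0")
          case False
          have "0 < r * a n" "r * a n \<le> 1 * a n"
            using that False a(1)[of n] by (auto intro!: mult_right_mono)
          then show ?thesis using 2(2)[of "t - r * a n"] n t by (simp add: ge)
        qed simp
        then have "t \<in> B (-1) m n" using tm n a(1)[of n] t by (auto simp: B_def)
        then show ?thesis by blast
      qed
    qed
  qed
qed

section \<open>Minima over disjoint intervals have distinct values\<close>

lemma grid_point_near:
  fixes a c u :: real
  assumes "a < c" "u \<in> {a..c}" "n \<ge> 1"
  obtains i where "i \<le> n" "\<bar>a + (c - a) * real i / real n - u\<bar> \<le> (c - a) / real n"
proof -
  define y where "y = real n * (u - a) / (c - a)"
  define i where "i = nat \<lfloor>y\<rfloor>"
  have y0: "0 \<le> y" using assms by (simp add: y_def)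
  have "y \<le> real n * 1" unfolding y_def times_divide_eq_right[symmetric]
    using assms by (intro mult_left_mono) (auto simp: field_simps)
  then have yn: "y \<le> real n" by simp
  have i: "real i \<le> y" "y \<le> real i + 1" using y0 by (auto simp: i_def)
  have "real i \<le> real n" using i yn by linarith
  have u: "u = a + (c - a) * y / real n" using assms by (simp add: y_def field_simps)
  have "a + (c - a) * real i / real n - u = (c - a) / real n * (real i - y)"
    unfolding u by (simp add: algebra_simps add_divide_distrib[symmetric] diff_divide_distrib[symmetric])
  then have "\<bar>a + (c - a) * real i / real n - u\<bar> = (c - a) / real n * \<bar>real i - y\<bar>"
    using assms by (simp add: abs_mult)
  also have "\<dots> \<le> (c - a) / real n * 1"
    using assms i by (intro mult_left_mono) auto
  finally show ?thesis using that[of i] \<open>real i \<le> real n\<close> by simp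
qed

definition equal_minima :: "(real \<Rightarrow> real) \<Rightarrow> real \<Rightarrow> real \<Rightarrow> real \<Rightarrow> real \<Rightarrow> bool" where
  "equal_minima f a c c' d \<longleftrightarrow> (\<exists>u\<in>{a..c}. \<exists>v\<in>{c'..d}. (\<forall>z\<in>{a..c}. f u \<le> f z) \<and>
     (\<forall>z\<in>{c'..d}. f v \<le> f z) \<and> f u = f v)"

text \<open>If the minima agree, then the sampled minima are within 1 / (m + 1) of each other for
  all fine samplings, and this has probability at most C / (m + 1), uniformly in the mesh. The gap
  between c and c' gives the linking increment a variance that does not shrink with the
  mesh.\<close>

lemma AE_interval_minima_distinct:
  assumes exc: "brownian_excursion M e"
    and ac: "0 < a" "a < c" "c < c'" "c' < d" "d < 1"
  shows "AE \<omega> in M. \<not> equal_minima (e \<omega>) a c c' d"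
proof -
  interpret prob_space M using brownian_excursionD(1)[OF exc] .
  \<comment> \<open>Indices 0 to n sample [a,c] and indices n + 1 to 2 n + 1 sample [c',d]. All end
    points are included, so the two blocks are separated by exactly c' - c for n \<ge> 1.\<close>
  define \<tau> where "\<tau> n i = (if i \<le> n then a + (c - a) * real i / real n else c' + (d - c') * real (i - Suc n) / real n)" for n i :: nat
  define E where "E m n = {\<omega> \<in> space M. block_minima_close (Suc n) (2 * Suc n) (1 / real (Suc m)) (\<lambda>i. e \<omega> (\<tau> n i))}" for m n
  define C where "C = excursion_const d * (1 / sqrt (2 * pi * a)) * (1 / sqrt (2 * pi * (c' - c)) * 2)"
  have C0: "C \<ge> 0" using ac by (simp add: C_def excursion_const_def)
  have \<tau>L: "\<tau> n i \<in> {a..c}" if "i \<le> n" "n \<ge> 1" for n i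
  proof -
    have "(c - a) * (real i / real n) \<le> (c - a) * 1" using ac that by (intro mult_left_mono) auto
    then show ?thesis using that ac by (simp add: \<tau>_def)
  qed
  have \<tau>R: "\<tau> n i \<in> {c'..d}" if "\<not> i \<le> n" "i < 2 * Suc n" "n \<ge> 1" for n i
  proof -
    have "real (i - Suc n) \<le> real n" using that by (simp add: le_diff_conv)
    then have "(d - c') * (real (i - Suc n) / real n) \<le> (d - c') * 1" using ac that by (intro mult_left_mono) auto
    then show ?thesis using that ac by (simp add: \<tau>_def)
  qed
  have \<tau>I: "\<tau> n i \<in> {a..d}" if "i < 2 * Suc n" "n \<ge> 1" for n i
    using \<tau>L[of i n] \<tau>R[of i n] that ac by (cases "i \<le> n") auto
  have Ee: "emeasure M (E m n) \<le> ennreal (C / real (Suc m))" if n: "n \<ge> 1" for m n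
  proof -
    have sm: "strict_mono_on {..<2 * Suc n} (\<tau> n)"
    proof (rule strict_mono_onI)
      fix i l assume il: "i \<in> {..<2 * Suc n}" "l \<in> {..<2 * Suc n}" "i < l"
      consider "l \<le> n" | "i \<le> n" "\<not> l \<le> n" | "\<not> i \<le> n" by linarith
      then show "\<tau> n i < \<tau> n l"
      proof cases
        case 1 then show ?thesis using il n ac by (auto simp: \<tau>_def intro!: divide_strict_right_mono)
      next
        case 2 then show ?thesis using \<tau>L[of i n] \<tau>R[of l n] il n ac by auto
      next
        case 3 then show ?thesis using il n ac by (auto simp: \<tau>_def intro!: divide_strict_right_mono)
      qed
    qed
    have "emeasure M (E m n) \<le> ennreal (excursion_const d * (1 / sqrt (2 * pi * a)) *
       (1 / sqrt (2 * pi * (c' - c)) * (2 * (1 / real (Suc m)))))"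
      unfolding E_def
    proof (rule excursion_block_minima_bound[OF exc sm])
      show "\<tau> n ` {..<2 * Suc n} \<subseteq> {a..d}" using \<tau>I n by blast
      show "c' - c \<le> \<tau> n (Suc n) - \<tau> n (Suc n - 1)" using n by (simp add: \<tau>_def)
    qed (use ac in auto)
    then show ?thesis by (simp add: C_def mult.assoc)
  qed
  have Em: "E m n \<in> sets M" if "n \<ge> 1" for m n
  proof -
    have "(\<lambda>\<omega>. e \<omega> (\<tau> n i)) \<in> borel_measurable M" if "i < 2 * Suc n" for i
      using \<tau>I[OF that \<open>n \<ge> 1\<close>] ac by (intro brownian_excursionD(2)[OF exc]) auto
    then show ?thesis unfolding E_def
      by (intro sets_block_minima_close[where X = "\<lambda>i \<omega>. e \<omega> (\<tau> n i)"]) auto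
  qed
  \<comment> \<open>The event that all sufficiently fine samplings have close minima. Starting at
    Suc N excludes n = 0, where the mesh is meaningless.\<close>
  define S where "S m = (\<Union>N. \<Inter>n\<in>{Suc N..}. E m n)" for m
  have Im: "(\<Inter>n\<in>{Suc N..}. E m n) \<in> sets M" for N m
    by (rule sets.countable_INT') (use Em in auto)
  have Sm: "S m \<in> sets M" for m unfolding S_def using Im by blast
  have Se: "emeasure M (S m) \<le> ennreal (C / real (Suc m))" for m
  proof -
    have "emeasure M (S m) = (SUP N. emeasure M (\<Inter>n\<in>{Suc N..}. E m n))"
      unfolding S_def using Im by (intro SUP_emeasure_incseq[symmetric]) (auto simp: incseq_def)
    also have "\<dots> \<le> ennreal (C / real (Suc m))"
    proof (rule SUP_least)
      fix N
      have "emeasure M (\<Inter>n\<in>{Suc N..}. E m n) \<le> emeasure M (E m (Suc N))"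
        by (rule emeasure_mono) (auto intro!: Em)
      also have "\<dots> \<le> ennreal (C / real (Suc m))" by (rule Ee) simp
      finally show "emeasure M (\<Inter>n\<in>{Suc N..}. E m n) \<le> ennreal (C / real (Suc m))" .
    qed
    finally show ?thesis .
  qed
  have "emeasure M (\<Inter>m. S m) \<le> ennreal (C * (1 / real (Suc m)))" for m
    using order_trans[OF emeasure_mono Se[of m], of "\<Inter>m. S m"] Sm by auto
  moreover have "(\<lambda>m. ennreal (C * (1 / real (Suc m)))) \<longlonglongrightarrow> ennreal (C * 0)"
    by (intro tendsto_ennrealI tendsto_mult tendsto_const LIMSEQ_Suc[OF lim_1_over_n])
  ultimately have "emeasure M (\<Inter>m. S m) \<le> 0" by (intro LIMSEQ_le_const) auto
  then have null: "(\<Inter>m. S m) \<in> null_sets M"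
    using Sm by (auto simp: null_sets_def)
  show ?thesis
  proof (rule AE_I'[OF null], rule subsetI)
    fix \<omega> assume "\<omega> \<in> {\<omega> \<in> space M. \<not> \<not> equal_minima (e \<omega>) a c c' d}"
    then have \<omega>: "\<omega> \<in> space M" and ex: "equal_minima (e \<omega>) a c c' d" by simp_all
    from ex[unfolded equal_minima_def] obtain u v where u1: "u \<in> {a..c}" and v1: "v \<in> {c'..d}" and u2: "\<forall>z\<in>{a..c}. e \<omega> u \<le> e \<omega> z"
      and v2: "\<forall>z\<in>{c'..d}. e \<omega> v \<le> e \<omega> z" and uv: "e \<omega> u = e \<omega> v" by blast
    note u = u1 u2[rule_format] and v = v1 v2[rule_format]
    have "uniformly_continuous_on {0..1} (e \<omega>)"
      using brownian_excursionD(3)[OF exc \<omega>] by (intro compact_uniformly_continuous) auto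
    have "\<omega> \<in> S m" for m
    proof -
      define \<epsilon> where "\<epsilon> = 1 / real (Suc m)"
      have "\<epsilon> > 0" by (simp add: \<epsilon>_def)
      then obtain \<delta> where \<delta>: "\<delta> > 0" "\<And>x y. x \<in> {0..1} \<Longrightarrow> y \<in> {0..1} \<Longrightarrow> dist y x < \<delta> \<Longrightarrow> dist (e \<omega> y) (e \<omega> x) < \<epsilon>"
        using \<open>uniformly_continuous_on {0..1} (e \<omega>)\<close> unfolding uniformly_continuous_on_def by metis
      obtain N where N: "inverse (real (Suc N)) < \<delta>" using reals_Archimedean[OF \<delta>(1)] by blast
      have "\<omega> \<in> E m n" if n: "n \<ge> Suc N" for n
      proof -
        have n1: "n \<ge> 1" using n by simp
        have "1 / real n \<le> inverse (real (Suc N))" using n by (simp add: inverse_eq_divide frac_le)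
        then have nd: "1 / real n < \<delta>" using N by linarith
        \<comment> \<open>The two intervals lie in (0,1), so their lengths are below 1 and 1 / n
          controls both meshes.\<close>
        have mesh: "x / real n < \<delta>" if "x \<le> 1" for x
        proof -
          have "x / real n \<le> 1 / real n" using that by (intro divide_right_mono) auto
          then show ?thesis using nd by linarith
        qed
        obtain i0 where i0: "i0 \<le> n" "\<bar>a + (c - a) * real i0 / real n - u\<bar> \<le> (c - a) / real n"
          using grid_point_near[OF ac(2) u(1) n1] by blast
        obtain l0 where l0: "l0 \<le> n" "\<bar>c' + (d - c') * real l0 / real n - v\<bar> \<le> (d - c') / real n"
          using grid_point_near[OF ac(4) v(1) n1] by blast
        have "dist (\<tau> n i0) u < \<delta>"
          using i0 mesh[of "c - a"] ac by (simp add: \<tau>_def dist_real_def)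
        then have ei0: "e \<omega> (\<tau> n i0) < e \<omega> u + \<epsilon>"
          using \<delta>(2)[of u "\<tau> n i0"] \<tau>L[OF i0(1) n1] u(1) ac by (auto simp: dist_real_def)
        have "dist (\<tau> n (l0 + Suc n)) v < \<delta>"
          using l0 mesh[of "d - c'"] ac by (simp add: \<tau>_def dist_real_def)
        then have el0: "e \<omega> (\<tau> n (l0 + Suc n)) < e \<omega> v + \<epsilon>"
          using \<delta>(2)[of v "\<tau> n (l0 + Suc n)"] \<tau>R[of "l0 + Suc n" n] l0(1) n1 v(1) ac by (auto simp: dist_real_def)
        \<comment> \<open>Each sampled minimum lies between the true minimum and the true minimum
          plus \<epsilon>. The true minima agree, so the sampled ones differ by at most
          \<epsilon>.\<close>
        obtain i where i: "i \<in> {..<Suc n}" "\<forall>i'\<in>{..<Suc n}. e \<omega> (\<tau> n i) \<le> e \<omega> (\<tau> n i')"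
          using ex_is_arg_min_if_finite[of "{..<Suc n}" "\<lambda>i. e \<omega> (\<tau> n i)"] by (force simp: is_arg_min_linorder)
        obtain l where l: "l \<in> {Suc n..<2 * Suc n}" "\<forall>l'\<in>{Suc n..<2 * Suc n}. e \<omega> (\<tau> n l) \<le> e \<omega> (\<tau> n l')"
          using ex_is_arg_min_if_finite[of "{Suc n..<2 * Suc n}" "\<lambda>i. e \<omega> (\<tau> n i)"] by (force simp: is_arg_min_linorder)
        have "e \<omega> u \<le> e \<omega> (\<tau> n i)" using u(2) \<tau>L[of i n] i(1) n1 by auto
        moreover have "e \<omega> (\<tau> n i) < e \<omega> u + \<epsilon>" using bspec[OF i(2), of i0] i0(1) ei0 by simp
        moreover have "e \<omega> v \<le> e \<omega> (\<tau> n l)" using v(2) \<tau>R[of l n] l(1) n1 by auto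
        moreover have "e \<omega> (\<tau> n l) < e \<omega> v + \<epsilon>" using bspec[OF l(2), of "l0 + Suc n"] l0(1) el0 by simp
        ultimately have "\<bar>e \<omega> (\<tau> n i) - e \<omega> (\<tau> n l)\<bar> \<le> 1 / real (Suc m)"
          using uv unfolding \<epsilon>_def by linarith
        then show ?thesis using \<omega> i l unfolding E_def block_minima_close_def by blast
      qed
      then show ?thesis unfolding S_def by blast
    qed
    then show "\<omega> \<in> (\<Inter>m. S m)" by blast
  qed
qed

text \<open>Two local minima can be enclosed in disjoint intervals with rational end points over
  which each is the minimum; there are only countably many such pairs of intervals.\<close>

lemma AE_inj_on_local_minima:
  assumes exc: "brownian_excursion M e"
  shows "AE \<omega> in M. inj_on (e \<omega>) (local_minima (e \<omega>))"
proof -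
  have "AE \<omega> in M. \<forall>a c c' d :: rat. 0 < real_of_rat a \<longrightarrow> real_of_rat a < real_of_rat c \<longrightarrow>
      real_of_rat c < real_of_rat c' \<longrightarrow> real_of_rat c' < real_of_rat d \<longrightarrow> real_of_rat d < 1 \<longrightarrow>
      \<not> equal_minima (e \<omega>) (real_of_rat a) (real_of_rat c) (real_of_rat c') (real_of_rat d)"
    unfolding AE_all_countable
  proof (intro allI)
    fix a c c' d :: rat
    show "AE \<omega> in M. 0 < real_of_rat a \<longrightarrow> real_of_rat a < real_of_rat c \<longrightarrow>
      real_of_rat c < real_of_rat c' \<longrightarrow> real_of_rat c' < real_of_rat d \<longrightarrow> real_of_rat d < 1 \<longrightarrow>
      \<not> equal_minima (e \<omega>) (real_of_rat a) (real_of_rat c) (real_of_rat c') (real_of_rat d)"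
    proof (cases "0 < real_of_rat a \<and> real_of_rat a < real_of_rat c \<and>
      real_of_rat c < real_of_rat c' \<and> real_of_rat c' < real_of_rat d \<and> real_of_rat d < (1 :: real)")
      case True
      then have "AE \<omega> in M. \<not> equal_minima (e \<omega>) (real_of_rat a) (real_of_rat c) (real_of_rat c') (real_of_rat d)"
        by (intro AE_interval_minima_distinct[OF exc]) auto
      then show ?thesis by (rule AE_mp) (intro AE_I2 impI, assumption)
    qed (intro AE_I2 impI, blast)
  qed
  then show ?thesis
  proof (rule AE_mp, intro AE_I2 impI)
    fix \<omega> assume *: "\<forall>a c c' d :: rat. 0 < real_of_rat a \<longrightarrow> real_of_rat a < real_of_rat c \<longrightarrow>
      real_of_rat c < real_of_rat c' \<longrightarrow> real_of_rat c' < real_of_rat d \<longrightarrow> real_of_rat d < 1 \<longrightarrow>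
      \<not> equal_minima (e \<omega>) (real_of_rat a) (real_of_rat c) (real_of_rat c') (real_of_rat d)"
    have ball: "\<exists>\<delta>>0. \<forall>z. \<bar>z - u\<bar> < \<delta> \<longrightarrow> e \<omega> u \<le> e \<omega> z" if "u \<in> local_minima (e \<omega>)" for u
      using that by (auto simp: local_minima_def eventually_nhds_metric dist_real_def)
    have lt: "e \<omega> u \<noteq> e \<omega> v" if u: "u \<in> local_minima (e \<omega>)" and v: "v \<in> local_minima (e \<omega>)" and uv: "u < v" for u v
    proof -
      obtain \<delta>1 \<delta>2 where \<delta>: "\<delta>1 > 0" "\<And>z. \<bar>z - u\<bar> < \<delta>1 \<Longrightarrow> e \<omega> u \<le> e \<omega> z"
        "\<delta>2 > 0" "\<And>z. \<bar>z - v\<bar> < \<delta>2 \<Longrightarrow> e \<omega> v \<le> e \<omega> z"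
        using ball[OF u] ball[OF v] by auto
      have I: "0 < u" "v < 1" using u v by (auto simp: local_minima_def)
      \<comment> \<open>Placing c below and c' above the midpoint keeps the two intervals
        disjoint.\<close>
      define m where "m = (u + v) / 2"
      obtain a where a: "max 0 (u - \<delta>1) < real_of_rat a" "real_of_rat a < u"
        using of_rat_dense[of "max 0 (u - \<delta>1)" u] I \<delta>(1) by auto
      obtain c where c: "u < real_of_rat c" "real_of_rat c < min m (u + \<delta>1)"
        using of_rat_dense[of u "min m (u + \<delta>1)"] uv \<delta>(1) by (auto simp: m_def)
      obtain c' where c': "max m (v - \<delta>2) < real_of_rat c'" "real_of_rat c' < v"
        using of_rat_dense[of "max m (v - \<delta>2)" v] uv \<delta>(3) by (auto simp: m_def)
      obtain d where d: "v < real_of_rat d" "real_of_rat d < min 1 (v + \<delta>2)"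
        using of_rat_dense[of v "min 1 (v + \<delta>2)"] I \<delta>(3) by auto
      have "\<not> equal_minima (e \<omega>) (real_of_rat a) (real_of_rat c) (real_of_rat c') (real_of_rat d)"
        using a c c' d by (intro *[rule_format]) auto
      moreover have "u \<in> {real_of_rat a..real_of_rat c}" "v \<in> {real_of_rat c'..real_of_rat d}"
        using a c c' d by auto
      moreover have "\<forall>z\<in>{real_of_rat a..real_of_rat c}. e \<omega> u \<le> e \<omega> z"
        using a c by (intro ballI \<delta>(2)) (auto simp: abs_less_iff)
      moreover have "\<forall>z\<in>{real_of_rat c'..real_of_rat d}. e \<omega> v \<le> e \<omega> z"
        using c' d by (intro ballI \<delta>(4)) (auto simp: abs_less_iff)
      ultimately show ?thesis unfolding equal_minima_def by blast
    qed
    show "inj_on (e \<omega>) (local_minima (e \<omega>))"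
    proof (rule inj_onI, rule ccontr)
      fix u v assume "u \<in> local_minima (e \<omega>)" "v \<in> local_minima (e \<omega>)" "e \<omega> u = e \<omega> v" "u \<noteq> v"
      then show False using lt[of u v] lt[of v u] by (cases "u < v") auto
    qed
  qed
qed

section \<open>Signs of minima and the order of the permuton\<close>

definition argmins :: "(real \<Rightarrow> real) \<Rightarrow> (nat \<Rightarrow> real) \<Rightarrow> real \<Rightarrow> real \<Rightarrow> nat set" where
  "argmins f b x y = {i. b i \<in> {x..y} \<and> (\<forall>z\<in>{x..y}. f (b i) \<le> f z)}"

lemma Dec_argmins: "x \<le> y \<Longrightarrow> Dec f b s x y = s (THE i. i \<in> argmins f b x y)"
  by (simp add: Dec_def argmins_def)

lemma Dec_commute: "Dec f b s x y = Dec f b s y x"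
  by (simp add: Dec_def min.commute max.commute)

lemma argmins_le: "i \<in> argmins f b x y \<Longrightarrow> x \<le> z \<Longrightarrow> z \<le> y \<Longrightarrow> f (b i) \<le> f z"
  by (simp add: argmins_def)

lemma argmins_unique:
  assumes b: "bij_betw b UNIV (local_minima f)" and inj: "inj_on f (local_minima f)"
    and ij: "i \<in> argmins f b x y" "j \<in> argmins f b x y"
  shows "i = j"
proof -
  have "f (b i) \<le> f (b j)" "f (b j) \<le> f (b i)" using ij unfolding argmins_def by blast+
  then have "f (b i) = f (b j)" by simp
  then have "b i = b j"
    by (rule inj_onD[OF inj]) (use bij_betw_apply[OF b] in auto)
  then show ?thesis using bij_betw_imp_inj_on[OF b] by (simp add: inj_eq)
qed

text \<open>The minimum over [x,y] is attained, but not at a generic end point. It is thus an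
  interior local minimum, hence enumerated by b.\<close>

lemma argmins_generic:
  assumes cont: "continuous_on {0..1} f"
    and b: "bij_betw b UNIV (local_minima f)" and inj: "inj_on f (local_minima f)"
    and xy: "x < y" "x \<in> {0<..<1}" "y \<in> {0<..<1}"
    and gen: "generic_point f x" "generic_point f y"
  obtains i where "argmins f b x y = {i}" "x < b i" "b i < y"
proof -
  have "continuous_on {x..y} f" using cont by (rule continuous_on_subset) (use xy in auto)
  then obtain z where z: "z \<in> {x..y}" "\<And>w. w \<in> {x..y} \<Longrightarrow> f z \<le> f w"
    using continuous_attains_inf[of "{x..y}" f] xy by auto
  have "z \<noteq> x"
  proof
    assume "z = x"
    obtain w where "x < w" "w < x + (y - x)" "f w < f x"
      using gen(1) xy(1) unfolding generic_point_def by (meson diff_gt_0_iff_gt)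
    then show False using z(2)[of w] \<open>z = x\<close> by auto
  qed
  moreover have "z \<noteq> y"
  proof
    assume "z = y"
    obtain w where "y - (y - x) < w" "w < y" "f w < f y"
      using gen(2) xy(1) unfolding generic_point_def by (meson diff_gt_0_iff_gt)
    then show False using z(2)[of w] \<open>z = y\<close> by auto
  qed
  ultimately have zin: "x < z" "z < y" using z(1) by auto
  have "\<forall>\<^sub>F v in nhds z. v \<in> {x<..<y}"
    using zin by (intro eventually_nhds_in_open) auto
  then have "\<forall>\<^sub>F v in nhds z. f z \<le> f v"
    by eventually_elim (use z(2) in auto)
  then have "z \<in> local_minima f" using zin xy by (auto simp: local_minima_def)
  then obtain i where i: "b i = z" using bij_betw_imp_surj_on[OF b] by (metis imageE)
  then have "i \<in> argmins f b x y" using z by (auto simp: argmins_def)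
  then have "argmins f b x y = {i}" using argmins_unique[OF b inj] by blast
  then show ?thesis using that zin i by blast
qed

text \<open>The set whose measure is \<open>psi\<close>. Comparing the sets instead of their
  measures reduces monotonicity of \<open>psi\<close> to an inclusion.\<close>

definition psi_below :: "(real \<Rightarrow> real) \<Rightarrow> (nat \<Rightarrow> real) \<Rightarrow> (nat \<Rightarrow> bool) \<Rightarrow> real \<Rightarrow> real set" where
  "psi_below f b s t = {u \<in> {0..<t}. Dec f b s u t} \<union> {u \<in> {t<..1}. \<not> Dec f b s u t}"

text \<open>
  Where no local minimum realises the minimum, \<open>THE\<close> is applied to the empty predicate, hence
  returns a fixed index.
\<close>

lemma sets_argmins_decision:
  fixes g :: "real \<Rightarrow> nat set"
  assumes uniq: "\<And>u i j. i \<in> g u \<Longrightarrow> j \<in> g u \<Longrightarrow> i = j"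
    and m: "\<And>i. {u \<in> S. i \<in> g u} \<in> sets borel" and S: "S \<in> sets borel"
  shows "{u \<in> S. s (THE i. i \<in> g u)} \<in> sets borel"
proof -
  define E where "E = S - (\<Union>i. {u \<in> S. i \<in> g u})"
  have E: "E \<in> sets borel" unfolding E_def using m S by blast
  have the: "(THE i. i \<in> g u) = i" if "i \<in> g u" for i u
    using that uniq by blast
  have the0: "(THE i. i \<in> g u) = (THE i. False)" if "u \<in> E" for u
  proof -
    have "(\<lambda>i. i \<in> g u) = (\<lambda>i. False)" using that by (auto simp: E_def)
    then show ?thesis by simp
  qed
  have "{u \<in> S. s (THE i. i \<in> g u)} = (\<Union>i\<in>{i. s i}. {u \<in> S. i \<in> g u}) \<union> (if s (THE i. False) then E else {})"
  proof (intro set_eqI iffI)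
    fix u assume u: "u \<in> {u \<in> S. s (THE i. i \<in> g u)}"
    show "u \<in> (\<Union>i\<in>{i. s i}. {u \<in> S. i \<in> g u}) \<union> (if s (THE i. False) then E else {})"
    proof (cases "u \<in> E")
      case True then show ?thesis using u the0[OF True] by auto
    next
      case False
      then obtain i where "i \<in> g u" using u by (auto simp: E_def)
      then show ?thesis using u the by auto
    qed
  next
    fix u assume u: "u \<in> (\<Union>i\<in>{i. s i}. {u \<in> S. i \<in> g u}) \<union> (if s (THE i. False) then E else {})"
    then show "u \<in> {u \<in> S. s (THE i. i \<in> g u)}"
      using the0[of u] the by (auto simp: E_def split: if_splits)
  qed
  also have "\<dots> \<in> sets borel" using m E by auto
  finally show ?thesis .
qed

text \<open>If i minimises over the intervals from two points u to t, it also does for every point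
  between them. The relevant sets of u are therefore intervals.\<close>

lemma sets_psi_below:
  assumes b: "bij_betw b UNIV (local_minima f)" and inj: "inj_on f (local_minima f)"
  shows "{u \<in> {0..<t}. Dec f b s u t} \<in> sets borel" "{u \<in> {t<..1}. \<not> Dec f b s u t} \<in> sets borel"
proof -
  have int: "S \<in> sets borel" if "\<And>x y z. x \<in> S \<Longrightarrow> y \<in> S \<Longrightarrow> x \<le> z \<Longrightarrow> z \<le> y \<Longrightarrow> z \<in> S" for S :: "real set"
  proof -
    have "is_interval S" unfolding is_interval_1 using that by blast
    then show ?thesis by (rule real_interval_borel_measurable)
  qed
  have "{u \<in> {0..<t}. s (THE i. i \<in> argmins f b u t)} \<in> sets borel"
  proof (rule sets_argmins_decision)
    show "i = j" if "i \<in> argmins f b u t" "j \<in> argmins f b u t" for i j u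
      using argmins_unique[OF b inj that] .
    show "{u \<in> {0..<t}. i \<in> argmins f b u t} \<in> sets borel" for i
      by (rule int) (auto simp: argmins_def)
  qed simp
  also have "{u \<in> {0..<t}. s (THE i. i \<in> argmins f b u t)} = {u \<in> {0..<t}. Dec f b s u t}"
    by (auto simp: Dec_argmins)
  finally show "{u \<in> {0..<t}. Dec f b s u t} \<in> sets borel" .
  have "{u \<in> {t<..1}. \<not> s (THE i. i \<in> argmins f b t u)} \<in> sets borel"
  proof (rule sets_argmins_decision[where s = "\<lambda>i. \<not> s i"])
    show "i = j" if "i \<in> argmins f b t u" "j \<in> argmins f b t u" for i j u
      using argmins_unique[OF b inj that] .
    show "{u \<in> {t<..1}. i \<in> argmins f b t u} \<in> sets borel" for i
      by (rule int) (auto simp: argmins_def)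
  qed simp
  also have "{u \<in> {t<..1}. \<not> s (THE i. i \<in> argmins f b t u)} = {u \<in> {t<..1}. \<not> Dec f b s u t}"
    by (auto simp: Dec_argmins Dec_commute[of f b s _ t])
  finally show "{u \<in> {t<..1}. \<not> Dec f b s u t} \<in> sets borel" .
qed

lemma psi_eq_measure:
  assumes b: "bij_betw b UNIV (local_minima f)" and inj: "inj_on f (local_minima f)"
  shows "psi f b s t = measure lborel (psi_below f b s t)"
    "psi_below f b s t \<in> sets borel" "psi_below f b s t \<subseteq> {min 0 t..max 1 t}"
proof -
  note m = sets_psi_below[OF b inj, where s = s and t = t]
  show "psi_below f b s t \<in> sets borel" unfolding psi_below_def using m by (rule sets.Un)
  show "psi_below f b s t \<subseteq> {min 0 t..max 1 t}" by (auto simp: psi_below_def)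
  have fin: "emeasure lborel S \<noteq> \<infinity>" if "S \<subseteq> {min 0 t..max 1 t}" for S :: "real set"
    using emeasure_bounded_finite[of S] bounded_subset[OF bounded_closed_interval that] by auto
  show "psi f b s t = measure lborel (psi_below f b s t)"
    unfolding psi_def psi_below_def
  proof (rule measure_Union[symmetric])
    show "emeasure lborel {u \<in> {0..<t}. Dec f b s u t} \<noteq> \<infinity>" by (rule fin) auto
    show "emeasure lborel {u \<in> {t<..1}. \<not> Dec f b s u t} \<noteq> \<infinity>" by (rule fin) auto
  qed (use m in auto)
qed

text \<open>The order \<open>u \<triangleleft> t \<longleftrightarrow> u \<in> psi_below f b s t\<close> is transitive.\<close>

lemma psi_below_mono:
  assumes b: "bij_betw b UNIV (local_minima f)" and inj: "inj_on f (local_minima f)"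
    and tt': "t < t'" "t' \<le> 1" and j: "j \<in> argmins f b t t'" "\<not> s j"
  shows "psi_below f b s t' \<subseteq> psi_below f b s t"
proof
  fix u assume u: "u \<in> psi_below f b s t'"
  have single: "Dec f b s x y = s i" if "x \<le> y" "i \<in> argmins f b x y" for x y i
  proof -
    have "(THE i. i \<in> argmins f b x y) = i" using argmins_unique[OF b inj] that(2) by blast
    then show ?thesis using Dec_argmins[OF that(1)] by simp
  qed
  have cong: "Dec f b s x y = Dec f b s x' y'" if "x \<le> y" "x' \<le> y'" "argmins f b x y = argmins f b x' y'" for x y x' y'
    using that by (simp add: Dec_argmins)
  have jb: "t \<le> b j" "b j \<le> t'" "\<And>z. t \<le> z \<Longrightarrow> z \<le> t' \<Longrightarrow> f (b j) \<le> f z"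
    using j(1) by (auto simp: argmins_def)
  consider "u < t" | "u = t" | "t < u" "u \<le> b j" "u < t'" | "b j < u" "u < t'" | "u > t'"
    using u tt' by (fastforce simp: psi_below_def)
  then show "u \<in> psi_below f b s t"
  proof cases
    \<comment> \<open>The sign between u and t' is \<oplus>, so j does not minimise over [u,t']. The
      path thus goes below \<open>f (b j)\<close> before t, nothing in [t,t'] competes, and [u,t]
      and [u,t'] have the same minimisers.\<close>
    case 1
    then have D: "Dec f b s u t'" "0 \<le> u" using u tt' by (auto simp: psi_below_def)
    have "j \<notin> argmins f b u t'" using single[of u t' j] D(1) j(2) 1 tt' by auto
    then obtain w where w: "u \<le> w" "w < t" "f w < f (b j)"
      using jb 1 by (auto simp: argmins_def not_le) (meson less_imp_le not_le)
    have "argmins f b u t' = argmins f b u t"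
    proof (intro set_eqI iffI)
      fix i assume i: "i \<in> argmins f b u t'"
      then have "f (b i) < f (b j)" using w tt' argmins_le[OF i, of w] by simp
      then have "\<not> t \<le> b i" using jb(3)[of "b i"] i by (auto simp: argmins_def)
      then show "i \<in> argmins f b u t" using i tt' by (auto simp: argmins_def)
    next
      fix i assume i: "i \<in> argmins f b u t"
      then have "f (b i) < f (b j)" using w argmins_le[OF i, of w] by simp
      then have "f (b i) \<le> f z" if "u \<le> z" "z \<le> t'" for z
        using i that jb(3)[of z] by (cases "z \<le> t") (auto simp: argmins_def)
      then show "i \<in> argmins f b u t'" using i tt' by (auto simp: argmins_def)
    qed
    then have "Dec f b s u t" using D(1) cong[of u t' u t] 1 tt' by auto
    then show ?thesis using 1 D(2) by (auto simp: psi_below_def)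
  next
    case 2
    then have "Dec f b s t t'" using u tt' by (auto simp: psi_below_def)
    then show ?thesis using single[of t t' j] j tt' by auto
  next
    \<comment> \<open>Impossible: b j lies in [u,t'], so j minimises there too and would give u and
      t' the sign \<ominus>.\<close>
    case 3
    then have "j \<in> argmins f b u t'" using jb by (auto simp: argmins_def)
    moreover have "Dec f b s u t'" using u 3 by (auto simp: psi_below_def)
    ultimately show ?thesis using single[of u t' j] j(2) 3 by auto
  next
    \<comment> \<open>Now b j lies in [t,u], so the same \<ominus> separates t from u.\<close>
    case 4
    then have "j \<in> argmins f b t u" using jb by (auto simp: argmins_def)
    then have "\<not> Dec f b s u t" using single[of t u j] j(2) 4 jb(1) by (auto simp: Dec_commute[of f b s u t])
    moreover have "u \<le> 1" using 4 tt' by simp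
    ultimately show ?thesis using 4 jb(1) by (auto simp: psi_below_def)
  next
    \<comment> \<open>The mirror image of the first case, except that j may minimise over [t,u]; its
      sign \<ominus> is then the one that is wanted.\<close>
    case 5
    then have D: "\<not> Dec f b s t' u" "u \<le> 1" using u by (auto simp: psi_below_def Dec_commute[of f b s u t'])
    have "\<not> Dec f b s t u"
    proof (cases "j \<in> argmins f b t u")
      case True
      then show ?thesis using single[of t u j] j(2) 5 tt' by auto
    next
      case False
      then obtain w where w: "t' < w" "w \<le> u" "f w < f (b j)"
        using jb 5 by (auto simp: argmins_def not_le) (meson less_imp_le not_le)
      have "argmins f b t u = argmins f b t' u"
      proof (intro set_eqI iffI)
        fix i assume i: "i \<in> argmins f b t u"
        then have "f (b i) < f (b j)" using w tt' argmins_le[OF i, of w] by simp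
        then have "\<not> b i \<le> t'" using jb(3)[of "b i"] i by (auto simp: argmins_def)
        then show "i \<in> argmins f b t' u" using i tt' by (auto simp: argmins_def)
      next
        fix i assume i: "i \<in> argmins f b t' u"
        then have "f (b i) < f (b j)" using w argmins_le[OF i, of w] by simp
        then have "f (b i) \<le> f z" if "t \<le> z" "z \<le> u" for z
          using i that jb(3)[of z] by (cases "t' \<le> z") (auto simp: argmins_def)
        then show "i \<in> argmins f b t u" using i tt' by (auto simp: argmins_def)
      qed
      then show ?thesis using D(1) cong[of t u t' u] 5 tt' by auto
    qed
    then show ?thesis using 5 D(2) tt' by (auto simp: psi_below_def Dec_commute[of f b s u t])
  qed
qed

lemma psi_mono:
  assumes b: "bij_betw b UNIV (local_minima f)" and inj: "inj_on f (local_minima f)"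
    and tt': "t < t'" "t' \<le> 1" and j: "j \<in> argmins f b t t'" "\<not> s j"
  shows "psi f b s t' \<le> psi f b s t"
  unfolding psi_eq_measure(1)[OF b inj]
proof (rule measure_mono_fmeasurable[OF psi_below_mono[where s = s, OF assms]])
  have "emeasure lborel (psi_below f b s t) < \<infinity>"
    using emeasure_bounded_finite[OF bounded_subset[OF bounded_closed_interval psi_eq_measure(3)[OF b inj]]] by simp
  then show "psi_below f b s t \<in> fmeasurable lborel"
    using psi_eq_measure(2)[OF b inj] by (simp add: fmeasurable_def)
qed (use psi_eq_measure(2)[OF b inj] in auto)

text \<open>Valid for arbitrary f, b and s: sets that are not measurable get \<open>measure\<close>
  0, so the bounds by lengths of intervals persist.\<close>

lemma psi_in_unit: "0 \<le> t \<Longrightarrow> t \<le> 1 \<Longrightarrow> psi f b s t \<in> {0..1}"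
proof -
  assume t: "0 \<le> t" "t \<le> 1"
  have le: "measure lborel A \<le> y - x" if "A \<subseteq> {x..y}" "x \<le> y" for A :: "real set" and x y
  proof (cases "A \<in> sets lborel")
    case True
    have "measure lborel A \<le> measure lborel {x..y}"
      using that True by (intro measure_mono_fmeasurable) (auto simp: fmeasurable_def)
    then show ?thesis using that by simp
  next
    case False
    then show ?thesis using that by (simp add: measure_notin_sets)
  qed
  have "measure lborel {u \<in> {0..<t}. Dec f b s u t} \<le> t - 0"
    using t by (intro le) auto
  moreover have "measure lborel {u \<in> {t<..1}. \<not> Dec f b s u t} \<le> 1 - t"
    using t by (intro le) auto
  ultimately show ?thesis by (simp add: psi_def)
qed

section \<open>Almost sure absence of chains\<close>

lemma continuous_on_less_near:
  fixes f :: "real \<Rightarrow> real"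
  assumes "continuous_on {0..1} f" "y \<in> {0..1}" "f y < c"
  obtains \<epsilon> where "\<epsilon> > 0" "\<And>z. z \<in> {0..1} \<Longrightarrow> \<bar>z - y\<bar> < \<epsilon> \<Longrightarrow> f z < c"
proof -
  obtain \<epsilon> where \<epsilon>: "\<epsilon> > 0" "\<forall>z\<in>{0..1}. dist z y < \<epsilon> \<longrightarrow> dist (f z) (f y) < c - f y"
    using assms unfolding continuous_on_iff by (metis diff_gt_0_iff_gt)
  have "f z < c" if "z \<in> {0..1}" "\<bar>z - y\<bar> < \<epsilon>" for z
  proof -
    have "dist (f z) (f y) < c - f y" using \<epsilon>(2) that by (simp add: dist_real_def)
    then show ?thesis by (simp add: dist_real_def)
  qed
  then show ?thesis using that \<epsilon>(1) by blast
qed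

text \<open>A strict inequality of a continuous function persists at nearby rationals. The countable
  form makes genericity jointly measurable in \<omega> and t.\<close>

lemma generic_point_iff:
  assumes cont: "continuous_on {0..1} f" and t: "0 < t" "t < 1"
  shows "generic_point f t \<longleftrightarrow>
    (\<forall>n. (\<exists>q::rat. t < of_rat q \<and> of_rat q < t + 1 / real (Suc n) \<and> of_rat q \<le> (1 :: real) \<and> f (of_rat q) < f t) \<and>
         (\<exists>q::rat. t - 1 / real (Suc n) < of_rat q \<and> of_rat q < t \<and> (0 :: real) \<le> of_rat q \<and> f (of_rat q) < f t))"
    (is "_ \<longleftrightarrow> ?R")
proof
  assume gen: "generic_point f t"
  show ?R
  proof (intro allI conjI)
    fix n
    have d: "1 / real (Suc n) > 0" by simp
    obtain y where y: "t < y" "y < t + 1 / real (Suc n)" "y \<le> 1" "f y < f t"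
      using gen d unfolding generic_point_def by blast
    obtain \<epsilon> where \<epsilon>: "\<epsilon> > 0" "\<And>z. z \<in> {0..1} \<Longrightarrow> \<bar>z - y\<bar> < \<epsilon> \<Longrightarrow> f z < f t"
      using continuous_on_less_near[OF cont _ y(4)] y t by auto
    obtain q :: rat where q: "max t (y - \<epsilon>) < of_rat q" "of_rat q < y"
      using of_rat_dense[of "max t (y - \<epsilon>)" y] y(1) \<epsilon>(1) by auto
    have "of_rat q \<in> {0..1::real}" unfolding atLeastAtMost_iff using q y t by linarith
    moreover have "\<bar>of_rat q - y\<bar> < \<epsilon>" using q by linarith
    ultimately have "f (of_rat q) < f t" by (rule \<epsilon>(2))
    then show "\<exists>q::rat. t < of_rat q \<and> of_rat q < t + 1 / real (Suc n) \<and> of_rat q \<le> (1 :: real) \<and> f (of_rat q) < f t"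
      using q y by (intro exI[of _ q] conjI) (assumption | linarith)+
    obtain y where y: "t - 1 / real (Suc n) < y" "y < t" "0 \<le> y" "f y < f t"
      using gen d unfolding generic_point_def by blast
    obtain \<epsilon> where \<epsilon>: "\<epsilon> > 0" "\<And>z. z \<in> {0..1} \<Longrightarrow> \<bar>z - y\<bar> < \<epsilon> \<Longrightarrow> f z < f t"
      using continuous_on_less_near[OF cont _ y(4)] y t by auto
    obtain q :: rat where q: "y < of_rat q" "of_rat q < min t (y + \<epsilon>)"
      using of_rat_dense[of y "min t (y + \<epsilon>)"] y(2) \<epsilon>(1) by auto
    have "of_rat q \<in> {0..1::real}" unfolding atLeastAtMost_iff using q y t by linarith
    moreover have "\<bar>of_rat q - y\<bar> < \<epsilon>" using q by linarith
    ultimately have "f (of_rat q) < f t" by (rule \<epsilon>(2))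
    then show "\<exists>q::rat. t - 1 / real (Suc n) < of_rat q \<and> of_rat q < t \<and> (0 :: real) \<le> of_rat q \<and> f (of_rat q) < f t"
      using q y by (intro exI[of _ q] conjI) (assumption | linarith)+
  qed
next
  assume R: ?R
  show "generic_point f t"
    unfolding generic_point_def
  proof (intro conjI allI impI)
    fix \<delta> :: real assume "\<delta> > 0"
    then obtain n where n: "inverse (real (Suc n)) < \<delta>" using reals_Archimedean by blast
    obtain q :: rat where "t < of_rat q" "of_rat q < t + 1 / real (Suc n)" "of_rat q \<le> (1 :: real)" "f (of_rat q) < f t"
      using R by blast
    then show "\<exists>y>t. y < t + \<delta> \<and> y \<le> 1 \<and> f y < f t"
      using n by (intro exI[of _ "of_rat q"]) (auto simp: inverse_eq_divide)
    obtain q :: rat where "t - 1 / real (Suc n) < of_rat q" "of_rat q < t" "(0 :: real) \<le> of_rat q" "f (of_rat q) < f t"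
      using R by blast
    then show "\<exists>y>t - \<delta>. y < t \<and> 0 \<le> y \<and> f y < f t"
      using n by (intro exI[of _ "of_rat q"]) (auto simp: inverse_eq_divide)
  qed
qed

text \<open>Fubini exchanges the quantifiers: the estimate along a progression fixes the times first
  and then asks for genericity with probability 1.\<close>

lemma AE_generic_point_swap:
  assumes exc: "brownian_excursion M e"
  shows "AE t in lborel. AE \<omega> in M. t \<in> {0<..<1} \<longrightarrow> generic_point (e \<omega>) t"
proof -
  interpret prob_space M using brownian_excursionD(1)[OF exc] .
  interpret P: pair_sigma_finite M "lborel :: real measure"
    by (intro pair_sigma_finite.intro sigma_finite_measure_axioms lborel.sigma_finite_measure_axioms)
  define c where "c t = max 0 (min 1 t)" for t :: real
  define R where "R x \<longleftrightarrow> (0 < snd x \<and> snd x < 1 \<longrightarrow> (\<forall>n.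
    (\<exists>q::rat. snd x < of_rat q \<and> of_rat q < snd x + 1 / real (Suc n) \<and> of_rat q \<le> (1 :: real) \<and> e (fst x) (c (of_rat q)) < e (fst x) (c (snd x))) \<and>
    (\<exists>q::rat. snd x - 1 / real (Suc n) < of_rat q \<and> of_rat q < snd x \<and> (0 :: real) \<le> of_rat q \<and> e (fst x) (c (of_rat q)) < e (fst x) (c (snd x)))))" for x
  have [measurable]: "(\<lambda>x. e (fst x) (c (snd x))) \<in> borel_measurable (M \<Otimes>\<^sub>M borel)"
    "\<And>r. (\<lambda>x. e (fst x) (c r)) \<in> borel_measurable (M \<Otimes>\<^sub>M borel)"
    unfolding c_def by (intro measurable_path_compose[OF brownian_excursionD(2,3)[OF exc]]; measurable)+
  have "{x \<in> space (M \<Otimes>\<^sub>M borel). R x} \<in> sets (M \<Otimes>\<^sub>M borel)"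
    unfolding R_def by measurable
  also have "{x \<in> space (M \<Otimes>\<^sub>M borel). R x} = {x \<in> space (M \<Otimes>\<^sub>M lborel). snd x \<in> {0<..<1} \<longrightarrow> generic_point (e (fst x)) (snd x)}"
  proof (intro set_eqI iffI; clarsimp simp: space_pair_measure)
    fix \<omega> t assume "\<omega> \<in> space M" "R (\<omega>, t)" "0 < t" "t < 1"
    moreover have "c (of_rat q) = of_rat q" if "(0 :: real) \<le> of_rat q" "of_rat q \<le> (1 :: real)" for q
      using that by (simp add: c_def)
    ultimately show "generic_point (e \<omega>) t"
      unfolding generic_point_iff[OF brownian_excursionD(3)[OF exc \<open>\<omega> \<in> space M\<close>] \<open>0 < t\<close> \<open>t < 1\<close>]
      unfolding R_def by (smt (verit) c_def fst_conv snd_conv)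
  next
    fix \<omega> t assume \<omega>: "\<omega> \<in> space M" and gen: "0 < t \<and> t < 1 \<longrightarrow> generic_point (e \<omega>) t"
    show "R (\<omega>, t)"
    proof (cases "0 < t \<and> t < 1")
      case True
      then have "generic_point (e \<omega>) t" using gen by blast
      then show ?thesis
        using True unfolding generic_point_iff[OF brownian_excursionD(3)[OF exc \<omega>] conjunct1[OF True] conjunct2[OF True]]
        unfolding R_def by (smt (verit) c_def fst_conv snd_conv)
    qed (auto simp: R_def)
  qed
  also have "sets (M \<Otimes>\<^sub>M borel) = sets (M \<Otimes>\<^sub>M (lborel :: real measure))"
    by (intro sets_pair_measure_cong) auto
  finally show ?thesis
    using AE_generic_point[OF exc] by (subst P.AE_commute[symmetric]) auto
qed

lemma AE_lborel_translate:
  fixes c :: real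
  assumes "AE t in lborel. Q t"
  shows "AE t in lborel. Q (t + c)"
proof -
  obtain N where N: "{t \<in> space lborel. \<not> Q t} \<subseteq> N" "N \<in> null_sets lborel"
    using assms unfolding eventually_ae_filter by blast
  then have Nb: "N \<in> sets borel" "emeasure lborel N = 0" by (auto simp: null_sets_def)
  have "{t. t + c \<in> N} \<in> sets borel"
  proof -
    have "(\<lambda>t. t + c) \<in> borel_measurable borel" by measurable
    from measurable_sets[OF this Nb(1)] show ?thesis by (simp add: vimage_def)
  qed
  then have "{t. t + c \<in> N} \<in> null_sets lborel"
    using emeasure_lborel_translate[OF Nb(1), of c] Nb(2) by (simp add: null_sets_def)
  then show ?thesis by (rule AE_I') (use N(1) in auto)
qed

text \<open>By continuity it suffices to test a dense set. The test points are the rational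
  divisions of [x,y] itself, so that they depend measurably on moving end points.\<close>

lemma argmins_iff_rational:
  assumes cont: "continuous_on {0..1} f" and xy: "0 \<le> x" "x \<le> y" "y \<le> 1"
  shows "l \<in> argmins f b x y \<longleftrightarrow> x \<le> b l \<and> b l \<le> y \<and>
     (\<forall>n. \<forall>i\<in>{..Suc n}. f (b l) \<le> f (x + real i / real (Suc n) * (y - x)))"
proof (intro iffI conjI)
  assume l: "l \<in> argmins f b x y"
  then show "x \<le> b l" "b l \<le> y" by (auto simp: argmins_def)
  show "\<forall>n. \<forall>i\<in>{..Suc n}. f (b l) \<le> f (x + real i / real (Suc n) * (y - x))"
  proof (intro allI ballI argmins_le[OF l])
    fix n i assume "i \<in> {..Suc n}"
    then have "real i / real (Suc n) * (y - x) \<le> 1 * (y - x)"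
      using xy by (intro mult_right_mono) auto
    then show "x + real i / real (Suc n) * (y - x) \<le> y" by simp
    show "x \<le> x + real i / real (Suc n) * (y - x)" using xy by simp
  qed
next
  assume R: "x \<le> b l \<and> b l \<le> y \<and> (\<forall>n. \<forall>i\<in>{..Suc n}. f (b l) \<le> f (x + real i / real (Suc n) * (y - x)))"
  have "f (b l) \<le> f z" if z: "z \<in> {x..y}" for z
  proof (cases "x = y")
    case True
    then have "z = x" using z by simp
    moreover have "f (b l) \<le> f (x + real 0 / real (Suc 0) * (y - x))" using R by blast
    ultimately show ?thesis by simp
  next
    case False
    then have xy': "x < y" using xy by simp
    define r where "r = (z - x) / (y - x)"
    have r: "0 \<le> r" "r \<le> 1" "z = x + r * (y - x)" using z xy' by (auto simp: r_def field_simps)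
    define u where "u n = real_of_int \<lfloor>real (Suc n) * r\<rfloor> / real (Suc n)" for n
    have ui: "\<exists>i\<in>{..Suc n}. u n = real i / real (Suc n)" for n
    proof -
      have "real (Suc n) * r \<le> real (Suc n)" using r(2) by (simp add: mult_left_le)
      then have "\<lfloor>real (Suc n) * r\<rfloor> \<le> int (Suc n)" by linarith
      moreover have "0 \<le> \<lfloor>real (Suc n) * r\<rfloor>" using r(1) by simp
      ultimately show ?thesis unfolding u_def
        by (intro bexI[of _ "nat \<lfloor>real (Suc n) * r\<rfloor>"]) auto
    qed
    have lim: "(\<lambda>n. x + u n * (y - x)) \<longlonglongrightarrow> x + r * (y - x)"
      unfolding u_def by (intro tendsto_intros floor_quotient_tendsto)
    have in01: "x + u n * (y - x) \<in> {0..1}" for n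
    proof -
      obtain i where i: "i \<in> {..Suc n}" "u n = real i / real (Suc n)" using ui by blast
      then have "0 \<le> u n" "u n \<le> 1" by auto
      then have "u n * (y - x) \<le> 1 * (y - x)" using xy by (intro mult_right_mono) auto
      moreover have "0 \<le> u n * (y - x)" using xy \<open>0 \<le> u n\<close> by simp
      ultimately have "0 \<le> u n * (y - x)" "u n * (y - x) \<le> y - x" by simp_all
      then show ?thesis using xy by simp
    qed
    have "(\<lambda>n. f (x + u n * (y - x))) \<longlonglongrightarrow> f (x + r * (y - x))"
      by (rule continuous_on_tendsto_compose[OF cont lim]) (use r(3) z xy in01 in auto)
    then have "f (b l) \<le> f (x + r * (y - x))"
    proof (rule LIMSEQ_le_const, intro exI[of _ 0] allI impI)
      fix n
      obtain i where i: "i \<in> {..Suc n}" "u n = real i / real (Suc n)" using ui by blast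
      then show "f (b l) \<le> f (x + u n * (y - x))" using R by simp
    qed
    then show ?thesis using r(3) by simp
  qed
  then show "l \<in> argmins f b x y" using R by (auto simp: argmins_def)
qed

text \<open>The map g and the random end points X, Y allow two uses: on the product with the time
  axis, with g the first projection, and on the path algebra with fixed times.\<close>

lemma sets_argmins:
  fixes e :: "'a \<Rightarrow> real \<Rightarrow> real" and b :: "nat \<Rightarrow> 'a \<Rightarrow> real"
  assumes e: "\<And>t. t \<in> {0..1} \<Longrightarrow> (\<lambda>\<omega>. e \<omega> t) \<in> borel_measurable N"
    and cont: "\<And>\<omega>. \<omega> \<in> space N \<Longrightarrow> continuous_on {0..1} (e \<omega>)"
    and b: "\<And>l. b l \<in> borel_measurable N"
    and g: "g \<in> L \<rightarrow>\<^sub>M N" and X [measurable]: "X \<in> borel_measurable L" and Y [measurable]: "Y \<in> borel_measurable L"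
  shows "{w \<in> space L. 0 \<le> X w \<and> X w \<le> Y w \<and> Y w \<le> 1 \<and> l \<in> argmins (e (g w)) (\<lambda>i. b i (g w)) (X w) (Y w)} \<in> sets L"
proof -
  define c where "c t = max 0 (min 1 t)" for t :: real
  have bg [measurable]: "(\<lambda>w. b l (g w)) \<in> borel_measurable L" by (rule measurable_compose[OF g b])
  have [measurable]: "(\<lambda>w. e (g w) (c (b l (g w)))) \<in> borel_measurable L"
    "(\<lambda>w. e (g w) (c (X w + real i / real (Suc n) * (Y w - X w)))) \<in> borel_measurable L" for i n
    unfolding c_def by (intro measurable_path_compose[OF e cont g]; measurable)+
  define Z where "Z = {w \<in> space L. 0 \<le> X w \<and> X w \<le> Y w \<and> Y w \<le> 1 \<and> X w \<le> b l (g w) \<and> b l (g w) \<le> Y w \<and>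
      (\<forall>n. \<forall>i\<in>{..Suc n}. e (g w) (c (b l (g w))) \<le> e (g w) (c (X w + real i / real (Suc n) * (Y w - X w))))}"
  have "Z \<in> sets L" unfolding Z_def by measurable
  also have "Z = {w \<in> space L. 0 \<le> X w \<and> X w \<le> Y w \<and> Y w \<le> 1 \<and> l \<in> argmins (e (g w)) (\<lambda>i. b i (g w)) (X w) (Y w)}"
    unfolding Z_def
  proof (intro Collect_cong conj_cong refl)
    fix w assume w: "w \<in> space L" and xy: "0 \<le> X w" "X w \<le> Y w" "Y w \<le> 1"
    have ct: "c t = t" if "X w \<le> t" "t \<le> Y w" for t using that xy by (simp add: c_def)
    have ci: "c (X w + real i / real (Suc n) * (Y w - X w)) = X w + real i / real (Suc n) * (Y w - X w)" if "i \<in> {..Suc n}" for i n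
    proof (rule ct)
      have "real i / real (Suc n) * (Y w - X w) \<le> 1 * (Y w - X w)"
        using xy that by (intro mult_right_mono) auto
      then show "X w + real i / real (Suc n) * (Y w - X w) \<le> Y w" by simp
      show "X w \<le> X w + real i / real (Suc n) * (Y w - X w)" using xy by simp
    qed
    have gw: "g w \<in> space N" using measurable_space[OF g w] .
    have "X w \<le> b l (g w) \<and> b l (g w) \<le> Y w \<and>
      (\<forall>n. \<forall>i\<in>{..Suc n}. e (g w) (c (b l (g w))) \<le> e (g w) (c (X w + real i / real (Suc n) * (Y w - X w)))) \<longleftrightarrow>
      X w \<le> b l (g w) \<and> b l (g w) \<le> Y w \<and>
      (\<forall>n. \<forall>i\<in>{..Suc n}. e (g w) (b l (g w)) \<le> e (g w) (X w + real i / real (Suc n) * (Y w - X w)))"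
      by (intro conj_cong refl all_cong1 ball_cong) (simp only: ct ci)
    also have "\<dots> \<longleftrightarrow> l \<in> argmins (e (g w)) (\<lambda>i. b i (g w)) (X w) (Y w)"
      by (rule argmins_iff_rational[OF cont[OF gw] xy, symmetric])
    finally show "(X w \<le> b l (g w) \<and> b l (g w) \<le> Y w \<and>
      (\<forall>n. \<forall>i\<in>{..Suc n}. e (g w) (c (b l (g w))) \<le> e (g w) (c (X w + real i / real (Suc n) * (Y w - X w))))) =
      (l \<in> argmins (e (g w)) (\<lambda>i. b i (g w)) (X w) (Y w))" .
  qed
  finally show ?thesis .
qed

text \<open>Split according to the tuple j of minimising indices. The event H j that the tuple is j
  belongs to F, and k signs at distinct fixed indices are all \<oplus> with probability p ^ k,
  independently of F. The events H j are disjoint, so summing over the countably many tuples gives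
  at most p ^ k.\<close>

lemma (in prob_space) sign_tuple_bound:
  fixes Am :: "nat \<Rightarrow> 'a \<Rightarrow> nat set"
  assumes F: "space F = space M"
    and indF: "indep_set (sets F) (sets (sign_algebra M s))"
    and inds: "indep_vars (\<lambda>_. count_space UNIV) s UNIV"
    and dist: "\<And>i. distr M (count_space UNIV) (s i) = measure_pmf (bernoulli_pmf p)"
    and p: "0 \<le> p" "p \<le> 1"
    and Am: "\<And>i l. i < k \<Longrightarrow> {\<omega> \<in> space M. l \<in> Am i \<omega>} \<in> sets F"
    and AE: "AE \<omega> in M. \<exists>j. inj_on j {..<k} \<and> (\<forall>i<k. Am i \<omega> = {j i})"
  shows "emeasure M {\<omega> \<in> space M. \<forall>i<k. \<exists>l\<in>Am i \<omega>. s l \<omega>} \<le> ennreal (p ^ k)"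
proof -
  let ?q = "ennreal (p ^ k)"
  let ?E = "{\<omega> \<in> space M. \<forall>i<k. \<exists>l\<in>Am i \<omega>. s l \<omega>}"
  define Js where "Js = {j \<in> {..<k} \<rightarrow>\<^sub>E (UNIV :: nat set). inj_on j {..<k}}"
  have "countable ({..<k} \<rightarrow>\<^sub>E (UNIV :: nat set))" by (rule countable_PiE) auto
  then have Jsc: "countable Js" by (rule countable_subset[rotated]) (auto simp: Js_def)
  define H where "H j = {\<omega> \<in> space M. \<forall>i\<in>{..<k}. \<forall>l. l \<in> Am i \<omega> \<longleftrightarrow> l = j i}" for j
  define T where "T j = {\<omega> \<in> space M. \<forall>i<k. s (j i) \<omega>}" for j
  have FM: "sets F \<subseteq> sets M" "sets (sign_algebra M s) \<subseteq> sets M"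
    using indF by (rule indep_setD_ev1, rule indep_setD_ev2)
  have HF: "H j \<in> sets F" for j
  proof -
    have "{\<omega> \<in> space F. l \<in> Am i \<omega> \<longleftrightarrow> l = j i} \<in> sets F" if "i \<in> {..<k}" for i l
    proof -
      have *: "{\<omega> \<in> space F. l \<in> Am i \<omega>} \<in> sets F" using Am[of i l] that F by simp
      show ?thesis
      proof (cases "l = j i")
        case True then show ?thesis using * by simp
      next
        case False then show ?thesis using sets.sets_Collect_neg[OF *] by simp
      qed
    qed
    then have "{\<omega> \<in> space F. \<forall>i\<in>{..<k}. \<forall>l. l \<in> Am i \<omega> \<longleftrightarrow> l = j i} \<in> sets F"
      by (intro sets.sets_Collect_finite_All sets.sets_Collect_countable_All) auto
    then show ?thesis by (simp add: H_def F)
  qed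
  have TS: "T j \<in> sets (sign_algebra M s)" for j
  proof -
    have "{x \<in> space (Pi\<^sub>M UNIV (\<lambda>_. count_space (UNIV :: bool set))). \<forall>i\<in>{..<k}. x (j i)} \<in> sets (Pi\<^sub>M UNIV (\<lambda>_::nat. count_space UNIV))"
      by measurable
    from in_vimage_algebra[OF this, of "\<lambda>\<omega> i. s i \<omega>" "space M"]
    have "(\<lambda>\<omega> i. s i \<omega>) -` {x \<in> space (Pi\<^sub>M UNIV (\<lambda>_. count_space (UNIV :: bool set))). \<forall>i\<in>{..<k}. x (j i)} \<inter> space M \<in> sets (sign_algebra M s)"
      unfolding sign_algebra_def .
    also have "(\<lambda>\<omega> i. s i \<omega>) -` {x \<in> space (Pi\<^sub>M UNIV (\<lambda>_. count_space (UNIV :: bool set))). \<forall>i\<in>{..<k}. x (j i)} \<inter> space M = T j"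
      by (auto simp: T_def space_PiM)
    finally show ?thesis .
  qed
  have sm: "s i \<in> M \<rightarrow>\<^sub>M count_space UNIV" for i
    using inds by (auto simp: indep_vars_def)
  have ps: "prob (s i -` {True} \<inter> space M) = p" for i
  proof -
    have "prob (s i -` {True} \<inter> space M) = measure (distr M (count_space UNIV) (s i)) {True}"
      by (rule measure_distr[OF sm, symmetric]) simp
    also have "\<dots> = p" unfolding dist using p by (simp add: measure_pmf_single)
    finally show ?thesis .
  qed
  have Tp: "emeasure M (T j) = ?q" if "inj_on j {..<k}" for j
  proof (cases "k = 0")
    case True
    then show ?thesis by (simp add: T_def emeasure_space_1)
  next
    case False
    have "prob (\<Inter>i\<in>j ` {..<k}. s i -` {True} \<inter> space M) = (\<Prod>i\<in>j ` {..<k}. prob (s i -` {True} \<inter> space M))"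
      using False by (intro indep_varsD[OF inds]) auto
    also have "(\<Inter>i\<in>j ` {..<k}. s i -` {True} \<inter> space M) = T j"
      using False by (auto simp: T_def)
    also have "(\<Prod>i\<in>j ` {..<k}. prob (s i -` {True} \<inter> space M)) = p ^ k"
      unfolding ps using that by (simp add: card_image)
    finally show ?thesis by (simp add: emeasure_eq_measure)
  qed
  have HT: "emeasure M (H j \<inter> T j) = emeasure M (H j) * ?q" if "j \<in> Js" for j
  proof -
    have "emeasure M (H j \<inter> T j) = emeasure M (H j) * emeasure M (T j)"
      using indep_setD[OF indF HF TS, of j j] by (simp add: emeasure_eq_measure ennreal_mult)
    also have "emeasure M (T j) = ?q" using that by (intro Tp) (auto simp: Js_def)
    finally show ?thesis .
  qed
  have disj: "disjoint_family_on H Js"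
    unfolding disjoint_family_on_def
  proof (intro ballI impI)
    fix j j' assume j: "j \<in> Js" "j' \<in> Js" "j \<noteq> j'"
    have "j = j'" if "\<omega> \<in> H j" "\<omega> \<in> H j'" for \<omega>
    proof (rule PiE_ext)
      show "j \<in> {..<k} \<rightarrow>\<^sub>E UNIV" "j' \<in> {..<k} \<rightarrow>\<^sub>E UNIV" using j by (auto simp: Js_def)
      show "j i = j' i" if "i \<in> {..<k}" for i
        using \<open>\<omega> \<in> H j\<close> \<open>\<omega> \<in> H j'\<close> that unfolding H_def by blast
    qed
    then show "H j \<inter> H j' = {}" using j by blast
  qed
  have HM: "H j \<in> sets M" "T j \<in> sets M" for j using HF TS FM by auto
  have "emeasure M ?E \<le> emeasure M (\<Union>j\<in>Js. H j \<inter> T j)"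
  proof (rule emeasure_mono_AE)
    show "(\<Union>j\<in>Js. H j \<inter> T j) \<in> sets M"
      using HM by (intro sets.countable_UN'' Jsc sets.Int) auto
    show "AE \<omega> in M. \<omega> \<in> ?E \<longrightarrow> \<omega> \<in> (\<Union>j\<in>Js. H j \<inter> T j)"
      using AE
    proof eventually_elim
      case (elim \<omega>)
      then obtain j where j: "inj_on j {..<k}" "\<And>i. i < k \<Longrightarrow> Am i \<omega> = {j i}" by blast
      have "restrict j {..<k} \<in> Js" using j(1) by (auto simp: Js_def inj_on_def)
      moreover have "\<omega> \<in> H (restrict j {..<k}) \<inter> T (restrict j {..<k})"
        if "\<omega> \<in> space M" "\<forall>i<k. \<exists>l\<in>Am i \<omega>. s l \<omega>"
        using that j(2) by (auto simp: H_def T_def)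
      ultimately show ?case by blast
    qed
  qed
  also have "\<dots> = (\<integral>\<^sup>+j. emeasure M (H j \<inter> T j) \<partial>count_space Js)"
    using disj HM by (intro emeasure_UN_countable Jsc) (auto simp: disjoint_family_on_def)
  also have "\<dots> = (\<integral>\<^sup>+j. emeasure M (H j) * ?q \<partial>count_space Js)"
    by (intro nn_integral_cong) (simp add: HT)
  also have "\<dots> = (\<integral>\<^sup>+j. emeasure M (H j) \<partial>count_space Js) * ?q"
    by (intro nn_integral_multc) auto
  also have "(\<integral>\<^sup>+j. emeasure M (H j) \<partial>count_space Js) = emeasure M (\<Union>j\<in>Js. H j)"
    using disj HM by (intro emeasure_UN_countable[symmetric] Jsc) auto
  also have "emeasure M (\<Union>j\<in>Js. H j) * ?q \<le> 1 * ?q"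
    by (intro mult_right_mono emeasure_le_1) simp
  finally show ?thesis by simp
qed

text \<open>If f were not measurable, some set and its complement would both have preimages outside
  L, to which \<open>emeasure\<close> assigns 0. The image measure would then have total mass 0, not
  1; if the set function is not a measure at all, \<open>distr\<close> is the zero measure. In this
  way measurability of t \<mapsto> (t, \<psi> t) follows from its image being a permuton.\<close>

lemma measurable_of_prob_space_distr:
  assumes L: "prob_space L" and f: "f \<in> space L \<rightarrow> space N" and d: "prob_space (distr L N f)"
  shows "f \<in> L \<rightarrow>\<^sub>M N"
proof (rule measurableI)
  show "f x \<in> space N" if "x \<in> space L" for x using f that by blast
  fix B assume B: "B \<in> sets N"
  define \<nu> where "\<nu> A = emeasure L (f -` A \<inter> space L)" for A
  have ms: "measure_space (space N) (sets N) \<nu>"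
  proof (rule ccontr)
    assume "\<not> measure_space (space N) (sets N) \<nu>"
    then have "emeasure (distr L N f) A = 0" for A
      unfolding distr_def \<nu>_def[symmetric]
      by (simp add: emeasure_measure_of_conv sets.sigma_sets_eq)
    then show False using prob_space.emeasure_space_1[OF d] by simp
  qed
  have e: "emeasure (distr L N f) A = \<nu> A" if "A \<in> sets N" for A
    unfolding distr_def \<nu>_def[symmetric]
    using ms that by (simp add: emeasure_measure_of_conv sets.sigma_sets_eq)
  have "\<nu> B + \<nu> (space N - B) = emeasure (distr L N f) (B \<union> (space N - B))"
    using B by (subst plus_emeasure[symmetric]) (auto simp: e)
  also have "B \<union> (space N - B) = space (distr L N f)" using sets.sets_into_space[OF B] by auto
  finally have one: "\<nu> B + \<nu> (space N - B) = 1" using prob_space.emeasure_space_1[OF d] by simp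
  have co: "f -` (space N - B) \<inter> space L = space L - (f -` B \<inter> space L)" using f by auto
  show "f -` B \<inter> space L \<in> sets L"
  proof (rule ccontr)
    assume n: "f -` B \<inter> space L \<notin> sets L"
    have "space L - (f -` B \<inter> space L) \<notin> sets L"
    proof
      assume "space L - (f -` B \<inter> space L) \<in> sets L"
      then have "space L - (space L - (f -` B \<inter> space L)) \<in> sets L" by (rule sets.compl_sets)
      moreover have "space L - (space L - (f -` B \<inter> space L)) = f -` B \<inter> space L" by auto
      ultimately show False using n by simp
    qed
    then have "\<nu> B = 0" "\<nu> (space N - B) = 0" unfolding \<nu>_def co using n by (simp_all add: emeasure_notin_sets)
    then show False using one by simp
  qed
qed

text \<open>\<open>AE_no_chain\<close> with q = p and B = 1. The relation asks for some minimising
  index with sign \<oplus>, instead of \<open>Dec\<close>, so that it is a countable union of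
  measurable events with no arbitrary default.\<close>

lemma AE_no_sign_chain:
  fixes e :: "'a \<Rightarrow> real \<Rightarrow> real" and b :: "nat \<Rightarrow> 'a \<Rightarrow> real" and s :: "nat \<Rightarrow> 'a \<Rightarrow> bool"
  assumes exc: "brownian_excursion M e"
    and b: "\<And>i. b i \<in> borel_measurable (path_algebra M e)"
    and bij: "AE \<omega> in M. bij_betw (\<lambda>i. b i \<omega>) UNIV (local_minima (e \<omega>))"
    and inds: "prob_space.indep_vars M (\<lambda>_. count_space UNIV) s UNIV"
    and dist: "\<And>i. distr M (count_space UNIV) (s i) = measure_pmf (bernoulli_pmf p)"
    and indF: "prob_space.indep_set M (sets (path_algebra M e)) (sets (sign_algebra M s))"
    and p: "0 \<le> p" "p < 1" and \<alpha>\<beta>: "0 < \<alpha>" "\<alpha> \<le> \<beta>" "\<beta> < 1"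
  shows "AE \<omega> in M. null_chains (\<lambda>x y. \<exists>l\<in>argmins (e \<omega>) (\<lambda>i. b i \<omega>) x y. s l \<omega>) \<alpha> \<beta>"
proof -
  interpret prob_space M using brownian_excursionD(1)[OF exc] .
  have spP: "space (path_algebra M e) = space M" by (simp add: path_algebra_def)
  have setsP: "sets (path_algebra M e) \<subseteq> sets M" by (rule indep_setD_ev1[OF indF])
  have eP: "(\<lambda>\<omega>. e \<omega> t) \<in> borel_measurable (path_algebra M e)" if "t \<in> {0..1}" for t
  proof -
    have "(\<lambda>\<omega>. \<lambda>t\<in>{0..1}. e \<omega> t) \<in> path_algebra M e \<rightarrow>\<^sub>M Pi\<^sub>M {0..1} (\<lambda>_. borel)"
      unfolding path_algebra_def by (rule measurable_vimage_algebra1) (auto simp: space_PiM)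
    from measurable_compose[OF this measurable_component_singleton[OF that]]
    show ?thesis using that by simp
  qed
  have contP: "continuous_on {0..1} (e \<omega>)" if "\<omega> \<in> space (path_algebra M e)" for \<omega>
    using that brownian_excursionD(3)[OF exc] by (simp add: spP)
  have bM: "b i \<in> borel_measurable M" for i
  proof (rule measurableI)
    fix B :: "real set" assume "B \<in> sets borel"
    from measurable_sets[OF b[of i] this] show "b i -` B \<inter> space M \<in> sets M"
      using setsP by (auto simp: spP)
  qed auto
  have sM: "s i \<in> M \<rightarrow>\<^sub>M count_space UNIV" for i using inds by (auto simp: indep_vars_def)
  show ?thesis
  proof (rule AE_no_chain)
    fix h :: real assume h: "h > 0"
    define Z where "Z l = {w \<in> space (M \<Otimes>\<^sub>M borel). 0 \<le> snd w \<and> snd w \<le> snd w + h \<and> snd w + h \<le> 1 \<and>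
      l \<in> argmins (e (fst w)) (\<lambda>i. b i (fst w)) (snd w) (snd w + h)}" for l
    have Z: "Z l \<in> sets (M \<Otimes>\<^sub>M borel)" for l
      unfolding Z_def
      by (rule sets_argmins[OF brownian_excursionD(2,3)[OF exc] bM]) measurable
    define Y where "Y l = {w \<in> space (M \<Otimes>\<^sub>M borel). \<alpha> \<le> snd w \<and> snd w + h \<le> \<beta> \<and> s l (fst w)}" for l
    have Y: "Y l \<in> sets (M \<Otimes>\<^sub>M borel)" for l
    proof -
      have [measurable]: "Measurable.pred (M \<Otimes>\<^sub>M borel) (\<lambda>w. s l (fst w))"
        by (rule measurable_compose[OF measurable_fst sM])
      show ?thesis unfolding Y_def by measurable
    qed
    have "(\<Union>l. Z l \<inter> Y l) \<in> sets (M \<Otimes>\<^sub>M borel)" using Z Y by blast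
    also have "(\<Union>l. Z l \<inter> Y l) = {(\<omega>, t). \<omega> \<in> space M \<and> \<alpha> \<le> t \<and> t + h \<le> \<beta> \<and>
        (\<exists>l\<in>argmins (e \<omega>) (\<lambda>i. b i \<omega>) t (t + h). s l \<omega>)}"
      using h \<alpha>\<beta> by (fastforce simp: Z_def Y_def space_pair_measure)
    finally show "{(\<omega>, t). \<omega> \<in> space M \<and> \<alpha> \<le> t \<and> t + h \<le> \<beta> \<and>
        (\<exists>l\<in>argmins (e \<omega>) (\<lambda>i. b i \<omega>) t (t + h). s l \<omega>)} \<in> sets (M \<Otimes>\<^sub>M borel)" .
  next
    fix k :: nat and h :: real assume h: "h > 0"
    \<comment> \<open>For almost every t, all k + 1 terms of the progression are almost surely
      generic, so every minimum along it is interior to its interval.\<close>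
    have "AE t in lborel. \<forall>i\<in>{..k}. AE \<omega> in M. t + real i * h \<in> {0<..<1} \<longrightarrow> generic_point (e \<omega>) (t + real i * h)"
      by (intro AE_finite_allI AE_lborel_translate[OF AE_generic_point_swap[OF exc]]) auto
    then show "AE t in lborel. \<alpha> \<le> t \<longrightarrow> t + real k * h \<le> \<beta> \<longrightarrow>
      emeasure M {\<omega> \<in> space M. \<forall>i<k. \<exists>l\<in>argmins (e \<omega>) (\<lambda>i. b i \<omega>) (t + real i * h) (t + real i * h + h). s l \<omega>}
        \<le> ennreal (1 * p ^ k)"
    proof eventually_elim
      case (elim t)
      show ?case
      proof (intro impI)
        assume t: "\<alpha> \<le> t" "t + real k * h \<le> \<beta>"
        have in01: "t + real i * h \<in> {0<..<1}" if "i \<le> k" for i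
        proof -
          have "real i * h \<le> real k * h" using that h by (intro mult_right_mono) auto
          moreover have "0 \<le> real i * h" using h by simp
          ultimately show ?thesis using t \<alpha>\<beta> by auto
        qed
        have suc: "t + real i * h + h = t + real (Suc i) * h" for i by (simp add: algebra_simps)
        have "emeasure M {\<omega> \<in> space M. \<forall>i<k. \<exists>l\<in>argmins (e \<omega>) (\<lambda>i. b i \<omega>) (t + real i * h) (t + real i * h + h). s l \<omega>}
          \<le> ennreal (p ^ k)"
        proof (rule sign_tuple_bound[OF spP indF inds dist p(1)])
          show "p \<le> 1" using p by simp
          \<comment> \<open>Measurability for the path algebra, not merely for M, is essential: the
            signs are independent of the path only.\<close>
          show "{\<omega> \<in> space M. l \<in> argmins (e \<omega>) (\<lambda>i. b i \<omega>) (t + real i * h) (t + real i * h + h)} \<in> sets (path_algebra M e)"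
            if "i < k" for i l
          proof -
            have bounds: "0 \<le> t + real i * h" "t + real i * h \<le> t + real i * h + h" "t + real i * h + h \<le> 1"
              using in01[of i] in01[of "Suc i"] that h unfolding suc by auto
            have "{w \<in> space (path_algebra M e). 0 \<le> t + real i * h \<and> t + real i * h \<le> t + real i * h + h \<and> t + real i * h + h \<le> 1 \<and>
              l \<in> argmins (e w) (\<lambda>i. b i w) (t + real i * h) (t + real i * h + h)} \<in> sets (path_algebra M e)"
              by (rule sets_argmins[OF eP contP b measurable_ident_sets[OF refl],
                where X = "\<lambda>_. t + real i * h" and Y = "\<lambda>_. t + real i * h + h"]) simp_all
            then show ?thesis by (simp only: bounds simp_thms spP)
          qed
          have "AE \<omega> in M. \<forall>i\<in>{..k}. t + real i * h \<in> {0<..<1} \<longrightarrow> generic_point (e \<omega>) (t + real i * h)"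
            using elim by (intro AE_finite_allI) auto
          then show "AE \<omega> in M. \<exists>j. inj_on j {..<k} \<and>
             (\<forall>i<k. argmins (e \<omega>) (\<lambda>i. b i \<omega>) (t + real i * h) (t + real i * h + h) = {j i})"
            using bij AE_inj_on_local_minima[OF exc] AE_space
          proof eventually_elim
            case (elim \<omega>)
            have "\<exists>l. argmins (e \<omega>) (\<lambda>i. b i \<omega>) (t + real i * h) (t + real i * h + h) = {l} \<and>
               t + real i * h < b l \<omega> \<and> b l \<omega> < t + real (Suc i) * h" if "i < k" for i
            proof -
              have mem: "t + real i * h \<in> {0<..<1}" "t + real (Suc i) * h \<in> {0<..<1}"
                using in01[of i] in01[of "Suc i"] that by simp_all
              have gp: "generic_point (e \<omega>) (t + real i * h)" "generic_point (e \<omega>) (t + real (Suc i) * h)"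
                using bspec[OF elim(1), of i] bspec[OF elim(1), of "Suc i"] mem that by simp_all
              have "t + real i * h < t + real (Suc i) * h" using h by simp
              from argmins_generic[OF brownian_excursionD(3)[OF exc elim(4)] elim(2,3) this mem gp]
              obtain l where "argmins (e \<omega>) (\<lambda>i. b i \<omega>) (t + real i * h) (t + real (Suc i) * h) = {l}"
                "t + real i * h < b l \<omega>" "b l \<omega> < t + real (Suc i) * h" by blast
              then show ?thesis unfolding suc by blast
            qed
            then obtain j where j: "\<And>i. i < k \<Longrightarrow> argmins (e \<omega>) (\<lambda>i. b i \<omega>) (t + real i * h) (t + real i * h + h) = {j i} \<and>
               t + real i * h < b (j i) \<omega> \<and> b (j i) \<omega> < t + real (Suc i) * h"
              by metis
            \<comment> \<open>Minimisers lying in disjoint open intervals have different positions,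
              hence different indices.\<close>
            have lt: "j i \<noteq> j i'" if "i < i'" "i' < k" for i i'
            proof -
              have "real (Suc i) * h \<le> real i' * h" using that h by (intro mult_right_mono) auto
              then have "b (j i) \<omega> < b (j i') \<omega>" using j[of i] j[of i'] that by linarith
              then show ?thesis by auto
            qed
            have "inj_on j {..<k}"
              by (rule inj_onI, rule ccontr) (metis lessThan_iff linorder_neqE_nat lt)
            then show ?case using j by blast
          qed
        qed
        then show "emeasure M {\<omega> \<in> space M. \<forall>i<k. \<exists>l\<in>argmins (e \<omega>) (\<lambda>i. b i \<omega>) (t + real i * h) (t + real i * h + h). s l \<omega>}
          \<le> ennreal (1 * p ^ k)" by simp
      qed
    qed
  qed (use p \<alpha>\<beta> in auto)
qed

text \<open>Over the chain, \<psi> is weakly increasing in t. Once the points sharing their value of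
  \<psi> with another point are discarded it is strictly increasing, and \<open>psi_mono\<close>
  then rules out every sign \<ominus>.\<close>

lemma null_chain_of_no_sign_chain:
  fixes f :: "real \<Rightarrow> real" and b :: "nat \<Rightarrow> real" and s :: "nat \<Rightarrow> bool"
  assumes cont: "continuous_on {0..1} f" and b: "bij_betw b UNIV (local_minima f)"
    and inj: "inj_on f (local_minima f)"
    and gen: "AE t in lborel. t \<in> {0<..<1} \<longrightarrow> generic_point f t"
    and nochain: "\<And>m. null_chains (\<lambda>x y. \<exists>l\<in>argmins f b x y. s l) (1 / real (m + 2)) (1 - 1 / real (m + 2))"
    and \<mu>: "\<mu> \<in> permutons" "\<mu> = permuton_of_signed_excursion f b s"
    and C: "closed C" "C \<subseteq> unit_square" "is_chain C"
  shows "measure \<mu> C = 0"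
proof -
  define \<psi> where "\<psi> = psi f b s"
  define L where "L = restrict_space (lborel :: real measure) {0..1}"
  define N where "N = restrict_space (borel :: (real \<times> real) measure) unit_square"
  have \<mu>d: "\<mu> = distr L N (\<lambda>t. (t, \<psi> t))"
    unfolding \<mu>(2) permuton_of_signed_excursion_def L_def N_def \<psi>_def ..
  have spL: "space L = {0..1}" and spN: "space N = unit_square" by (auto simp: L_def N_def space_restrict_space)
  have setsL: "A \<in> sets L \<longleftrightarrow> A \<in> sets borel \<and> A \<subseteq> {0..1}" for A
    unfolding L_def by (subst sets_restrict_space_iff) auto
  have emL: "emeasure L A = emeasure lborel A" if "A \<subseteq> {0..1}" for A
    unfolding L_def using that by (intro emeasure_restrict_space) auto
  have pL: "prob_space L" by (rule prob_spaceI) (simp add: spL emL)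
  have us: "unit_square \<in> sets (borel :: (real \<times> real) measure)" by (intro borel_closed closed_Times) auto
  have \<phi>: "(\<lambda>t. (t, \<psi> t)) \<in> L \<rightarrow>\<^sub>M N"
  proof (rule measurable_of_prob_space_distr[OF pL])
    show "(\<lambda>t. (t, \<psi> t)) \<in> space L \<rightarrow> space N"
      unfolding spL spN using psi_in_unit[of _ f b s] by (auto simp: \<psi>_def)
    show "prob_space (distr L N (\<lambda>t. (t, \<psi> t)))" using permutonD(1)[OF \<mu>(1)] by (simp add: \<mu>d)
  qed
  have em: "emeasure \<mu> B = emeasure lborel {t \<in> {0..1}. (t, \<psi> t) \<in> B}" "{t \<in> {0..1}. (t, \<psi> t) \<in> B} \<in> sets borel"
    if "B \<in> sets borel" "B \<subseteq> unit_square" for B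
  proof -
    have BN: "B \<in> sets N" unfolding N_def using that us by (subst sets_restrict_space_iff) auto
    have eq: "(\<lambda>t. (t, \<psi> t)) -` B \<inter> space L = {t \<in> {0..1}. (t, \<psi> t) \<in> B}" by (auto simp: spL)
    have "emeasure \<mu> B = emeasure L ((\<lambda>t. (t, \<psi> t)) -` B \<inter> space L)"
      unfolding \<mu>d by (rule emeasure_distr[OF \<phi> BN])
    also have "\<dots> = emeasure lborel {t \<in> {0..1}. (t, \<psi> t) \<in> B}" unfolding eq by (rule emL) auto
    finally show "emeasure \<mu> B = emeasure lborel {t \<in> {0..1}. (t, \<psi> t) \<in> B}" .
    show "{t \<in> {0..1}. (t, \<psi> t) \<in> B} \<in> sets borel"
      using measurable_sets[OF \<phi> BN] unfolding eq by (simp add: setsL)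
  qed
  define A where "A = {t \<in> {0..1}. (t, \<psi> t) \<in> C}"
  have Am: "A \<in> sets borel" unfolding A_def by (rule em(2)[OF borel_closed[OF C(1)] C(2)])
  have \<mu>C: "emeasure \<mu> C = emeasure lborel A" unfolding A_def by (rule em(1)[OF borel_closed[OF C(1)] C(2)])
  have le: "\<psi> x \<le> \<psi> y" if "x \<in> A" "y \<in> A" "x < y" for x y
    using C(3) that unfolding is_chain_def A_def by fastforce
  define Lv where "Lv v = {t \<in> {0..1}. \<psi> t = v}" for v
  \<comment> \<open>The level set of v is the preimage of a horizontal line, which has no mass
    because the second marginal is uniform.\<close>
  have Lv: "Lv v \<in> null_sets lborel" for v
  proof -
    define B where "B = {0..1::real} \<times> ({0..1} \<inter> {v})"
    have Bb: "B \<in> sets borel" "B \<subseteq> unit_square" unfolding B_def by (auto intro!: borel_closed closed_Times)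
    have eq: "{t \<in> {0..1}. (t, \<psi> t) \<in> B} = Lv v"
      using psi_in_unit[of _ f b s] by (auto simp: B_def Lv_def \<psi>_def)
    have snd: "snd \<in> \<mu> \<rightarrow>\<^sub>M borel"
      by (rule borel_measurable_permuton[OF \<mu>(1)]) (intro borel_measurable_continuous_onI continuous_on_snd continuous_on_id)
    have "emeasure \<mu> B = emeasure \<mu> (snd -` {v} \<inter> space \<mu>)"
      unfolding permutonD(3)[OF \<mu>(1)] by (intro arg_cong[where f = "emeasure \<mu>"]) (auto simp: B_def)
    also have "\<dots> = emeasure (distr \<mu> borel snd) {v}"
      by (rule emeasure_distr[OF snd, symmetric]) simp
    also have "\<dots> = emeasure (uniform_measure lborel {0..1}) {v}"
      using \<mu>(1) by (simp add: permutons_def)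
    also have "\<dots> = emeasure lborel ({0..1} \<inter> {v}) / emeasure lborel {0..1::real}"
      by (rule emeasure_uniform_measure) auto
    also have "emeasure lborel ({0..1} \<inter> {v}) = 0"
      using emeasure_mono[of "{0..1} \<inter> {v}" "{v}" lborel] by simp
    finally have "emeasure \<mu> B = 0" by simp
    then show ?thesis using em[OF Bb] unfolding eq by (simp add: null_sets_def)
  qed
  \<comment> \<open>The values taken by \<psi> on the chain on both sides of q. Monotonicity leaves
    at most one for each rational q, so only countably many null level sets have to be
    removed.\<close>
  define V where "V q = {v. \<exists>x\<in>A. \<exists>y\<in>A. x < real_of_rat q \<and> real_of_rat q < y \<and> \<psi> x = v \<and> \<psi> y = v}" for q
  have Vun: "v = w" if "v \<in> V q" "w \<in> V q" for v w q
  proof -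
    obtain x y where xy: "x \<in> A" "y \<in> A" "x < real_of_rat q" "real_of_rat q < y" "\<psi> x = v" "\<psi> y = v"
      using \<open>v \<in> V q\<close> by (auto simp: V_def)
    obtain x' y' where xy': "x' \<in> A" "y' \<in> A" "x' < real_of_rat q" "real_of_rat q < y'" "\<psi> x' = w" "\<psi> y' = w"
      using \<open>w \<in> V q\<close> by (auto simp: V_def)
    have "\<psi> x \<le> \<psi> y'" "\<psi> x' \<le> \<psi> y" using le[OF xy(1) xy'(2)] le[OF xy'(1) xy(2)] xy xy' by simp_all
    then show ?thesis using xy xy' by simp
  qed
  define NN where "NN = (\<Union>q. if V q = {} then {} else Lv (SOME v. v \<in> V q))"
  have NN: "NN \<in> null_sets lborel" unfolding NN_def by (intro null_sets_UN) (auto simp: Lv)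
  obtain N0 where N0: "{t \<in> space lborel. \<not> (t \<in> {0<..<1} \<longrightarrow> generic_point f t)} \<subseteq> N0" "N0 \<in> null_sets lborel"
    using gen unfolding eventually_ae_filter by blast
  define A' where "A' = A - (NN \<union> N0 \<union> {0, 1})"
  have null: "NN \<union> N0 \<union> {0, 1} \<in> null_sets lborel"
    by (rule null_sets.Un[OF null_sets.Un[OF NN N0(2)] finite_imp_null_set_lborel]) simp
  have A'A: "emeasure lborel A' = emeasure lborel A"
    unfolding A'_def using null Am by (intro emeasure_Diff_null_set) auto
  have A'm: "A' \<in> sets borel" unfolding A'_def using Am null by (auto simp: null_sets_def)
  have A'gen: "x \<in> {0<..<1}" "generic_point f x" if "x \<in> A'" for x
  proof -
    show x: "x \<in> {0<..<1}" using that by (auto simp: A'_def A_def)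
    show "generic_point f x" using that N0(1) x by (auto simp: A'_def)
  qed
  have plus: "\<exists>l\<in>argmins f b x y. s l" if xy: "x \<in> A'" "y \<in> A'" "x < y" for x y
  proof -
    have xyA: "x \<in> A" "y \<in> A" using xy by (auto simp: A'_def)
    have "\<psi> x \<noteq> \<psi> y"
    proof
      assume eq: "\<psi> x = \<psi> y"
      obtain q where q: "x < real_of_rat q" "real_of_rat q < y" using of_rat_dense[OF xy(3)] by blast
      then have Vq: "\<psi> x \<in> V q" using xyA eq by (auto simp: V_def)
      then have "(SOME v. v \<in> V q) = \<psi> x" using Vun[OF _ Vq] someI[of "\<lambda>v. v \<in> V q", OF Vq] by blast
      then have "x \<in> NN" using Vq xyA(1) unfolding NN_def by (intro UN_I[of q]) (auto simp: Lv_def A_def)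
      then show False using xy(1) by (simp add: A'_def)
    qed
    then have lt: "\<psi> x < \<psi> y" using le[OF xyA xy(3)] by simp
    obtain j where j: "argmins f b x y = {j}"
      using argmins_generic[OF cont b inj xy(3) A'gen(1)[OF xy(1)] A'gen(1)[OF xy(2)] A'gen(2)[OF xy(1)] A'gen(2)[OF xy(2)]] by blast
    have "s j"
    proof (rule ccontr)
      assume "\<not> s j"
      then have "\<psi> y \<le> \<psi> x" unfolding \<psi>_def
        using j A'gen(1)[OF xy(2)] by (intro psi_mono[OF b inj xy(3), of j]) auto
      then show False using lt by simp
    qed
    then show ?thesis using j by blast
  qed
  \<comment> \<open>All pairs of A' have sign \<oplus>, whatever their distance, so the scale \<eta>
    = 1 is admissible.\<close>
  have part: "emeasure lborel (A' \<inter> {1 / real (m + 2)..1 - 1 / real (m + 2)}) = 0" for m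
    by (rule nochain[unfolded null_chains_def, rule_format, of _ m 1]) (use A'm plus in auto)
  have "A' \<subseteq> (\<Union>m. A' \<inter> {1 / real (m + 2)..1 - 1 / real (m + 2)})"
  proof
    fix x assume x: "x \<in> A'"
    then have "0 < min x (1 - x)" using A'gen(1) by auto
    then obtain m where "inverse (real (Suc m)) < min x (1 - x)" using reals_Archimedean by blast
    moreover have "1 / real (m + 2) \<le> inverse (real (Suc m))" by (simp add: inverse_eq_divide field_simps)
    ultimately have "x \<in> {1 / real (m + 2)..1 - 1 / real (m + 2)}" by auto
    then show "x \<in> (\<Union>m. A' \<inter> {1 / real (m + 2)..1 - 1 / real (m + 2)})" using x by blast
  qed
  note sub = this
  have "(\<Union>m. A' \<inter> {1 / real (m + 2)..1 - 1 / real (m + 2)}) \<in> null_sets lborel"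
    using part A'm by (intro null_sets_UN) (auto simp: null_sets_def)
  from null_sets_subset[OF this _ sub] have "emeasure lborel A' = 0" using A'm by (simp add: null_sets_def)
  then have "emeasure \<mu> C = 0" using A'A \<mu>C by simp
  then show ?thesis by (simp add: measure_def)
qed

section \<open>From null chains to the longest increasing subsequence\<close>

lemma AE_permuton_null_chain:
  assumes p: "0 \<le> p" "p < 1" and X: "brownian_separable_permuton p M X"
  shows "AE \<omega> in M. X \<omega> \<in> permutons \<and> (\<forall>C. closed C \<longrightarrow> C \<subseteq> unit_square \<longrightarrow> is_chain C \<longrightarrow> measure (X \<omega>) C = 0)"
proof -
  obtain e b s where exc: "brownian_excursion M e"
    and b: "\<And>i. b i \<in> borel_measurable (path_algebra M e)"
    and bij: "AE \<omega> in M. bij_betw (\<lambda>i. b i \<omega>) UNIV (local_minima (e \<omega>))"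
    and inds: "prob_space.indep_vars M (\<lambda>_. count_space UNIV) s UNIV"
    and dist: "\<And>i. distr M (count_space UNIV) (s i) = measure_pmf (bernoulli_pmf p)"
    and indF: "prob_space.indep_set M (sets (path_algebra M e)) (sets (sign_algebra M s))"
    and Xeq: "AE \<omega> in M. X \<omega> = permuton_of_signed_excursion (e \<omega>) (\<lambda>i. b i \<omega>) (\<lambda>i. s i \<omega>)"
    using X unfolding brownian_separable_permuton_def by blast
  have XM: "X \<in> M \<rightarrow>\<^sub>M permuton_borel" using X unfolding brownian_separable_permuton_def by blast
  have "space permuton_borel = permutons"
    unfolding permuton_borel_def by (rule space_measure_of) (use openin_subset topspace_permuton_topology in blast)
  then have Xperm: "X \<omega> \<in> permutons" if "\<omega> \<in> space M" for \<omega>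
    using measurable_space[OF XM that] by simp
  have "AE \<omega> in M. \<forall>m. null_chains (\<lambda>x y. \<exists>l\<in>argmins (e \<omega>) (\<lambda>i. b i \<omega>) x y. s l \<omega>) (1 / real (m + 2)) (1 - 1 / real (m + 2))"
    unfolding AE_all_countable
  proof
    fix m
    show "AE \<omega> in M. null_chains (\<lambda>x y. \<exists>l\<in>argmins (e \<omega>) (\<lambda>i. b i \<omega>) x y. s l \<omega>) (1 / real (m + 2)) (1 - 1 / real (m + 2))"
      by (rule AE_no_sign_chain[OF exc b bij inds dist indF p]) (auto simp: field_simps)
  qed
  then show ?thesis
    using bij AE_inj_on_local_minima[OF exc] AE_generic_point[OF exc] Xeq AE_space
  proof eventually_elim
    case (elim \<omega>)
    show ?case
    proof (intro conjI allI impI)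
      show X\<omega>: "X \<omega> \<in> permutons" using Xperm elim(6) by blast
      fix C assume C: "closed C" "C \<subseteq> unit_square" "is_chain C"
      show "measure (X \<omega>) C = 0"
        by (rule null_chain_of_no_sign_chain[OF brownian_excursionD(3)[OF exc elim(6)] elim(2,3,4) _ X\<omega> elim(5) C])
          (use elim(1) in blast)
    qed
  qed
qed

lemma chain_mass_tendsto_0:
  assumes \<mu>: "\<mu> \<in> permutons"
    and null: "\<And>C. closed C \<Longrightarrow> C \<subseteq> unit_square \<Longrightarrow> is_chain C \<Longrightarrow> measure \<mu> C = 0"
  shows "(\<lambda>m. chain_mass m \<mu>) \<longlonglongrightarrow> 0"
proof (rule LIMSEQ_I)
  fix c :: real assume c: "c > 0"
  have "finite {m. m > 0 \<and> c \<le> chain_mass m \<mu>}"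
  proof (rule ccontr)
    assume "infinite {m. m > 0 \<and> c \<le> chain_mass m \<mu>}"
    then obtain C where "closed C" "C \<subseteq> unit_square" "is_chain C" "c \<le> measure \<mu> C"
      using chain_mass_limit[OF \<mu>] by blast
    then show False using null[of C] c by simp
  qed
  then obtain m0 where m0: "\<forall>m\<in>{m. m > 0 \<and> c \<le> chain_mass m \<mu>}. m < m0"
    unfolding finite_nat_set_iff_bounded by (rule exE)
  have "norm (chain_mass m \<mu> - 0) < c" if "m \<ge> Suc m0" for m
  proof -
    have "\<not> c \<le> chain_mass m \<mu>"
    proof
      assume "c \<le> chain_mass m \<mu>"
      then have "m < m0" using bspec[OF m0, of m] that by simp
      then show False using that by simp
    qed
    then show ?thesis using chain_mass_nonneg[of m \<mu>] by simp
  qed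
  then show "\<exists>no. \<forall>m\<ge>no. norm (chain_mass m \<mu> - 0) < c" by blast
qed

theorem theorem1p10:
  fixes p :: real
    and P :: "nat \<Rightarrow> 'a measure" and \<sigma> :: "nat \<Rightarrow> 'a \<Rightarrow> nat \<Rightarrow> nat"
    and Q :: "'b measure" and X :: "'b \<Rightarrow> (real \<times> real) measure"
  assumes "0 \<le> p" and "p < 1"
    and "\<And>n. n \<ge> 1 \<Longrightarrow> random_permutation n (P n) (\<sigma> n)"
    and "brownian_separable_permuton p Q X"
    and "converges_in_distribution permuton_topology
           P (\<lambda>n \<omega>. permuton_of_perm n (\<sigma> n \<omega>)) Q X"
  shows "\<forall>\<epsilon>>0. (\<lambda>n. measure (P n)
           {\<omega> \<in> space (P n). \<bar>real (LIS n (\<sigma> n \<omega>)) / real n\<bar> > \<epsilon>}) \<longlonglongrightarrow> 0"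
proof (intro allI impI)
  fix \<epsilon> :: real assume \<epsilon>: "\<epsilon> > 0"
  interpret Q: prob_space Q using assms(4) by (simp add: brownian_separable_permuton_def)
  have XM: "X \<in> Q \<rightarrow>\<^sub>M permuton_borel" using assms(4) by (simp add: brownian_separable_permuton_def)
  have AEX: "AE \<omega> in Q. X \<omega> \<in> permutons \<and> (\<forall>C. closed C \<longrightarrow> C \<subseteq> unit_square \<longrightarrow> is_chain C \<longrightarrow> measure (X \<omega>) C = 0)"
    by (rule AE_permuton_null_chain[OF assms(1,2,4)])
  have "(\<lambda>m. \<integral>\<omega>. chain_mass m (X \<omega>) \<partial>Q) \<longlonglongrightarrow> (\<integral>\<omega>. 0 \<partial>Q)"
  proof (rule integral_dominated_convergence[where w = "\<lambda>_. 1"])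
    show "(\<lambda>\<omega>. chain_mass m (X \<omega>)) \<in> borel_measurable Q" for m
      by (rule measurable_compose[OF XM measurable_permuton_borel_continuous[OF continuous_chain_mass]])
    show "AE \<omega> in Q. (\<lambda>m. chain_mass m (X \<omega>)) \<longlonglongrightarrow> 0"
      using AEX by eventually_elim (rule chain_mass_tendsto_0; blast)
    show "AE \<omega> in Q. norm (chain_mass m (X \<omega>)) \<le> 1" for m
      using AEX by eventually_elim (simp add: chain_mass_nonneg chain_mass_le_1)
  qed auto
  then have lim0: "(\<lambda>m. \<integral>\<omega>. chain_mass m (X \<omega>) \<partial>Q) \<longlonglongrightarrow> 0" by simp
  show "(\<lambda>n. measure (P n) {\<omega> \<in> space (P n). \<bar>real (LIS n (\<sigma> n \<omega>)) / real n\<bar> > \<epsilon>}) \<longlonglongrightarrow> 0"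
  proof (rule LIMSEQ_I)
    fix \<delta> :: real assume \<delta>: "\<delta> > 0"
    \<comment> \<open>The target \<delta> * \<epsilon> anticipates Markov's inequality at level
      \<epsilon>. From here on m is fixed.\<close>
    have "\<forall>\<^sub>F m in sequentially. (\<integral>\<omega>. chain_mass m (X \<omega>) \<partial>Q) < \<delta> * \<epsilon>"
      using lim0 \<delta> \<epsilon> by (intro order_tendstoD) auto
    then obtain m where m: "m > 0" "(\<integral>\<omega>. chain_mass m (X \<omega>) \<partial>Q) < \<delta> * \<epsilon>"
      unfolding eventually_sequentially by (metis le_Suc_eq nat_le_linear zero_less_Suc)
    have "(\<lambda>n. \<integral>\<omega>. chain_mass m (permuton_of_perm n (\<sigma> n \<omega>)) \<partial>P n) \<longlonglongrightarrow> (\<integral>\<omega>. chain_mass m (X \<omega>) \<partial>Q)"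
    proof (rule assms(5)[unfolded converges_in_distribution_def, rule_format], intro conjI)
      show "continuous_map permuton_topology euclideanreal (chain_mass m)" by (rule continuous_chain_mass)
      show "bounded (chain_mass m ` topspace permuton_topology)"
        unfolding topspace_permuton_topology
        by (rule boundedI[of _ 1]) (auto simp: chain_mass_nonneg chain_mass_le_1)
    qed
    then have "\<forall>\<^sub>F n in sequentially. (\<integral>\<omega>. chain_mass m (permuton_of_perm n (\<sigma> n \<omega>)) \<partial>P n) < \<delta> * \<epsilon>"
      using m(2) by (rule order_tendstoD)
    then obtain n0 where n0: "\<And>n. n \<ge> n0 \<Longrightarrow> (\<integral>\<omega>. chain_mass m (permuton_of_perm n (\<sigma> n \<omega>)) \<partial>P n) < \<delta> * \<epsilon>"
      unfolding eventually_sequentially by blast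
    have "norm (measure (P n) {\<omega> \<in> space (P n). \<bar>real (LIS n (\<sigma> n \<omega>)) / real n\<bar> > \<epsilon>} - 0) < \<delta>"
      if n: "n \<ge> max n0 (2 * m)" for n
    proof -
      have n1: "n \<ge> 1" using n m by simp
      define S where "S = {\<pi>. \<pi> permutes {1..n}}"
      \<comment> \<open>Only finitely many permutations occur, so functions of
        \<open>\<sigma> n\<close> are measurable on the discrete space S and bounded by a
        maximum.\<close>
      have finS: "finite S" unfolding S_def by (rule finite_permutations) simp
  let ?B = "Max ((\<lambda>\<pi>. chain_mass m (permuton_of_perm n \<pi>)) ` S)"
      interpret Pn: prob_space "P n" using assms(3)[OF n1] by (simp add: random_permutation_def)
      have \<sigma>M: "\<sigma> n \<in> P n \<rightarrow>\<^sub>M count_space S" using assms(3)[OF n1] by (simp add: random_permutation_def S_def)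
      have \<sigma>S: "\<sigma> n \<omega> \<in> S" if "\<omega> \<in> space (P n)" for \<omega> using measurable_space[OF \<sigma>M that] by simp
      define F where "F \<omega> = chain_mass m (permuton_of_perm n (\<sigma> n \<omega>))" for \<omega>
      have FM: "F \<in> borel_measurable (P n)"
        unfolding F_def[abs_def] by (rule measurable_compose[OF \<sigma>M]) simp
      define E where "E = {\<omega> \<in> space (P n). \<bar>real (LIS n (\<sigma> n \<omega>)) / real n\<bar> > \<epsilon>}"
      have EM: "E \<in> sets (P n)"
      proof -
        have "(\<lambda>\<omega>. \<bar>real (LIS n (\<sigma> n \<omega>)) / real n\<bar> > \<epsilon>) \<in> P n \<rightarrow>\<^sub>M count_space UNIV"
          by (rule measurable_compose[OF \<sigma>M]) simp
        then show ?thesis unfolding E_def by (rule predE)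
      qed
      have Fint: "integrable (P n) F"
      proof (rule Pn.integrable_const_bound[where B = "?B"])
        show "AE \<omega> in P n. norm (F \<omega>) \<le> ?B"
        proof (rule AE_I2)
          fix \<omega> assume "\<omega> \<in> space (P n)"
          then have "F \<omega> \<le> ?B"
            unfolding F_def using \<sigma>S finS by (intro Max_ge) auto
          then show "norm (F \<omega>) \<le> ?B"
            using chain_mass_nonneg by (simp add: F_def)
        qed
      qed (rule FM)
      have Eint: "integrable (P n) (\<lambda>\<omega>. \<epsilon> * indicator E \<omega> :: real)"
        using EM by (intro integrable_mult_right integrable_real_indicator) (auto simp: less_top[symmetric])
      \<comment> \<open>Markov's inequality, with F dominating the normalised length of the longest
        increasing subsequence.\<close>
      have "\<epsilon> * measure (P n) E = (\<integral>\<omega>. \<epsilon> * indicator E \<omega> \<partial>P n)"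
        using EM by simp
      also have "\<dots> \<le> (\<integral>\<omega>. F \<omega> \<partial>P n)"
      proof (rule integral_mono[OF Eint Fint])
        fix \<omega> assume \<omega>: "\<omega> \<in> space (P n)"
        have "real (LIS n (\<sigma> n \<omega>)) / real n \<le> F \<omega>"
          unfolding F_def using n m \<sigma>S[OF \<omega>] by (intro LIS_le_chain_mass) (auto simp: S_def)
        then show "\<epsilon> * indicator E \<omega> \<le> F \<omega>"
          using chain_mass_nonneg[of m] by (auto simp: E_def F_def indicator_def)
      qed
      also have "\<dots> < \<delta> * \<epsilon>" unfolding F_def using n by (intro n0) simp
      finally have "measure (P n) E < \<delta>" using \<epsilon> by (simp add: mult.commute)
      then show ?thesis unfolding E_def[symmetric] by simp
    qed
    then show "\<exists>no. \<forall>n\<ge>no. norm (measure (P n) {\<omega> \<in> space (P n). \<bar>real (LIS n (\<sigma> n \<omega>)) / real n\<bar> > \<epsilon>} - 0) < \<delta>"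
      by blast
  qed
qed

end
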